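(* Restriction of ideals, $J\mapsto J\cap\mathrm{S}(W_{\geq-1})$, induces a bijection between prime Poisson ideals of $\mathrm{S}(W)$ and prime Poisson ideals of $\mathrm{S}(W_{\geq-1})$, and a bijection between irreducible closed subsets of $\mathrm{PSpec}_{\mathrm{prim}}\mathrm{S}(W_{\geq-1})$ and of $\mathrm{PSpec}_{\mathrm{prim}}\mathrm{S}(W)$.
   Context: $\Bbbk$ is an uncountable algebraically closed field of characteristic $0$; $\partial=d/dt$. $W=\Bbbk[t,t^{-1}]\partial$ with $[f\partial,g\partial]=(fg'-f'g)\partial$, and $W_{\geq-1}=\Bbbk[t]\partial\subset W$. For a Lie algebra $\mathfrak g$, $\mathrm{S}(\mathfrak g)$ is a Poisson algebra with bracket extending $\{u,v\}=[u,v]$; a Poisson ideal is an ideal $I$ with $\{I,\mathrm{S}(\mathfrak g)\}\subseteq I$. A Poisson ideal is Poisson primitive if it is the largest Poisson ideal contained in some maximal ideal of $\mathrm{S}(\mathfrak g)$ (such ideals are prime). $\mathrm{PSpec}_{\mathrm{prim}}\mathrm{S}(\mathfrak g)$ is the set of Poisson primitive ideals with the Zariski topology, whose closed sets are the sets of Poisson primitive ideals containing a given Poisson ideal. *)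

theory Defs
  imports
    "HOL-Library.Countable_Set"
    "HOL-Computational_Algebra.Polynomial"
    "HOL-Library.Poly_Mapping"
    "HOL-Algebra.QuotRing"
    "HOL-Analysis.Abstract_Topology"
begin

section \<open>Linear algebra on finitely supported functions\<close>

text \<open>
  A vector space with basis indexed by \<^typ>\<open>'x\<close> is the type \<open>'x \<Rightarrow>\<^sub>0 'k\<close>;
  the basis vector with index \<open>x\<close> is \<open>Poly_Mapping.single x 1\<close>.
\<close>

definition scal :: "'k::comm_ring_1 \<Rightarrow> ('x \<Rightarrow>\<^sub>0 'k) \<Rightarrow> ('x \<Rightarrow>\<^sub>0 'k)" where
  "scal c v = Poly_Mapping.map ((*) c) v"

lemma lookup_scal [simp]: "Poly_Mapping.lookup (scal c v) x = c * Poly_Mapping.lookup v x"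
  unfolding scal_def by (transfer) (auto simp: when_def)

lemma scal_single [simp]: "scal c (Poly_Mapping.single x a) = Poly_Mapping.single x (c * a)"
  by (rule poly_mapping_eqI) (auto simp: lookup_single when_def)

lemma scal_conv_mult: "scal c p = Poly_Mapping.single 0 c * p"
  unfolding scal_def by (rule mult_map_scale_conv_mult)

lemma scal_add: "scal c (v + w) = scal c v + scal c w"
  by (rule poly_mapping_eqI) (simp add: lookup_add algebra_simps)

lemma poly_mapping_sum_singles:
  fixes v :: "'x \<Rightarrow>\<^sub>0 'b::comm_monoid_add"
  shows "(\<Sum>x\<in>Poly_Mapping.keys v. Poly_Mapping.single x (Poly_Mapping.lookup v x)) = v"
proof (rule poly_mapping_eqI)
  fix y
  show "Poly_Mapping.lookup (\<Sum>x\<in>Poly_Mapping.keys v. Poly_Mapping.single x (Poly_Mapping.lookup v x)) y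
    = Poly_Mapping.lookup v y"
    by (simp add: lookup_sum lookup_single when_def sum.delta in_keys_iff)
qed

lemma poly_mapping_single_induct [case_names zero single add]:
  fixes v :: "'x \<Rightarrow>\<^sub>0 'b::comm_monoid_add"
  assumes "P 0" "\<And>x c. x \<in> Poly_Mapping.keys v \<Longrightarrow> P (Poly_Mapping.single x c)"
    and "\<And>p q. P p \<Longrightarrow> P q \<Longrightarrow> P (p + q)"
  shows "P v"
proof -
  have "P (\<Sum>x\<in>S. Poly_Mapping.single x (Poly_Mapping.lookup v x))"
    if "finite S" "S \<subseteq> Poly_Mapping.keys v" for S
    using that by (induction S rule: finite_induct) (auto intro: assms)
  from this[of "Poly_Mapping.keys v"] show ?thesis by (simp add: poly_mapping_sum_singles)
qed

definition additive_map :: "('a::monoid_add \<Rightarrow> 'b::monoid_add) \<Rightarrow> bool" where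
  "additive_map f \<longleftrightarrow> (\<forall>u v. f (u + v) = f u + f v)"

lemma additive_mapD: "additive_map f \<Longrightarrow> f (u + v) = f u + f v"
  by (simp add: additive_map_def)

lemma additive_map_0:
  fixes f :: "'a::monoid_add \<Rightarrow> 'b::group_add"
  assumes "additive_map f" shows "f 0 = 0"
  using additive_mapD[OF assms, of 0 0] by (metis add.right_neutral add_left_cancel)

lemma additive_map_sum:
  fixes f :: "'a::comm_monoid_add \<Rightarrow> 'b::ab_group_add"
  assumes "additive_map f" shows "f (\<Sum>x\<in>A. g x) = (\<Sum>x\<in>A. f (g x))"
  by (induction A rule: infinite_finite_induct)
    (auto simp: additive_map_0[OF assms] additive_mapD[OF assms])

lemma additive_map_eqI:
  fixes f g :: "('x \<Rightarrow>\<^sub>0 'b::comm_monoid_add) \<Rightarrow> 'c::ab_group_add"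
  assumes "additive_map f" "additive_map g"
    and "\<And>x c. f (Poly_Mapping.single x c) = g (Poly_Mapping.single x c)"
  shows "f p = g p"
  by (induction p rule: poly_mapping_single_induct)
    (simp_all add: assms additive_map_0 additive_mapD[OF assms(1)] additive_mapD[OF assms(2)])

definition additive_ext :: "('x \<Rightarrow> 'b::comm_monoid_add \<Rightarrow> 'c::comm_monoid_add) \<Rightarrow> ('x \<Rightarrow>\<^sub>0 'b) \<Rightarrow> 'c" where
  "additive_ext f p = (\<Sum>x\<in>Poly_Mapping.keys p. f x (Poly_Mapping.lookup p x))"

lemma additive_ext_single:
  assumes "\<And>x. f x 0 = 0"
  shows "additive_ext f (Poly_Mapping.single x c) = f x c"
  using assms by (simp add: additive_ext_def)

lemma additive_ext_additive:
  assumes "\<And>x. f x 0 = 0" "\<And>x a b. f x (a + b) = f x a + f x b"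
  shows "additive_map (additive_ext f)"
  unfolding additive_map_def additive_ext_def
  by (intro allI setsum_keys_plus_distrib) (auto simp: assms)


section \<open>Lie algebras and the Witt algebra\<close>

definition lie_bracket :: "(('x \<Rightarrow>\<^sub>0 'k::comm_ring_1) \<Rightarrow> ('x \<Rightarrow>\<^sub>0 'k) \<Rightarrow> ('x \<Rightarrow>\<^sub>0 'k)) \<Rightarrow> bool" where
  "lie_bracket br \<longleftrightarrow>
     (\<forall>u v w. br (u + v) w = br u w + br v w) \<and> (\<forall>u v w. br u (v + w) = br u v + br u w) \<and>
     (\<forall>c u v. br (scal c u) v = scal c (br u v)) \<and> (\<forall>c u v. br u (scal c v) = scal c (br u v)) \<and>
     (\<forall>u. br u u = 0) \<and> (\<forall>u v w. br u (br v w) + br v (br w u) + br w (br u v) = 0)"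

text \<open>
  The Laurent polynomial ring \<open>k[t,t\<^sup>-\<^sup>1]\<close> is the group algebra of the integers, that is,
  \<open>int \<Rightarrow>\<^sub>0 'k\<close> with convolution as product, \<open>Poly_Mapping.single n 1\<close> being \<open>t\<^sup>n\<close>.
  The vector field \<open>f\<partial>\<close> is represented by its coefficient \<open>f\<close>.
\<close>

type_synonym 'k witt = "int \<Rightarrow>\<^sub>0 'k"

definition laurent_deriv :: "(int \<Rightarrow>\<^sub>0 'k::comm_ring_1) \<Rightarrow> (int \<Rightarrow>\<^sub>0 'k)" where
  "laurent_deriv f =
     (\<Sum>n\<in>Poly_Mapping.keys f. Poly_Mapping.single (n - 1) (of_int n * Poly_Mapping.lookup f n))"

definition witt_bracket :: "'k::comm_ring_1 witt \<Rightarrow> 'k witt \<Rightarrow> 'k witt" where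
  "witt_bracket f g = f * laurent_deriv g - laurent_deriv f * g"

text \<open>\<open>k[t]\<partial>\<close> inside \<open>k[t,t\<^sup>-\<^sup>1]\<partial>\<close>: only non-negative exponents of \<open>t\<close>.\<close>

definition W_ge :: "'k::comm_ring_1 witt set" where
  "W_ge = {f. Poly_Mapping.keys f \<subseteq> {0..}}"

lemma laurent_deriv_ext:
  "laurent_deriv = additive_ext (\<lambda>n c. Poly_Mapping.single (n - 1) (of_int n * c))"
  by (simp add: fun_eq_iff laurent_deriv_def additive_ext_def)

lemma laurent_deriv_single:
  "laurent_deriv (Poly_Mapping.single n c) = Poly_Mapping.single (n - 1) (of_int n * c)"
  unfolding laurent_deriv_ext by (rule additive_ext_single) simp

lemma laurent_deriv_add: "laurent_deriv (f + g) = laurent_deriv f + laurent_deriv g"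
  unfolding laurent_deriv_ext
  by (rule additive_mapD[OF additive_ext_additive]) (simp_all add: single_add algebra_simps)

lemma laurent_deriv_diff: "laurent_deriv (f - g) = laurent_deriv f - laurent_deriv g"
  by (metis add_diff_cancel diff_add_cancel laurent_deriv_add)

lemma laurent_deriv_mult: "laurent_deriv (f * g) = f * laurent_deriv g + laurent_deriv f * g"
proof -
  have *: "additive_map (\<lambda>g. laurent_deriv (f * g))"
    "additive_map (\<lambda>g. f * laurent_deriv g + laurent_deriv f * g)"
    "additive_map (\<lambda>f. laurent_deriv (f * g))"
    "additive_map (\<lambda>f. f * laurent_deriv g + laurent_deriv f * g)" for f g :: "'a witt"
    by (simp_all add: additive_map_def laurent_deriv_add algebra_simps)
  show ?thesis
    apply (rule additive_map_eqI[OF *(3) *(4)])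
    apply (rule additive_map_eqI[OF *(1) *(2)])
    apply (simp add: laurent_deriv_single mult_single algebra_simps flip: single_add)
    done
qed

lemma laurent_deriv_scal: "laurent_deriv (scal c f) = scal c (laurent_deriv f)"
  by (simp add: scal_conv_mult laurent_deriv_mult laurent_deriv_single)

lemma lie_bracket_witt: "lie_bracket witt_bracket"
  unfolding lie_bracket_def witt_bracket_def
  by (auto simp: laurent_deriv_add laurent_deriv_diff laurent_deriv_scal laurent_deriv_mult algebra_simps
      scal_conv_mult laurent_deriv_single)


section \<open>Symmetric algebras\<close>

text \<open>
  The symmetric algebra of a vector space with a given basis is realised as the polynomial ring on
  that basis: a monomial is an exponent function \<open>'x \<Rightarrow>\<^sub>0 nat\<close>.  The lemmas
  \<open>sym_universal_exists\<close> and \<open>sym_universal_unique\<close> below are its universal property.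
\<close>

type_synonym ('x, 'k) sym = "('x \<Rightarrow>\<^sub>0 nat) \<Rightarrow>\<^sub>0 'k"

definition sym_const :: "'k::comm_ring_1 \<Rightarrow> ('x, 'k) sym" where
  "sym_const c = Poly_Mapping.single 0 c"

definition sym_embed :: "('x \<Rightarrow>\<^sub>0 'k::comm_ring_1) \<Rightarrow> ('x, 'k) sym" where
  "sym_embed v = (\<Sum>x\<in>Poly_Mapping.keys v.
     Poly_Mapping.single (Poly_Mapping.single x 1) (Poly_Mapping.lookup v x))"

inductive_set sym_span :: "('x \<Rightarrow>\<^sub>0 'k::comm_ring_1) set \<Rightarrow> ('x, 'k) sym set"
  for U :: "('x \<Rightarrow>\<^sub>0 'k) set" where
  const: "sym_const c \<in> sym_span U"
| embed: "u \<in> U \<Longrightarrow> sym_embed u \<in> sym_span U"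
| add: "p \<in> sym_span U \<Longrightarrow> q \<in> sym_span U \<Longrightarrow> p + q \<in> sym_span U"
| mult: "p \<in> sym_span U \<Longrightarrow> q \<in> sym_span U \<Longrightarrow> p * q \<in> sym_span U"

text \<open>
  For a subspace \<open>U\<close>, the algebra \<open>S(U)\<close> is the subalgebra of the ambient symmetric algebra
  generated by \<open>U\<close>.  For coordinate subspaces such as \<open>W_ge\<close>, the universal property is again
  \<open>sym_universal_exists\<close> and \<open>sym_universal_unique\<close>.
\<close>

definition sym_ring :: "('x \<Rightarrow>\<^sub>0 'k::comm_ring_1) set \<Rightarrow> ('x, 'k) sym ring" where
  "sym_ring U = \<lparr>carrier = sym_span U, monoid.mult = (*), one = 1, ring.zero = 0, add = (+)\<rparr>"

lemma sym_ring_simps [simp]: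
  "carrier (sym_ring U) = sym_span U"
  "monoid.mult (sym_ring U) = (*)" "one (sym_ring U) = 1"
  "ring.zero (sym_ring U) = 0" "add (sym_ring U) = (+)"
  by (simp_all add: sym_ring_def)

lemma sym_const_0 [simp]: "sym_const 0 = 0"
  and sym_const_1 [simp]: "sym_const 1 = 1"
  and sym_const_add: "sym_const (a + b) = sym_const a + sym_const b"
  and sym_const_mult: "sym_const (a * b) = sym_const a * sym_const b"
  and sym_const_uminus: "sym_const (- a) = - sym_const a"
  by (simp_all add: sym_const_def single_add mult_single single_uminus)

lemma sym_const_mult_single [simp]:
  "sym_const c * Poly_Mapping.single m a = Poly_Mapping.single m (c * a)"
  "Poly_Mapping.single m a * sym_const c = Poly_Mapping.single m (a * c)"
  by (simp_all add: sym_const_def mult_single)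

lemma scal_conv_sym_const: "scal c p = sym_const c * p"
  by (simp add: scal_conv_mult sym_const_def)

lemma sym_embed_ext:
  "sym_embed = additive_ext (\<lambda>x. Poly_Mapping.single (Poly_Mapping.single x 1))"
  by (simp add: fun_eq_iff sym_embed_def additive_ext_def)

lemma sym_embed_single:
  "sym_embed (Poly_Mapping.single x c) = Poly_Mapping.single (Poly_Mapping.single x 1) c"
  unfolding sym_embed_ext by (rule additive_ext_single) simp

lemma additive_map_sym_embed: "additive_map sym_embed"
  unfolding sym_embed_ext by (rule additive_ext_additive) (simp_all add: single_add)

lemmas sym_embed_add = additive_mapD[OF additive_map_sym_embed]

lemma sym_embed_0 [simp]: "sym_embed 0 = 0"
  by (rule additive_map_0[OF additive_map_sym_embed])

lemma sym_embed_uminus: "sym_embed (- v) = - sym_embed v"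
  using sym_embed_add[of v "- v"] by (simp add: eq_neg_iff_add_eq_0 add.commute)

lemma sym_embed_scal: "sym_embed (scal c v) = sym_const c * sym_embed v"
proof -
  have "additive_map (\<lambda>v. sym_embed (scal c v))" "additive_map (\<lambda>v. sym_const c * sym_embed v)"
    by (simp_all add: additive_map_def scal_add sym_embed_add algebra_simps)
  thus ?thesis by (rule additive_map_eqI) (simp add: sym_embed_single)
qed

lemma sym_embed_inj: "inj sym_embed"
proof (rule injI, rule poly_mapping_eqI)
  fix v w :: "'x \<Rightarrow>\<^sub>0 'k::comm_ring_1" and x
  have "Poly_Mapping.lookup (sym_embed v) (Poly_Mapping.single x 1) = Poly_Mapping.lookup v x" for v :: "'x \<Rightarrow>\<^sub>0 'k"
  proof -
    have "(Poly_Mapping.single y (1::nat) = Poly_Mapping.single x 1) \<longleftrightarrow> y = x" for y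
      by (metis inj_single injD lookup_single_eq lookup_single_not_eq one_neq_zero)
    thus ?thesis
      by (simp add: sym_embed_def lookup_sum lookup_single when_def sum.delta in_keys_iff)
  qed
  thus "sym_embed v = sym_embed w \<Longrightarrow> Poly_Mapping.lookup v x = Poly_Mapping.lookup w x" by metis
qed

lemma sym_monom_in_span:
  assumes "\<And>x. x \<in> Poly_Mapping.keys m \<Longrightarrow> Poly_Mapping.single x 1 \<in> U"
  shows "Poly_Mapping.single m c \<in> sym_span U"
proof -
  have power: "Poly_Mapping.single (Poly_Mapping.single x k) 1 \<in> sym_span U"
    if "x \<in> Poly_Mapping.keys m" for x k
  proof (induction k)
    case 0
    show ?case using sym_span.const[of 1 U] by (simp add: sym_const_def)
  next
    case (Suc k)
    from sym_span.mult[OF sym_span.embed[OF assms[OF that]] this] show ?case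
      by (simp add: sym_embed_single mult_single flip: single_add)
  qed
  have "Poly_Mapping.single (\<Sum>x\<in>S. Poly_Mapping.single x (Poly_Mapping.lookup m x)) 1 \<in> sym_span U"
    if "finite S" "S \<subseteq> Poly_Mapping.keys m" for S
    using that
  proof (induction S rule: finite_induct)
    case empty
    show ?case using sym_span.const[of 1 U] by (simp add: sym_const_def)
  next
    case (insert x S)
    have "x \<in> Poly_Mapping.keys m" using insert.prems by blast
    from sym_span.mult[OF power[OF this, of "Poly_Mapping.lookup m x"] insert.IH] insert
    show ?case by (simp add: mult_single)
  qed
  from this[of "Poly_Mapping.keys m"] have "Poly_Mapping.single m 1 \<in> sym_span U"
    by (simp add: poly_mapping_sum_singles)
  from sym_span.mult[OF sym_span.const[of c] this] show ?thesis by simp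
qed

lemma sym_span_basis:
  fixes X :: "'x set"
  shows "sym_span {v :: 'x \<Rightarrow>\<^sub>0 'k::comm_ring_1. Poly_Mapping.keys v \<subseteq> X} =
     {p. \<forall>m\<in>Poly_Mapping.keys p. Poly_Mapping.keys m \<subseteq> X}" (is "sym_span ?U = ?P")
proof (intro equalityI subsetI)
  fix p assume "p \<in> sym_span ?U"
  thus "p \<in> ?P"
  proof induction
    case (const c)
    show ?case by (simp add: sym_const_def)
  next
    case (embed u)
    have "Poly_Mapping.keys (sym_embed u)
        \<subseteq> (\<Union>x\<in>Poly_Mapping.keys u. Poly_Mapping.keys
             (Poly_Mapping.single (Poly_Mapping.single x (1::nat)) (Poly_Mapping.lookup u x)))"
      unfolding sym_embed_def by (rule keys_sum)
    also have "\<dots> \<subseteq> (\<lambda>x. Poly_Mapping.single x 1) ` Poly_Mapping.keys u"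
      by (auto split: if_splits)
    finally show ?case using embed by fastforce
  next
    case (add p q)
    thus ?case using keys_add[of p q] by blast
  next
    case (mult p q)
    show ?case
    proof (intro CollectI ballI)
      fix m assume "m \<in> Poly_Mapping.keys (p * q)"
      with keys_mult[of p q] obtain a b where "m = a + b" "a \<in> Poly_Mapping.keys p" "b \<in> Poly_Mapping.keys q"
        by blast
      thus "Poly_Mapping.keys m \<subseteq> X" using mult keys_add[of a b] by blast
    qed
  qed
next
  fix p assume p: "p \<in> ?P"
  show "p \<in> sym_span ?U"
  proof (rule poly_mapping_single_induct[where v = p and P = "\<lambda>p. p \<in> sym_span ?U"])
    show "0 \<in> sym_span ?U" using sym_span.const[of 0] by simp
    show "Poly_Mapping.single m c \<in> sym_span ?U" if "m \<in> Poly_Mapping.keys p" for m c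
      using p that by (intro sym_monom_in_span) auto
  qed (rule sym_span.add)
qed

lemma sym_span_UNIV: "sym_span UNIV = UNIV"
  using sym_span_basis[of UNIV] by simp

lemma sym_span_W_ge:
  "sym_span W_ge = {p. \<forall>m\<in>Poly_Mapping.keys p. Poly_Mapping.keys m \<subseteq> {0..}}"
  unfolding W_ge_def by (rule sym_span_basis)

lemma sym_span_uminus: "p \<in> sym_span U \<Longrightarrow> - p \<in> sym_span U"
  using sym_span.mult[OF sym_span.const[of "- 1"]] by (fastforce simp: sym_const_uminus)

lemma cring_sym_ring: "cring (sym_ring U)"
proof (rule cringI)
  have 0: "0 \<in> sym_span U" and 1: "1 \<in> sym_span U"
    using sym_span.const[of 0 U] sym_span.const[of 1 U] by simp_all
  show "abelian_group (sym_ring U)"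
    by (rule abelian_groupI) (auto simp: sym_span.add 0 add_ac intro!: bexI[OF _ sym_span_uminus])
  show "comm_monoid (sym_ring U)"
    by (rule comm_monoidI) (auto simp: sym_span.mult 1 mult_ac)
qed (simp add: algebra_simps)

definition algebra_hom_on ::
  "('k \<Rightarrow> 'a::comm_ring_1) \<Rightarrow> ('x, 'k::comm_ring_1) sym set \<Rightarrow> (('x, 'k) sym \<Rightarrow> 'a) \<Rightarrow> bool" where
  "algebra_hom_on h A F \<longleftrightarrow>
     (\<forall>c. F (sym_const c) = h c) \<and>
     (\<forall>p\<in>A. \<forall>q\<in>A. F (p + q) = F p + F q) \<and> (\<forall>p\<in>A. \<forall>q\<in>A. F (p * q) = F p * F q)"

theorem sym_universal_exists:
  fixes h :: "'k::comm_ring_1 \<Rightarrow> 'a::comm_ring_1" and \<phi> :: "('x \<Rightarrow>\<^sub>0 'k) \<Rightarrow> 'a"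
  assumes h: "\<And>a b. h (a + b) = h a + h b" "\<And>a b. h (a * b) = h a * h b" "h 1 = 1"
    and U: "U = {v. Poly_Mapping.keys v \<subseteq> X}"
    and \<phi>: "\<And>u v. u \<in> U \<Longrightarrow> v \<in> U \<Longrightarrow> \<phi> (u + v) = \<phi> u + \<phi> v"
      "\<And>c v. v \<in> U \<Longrightarrow> \<phi> (scal c v) = h c * \<phi> v"
  shows "\<exists>F. algebra_hom_on h (sym_span U) F \<and> (\<forall>u\<in>U. F (sym_embed u) = \<phi> u)"
proof -
  have h0: "h 0 = 0" using h(1)[of 0 0] by simp
  define E where "E m = (\<Prod>x\<in>Poly_Mapping.keys m. \<phi> (Poly_Mapping.single x 1) ^ Poly_Mapping.lookup m x)"
    for m :: "'x \<Rightarrow>\<^sub>0 nat"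
  define F where "F = additive_ext (\<lambda>m c. h c * E m)"
  have E_sup: "E m = (\<Prod>x\<in>S. \<phi> (Poly_Mapping.single x 1) ^ Poly_Mapping.lookup m x)"
    if "finite S" "Poly_Mapping.keys m \<subseteq> S" for m S
    unfolding E_def using that by (intro prod.mono_neutral_left) (auto simp: in_keys_iff)
  have E_add: "E (m + n) = E m * E n" for m n
  proof -
    let ?S = "Poly_Mapping.keys m \<union> Poly_Mapping.keys n"
    show ?thesis
      using keys_add[of m n]
      by (simp add: E_sup[of ?S] lookup_add power_add prod.distrib)
  qed
  have E_single: "E (Poly_Mapping.single x 1) = \<phi> (Poly_Mapping.single x 1)" for x
    by (simp add: E_def)
  have E0: "E 0 = 1" by (simp add: E_def)
  have F_single: "F (Poly_Mapping.single m c) = h c * E m" for m c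
    unfolding F_def by (rule additive_ext_single) (simp add: h0)
  have F_additive: "additive_map F"
    unfolding F_def by (rule additive_ext_additive) (simp_all add: h0 h algebra_simps)
  note F_add = additive_mapD[OF F_additive]
  have F_mult: "F (p * q) = F p * F q" for p q
  proof -
    have *: "additive_map (\<lambda>p. F (p * q))" "additive_map (\<lambda>p. F p * F q)"
      "additive_map (\<lambda>p. F (q * p))" "additive_map (\<lambda>p. F q * F p)" for q
      by (simp_all add: additive_map_def F_add algebra_simps)
    show ?thesis
      apply (rule additive_map_eqI[OF *(1) *(2)])
      apply (rule additive_map_eqI[OF *(3) *(4)])
      apply (simp add: mult_single F_single h E_add mult_ac)
      done
  qed
  have F_embed: "F (sym_embed u) = \<phi> u" if "u \<in> U" for u
  proof -
    have 0: "0 \<in> U" by (simp add: U)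
    have s: "Poly_Mapping.single x c \<in> U" if "x \<in> X" for x c using that by (simp add: U)
    have "F (sym_embed (\<Sum>x\<in>S. Poly_Mapping.single x (Poly_Mapping.lookup u x)))
        = \<phi> (\<Sum>x\<in>S. Poly_Mapping.single x (Poly_Mapping.lookup u x))
      \<and> (\<Sum>x\<in>S. Poly_Mapping.single x (Poly_Mapping.lookup u x)) \<in> U"
      if "finite S" "S \<subseteq> X" for S
      using that
    proof (induction S rule: finite_induct)
      case empty
      have "\<phi> 0 = 0" using \<phi>(1)[OF 0 0] by simp
      thus ?case by (simp add: additive_map_0[OF F_additive] 0)
    next
      case (insert x S)
      have x: "x \<in> X" using insert.prems by blast
      let ?c = "Poly_Mapping.lookup u x"
      let ?r = "\<Sum>x\<in>S. Poly_Mapping.single x (Poly_Mapping.lookup u x)"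
      have IH: "F (sym_embed ?r) = \<phi> ?r" "?r \<in> U" using insert by auto
      have "\<phi> (Poly_Mapping.single x ?c) = h ?c * \<phi> (Poly_Mapping.single x 1)"
        using \<phi>(2)[OF s[OF x, of 1], of ?c] by simp
      hence "F (sym_embed (Poly_Mapping.single x ?c)) = \<phi> (Poly_Mapping.single x ?c)"
        by (simp add: sym_embed_single F_single E_single flip: One_nat_def)
      moreover have "Poly_Mapping.single x ?c + ?r \<in> U"
        using s[OF x, of ?c] IH(2) keys_add[of "Poly_Mapping.single x ?c" ?r] unfolding U by blast
      ultimately show ?case
        using insert.hyps IH \<phi>(1)[OF s[OF x] IH(2), of ?c] by (simp add: sym_embed_add F_add)
    qed
    from this[of "Poly_Mapping.keys u"] that show ?thesis
      by (simp add: U poly_mapping_sum_singles)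
  qed
  show ?thesis
    by (intro exI[of _ F])
      (auto simp: algebra_hom_on_def F_add F_mult F_embed sym_const_def F_single E0)
qed

theorem sym_universal_unique:
  assumes "algebra_hom_on h (sym_span U) F" "algebra_hom_on h (sym_span U) G"
    and "\<And>u. u \<in> U \<Longrightarrow> F (sym_embed u) = G (sym_embed u)"
    and "p \<in> sym_span U"
  shows "F p = G p"
  using assms(4) by induction (use assms(1-3) in \<open>auto simp: algebra_hom_on_def\<close>)


section \<open>The Poisson bracket of a symmetric algebra\<close>

definition derivation :: "('a::comm_ring_1 \<Rightarrow> 'a) \<Rightarrow> bool" where
  "derivation D \<longleftrightarrow> (\<forall>p q. D (p + q) = D p + D q) \<and> (\<forall>p q. D (p * q) = p * D q + D p * q)"

text \<open>
  \<open>sym_deriv d\<close> is the derivation of the polynomial ring that vanishes on constants and sends the indeterminate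
  \<open>x\<close> to \<open>d x\<close>.
\<close>

definition sym_deriv :: "('x \<Rightarrow> ('x, 'k::comm_ring_1) sym) \<Rightarrow> ('x, 'k) sym \<Rightarrow> ('x, 'k) sym" where
  "sym_deriv d p = (\<Sum>m\<in>Poly_Mapping.keys p. \<Sum>x\<in>Poly_Mapping.keys m.
     Poly_Mapping.single (m - Poly_Mapping.single x 1)
       (of_nat (Poly_Mapping.lookup m x) * Poly_Mapping.lookup p m) * d x)"

text \<open>
  In terms of partial derivatives, the bracket is
  \<open>{p,q} = \<Sum>x y. (\<partial>p/\<partial>x) (\<partial>q/\<partial>y) [x,y]\<close>.  By \<open>sym_bracket_unique\<close>
  below it is the only bilinear biderivation extending the Lie bracket.
\<close>

definition sym_bracket ::
  "(('x \<Rightarrow>\<^sub>0 'k::comm_ring_1) \<Rightarrow> ('x \<Rightarrow>\<^sub>0 'k) \<Rightarrow> ('x \<Rightarrow>\<^sub>0 'k)) \<Rightarrow>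
    ('x, 'k) sym \<Rightarrow> ('x, 'k) sym \<Rightarrow> ('x, 'k) sym" where
  "sym_bracket br p q =
     sym_deriv (\<lambda>x. sym_deriv (\<lambda>y. sym_embed (br (Poly_Mapping.single x 1) (Poly_Mapping.single y 1))) q) p"

lemma derivation_add: "derivation D \<Longrightarrow> D (p + q) = D p + D q"
  and derivation_mult: "derivation D \<Longrightarrow> D (p * q) = p * D q + D p * q"
  by (simp_all add: derivation_def)

lemma derivation_additive: "derivation D \<Longrightarrow> additive_map D"
  by (simp add: derivation_def additive_map_def)

lemma derivation_0: "derivation D \<Longrightarrow> D 0 = 0"
  by (rule additive_map_0[OF derivation_additive])

lemma derivation_uminus: "derivation D \<Longrightarrow> D (- p) = - D p"
  using derivation_add[of D p "- p"] derivation_0[of D] by (simp add: eq_neg_iff_add_eq_0 add.commute)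

lemma derivation_diff: "derivation D \<Longrightarrow> D (p - q) = D p - D q"
  using derivation_add[of D p "- q"] by (simp add: derivation_uminus)

lemma derivation_eq_0:
  fixes D :: "('x, 'k::comm_ring_1) sym \<Rightarrow> ('x, 'k) sym"
  assumes D: "derivation D" and "\<And>c. D (sym_const c) = 0"
    and "\<And>x. D (sym_embed (Poly_Mapping.single x 1)) = 0"
  shows "D p = 0"
proof -
  have embed: "D (sym_embed v) = 0" for v
  proof (induction v rule: poly_mapping_single_induct)
    case zero
    show ?case by (simp add: derivation_0[OF D])
  next
    case (single x c)
    have "D (sym_const c * sym_embed (Poly_Mapping.single x 1)) = 0"
      by (simp only: derivation_mult[OF D] assms(2,3)) simp
    thus ?case by (simp flip: sym_embed_scal)
  next
    case (add p q)
    thus ?case by (simp add: sym_embed_add derivation_add[OF D])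
  qed
  have "p \<in> sym_span UNIV" by (simp add: sym_span_UNIV)
  thus ?thesis
    by induction (simp_all add: assms embed derivation_add[OF D] derivation_mult[OF D])
qed

lemma sym_deriv_ext:
  "sym_deriv d = additive_ext (\<lambda>m c. \<Sum>x\<in>Poly_Mapping.keys m.
     Poly_Mapping.single (m - Poly_Mapping.single x 1) (of_nat (Poly_Mapping.lookup m x) * c) * d x)"
  by (simp add: fun_eq_iff sym_deriv_def additive_ext_def)

lemma sym_deriv_single:
  "sym_deriv d (Poly_Mapping.single m c) = (\<Sum>x\<in>Poly_Mapping.keys m.
     Poly_Mapping.single (m - Poly_Mapping.single x 1) (of_nat (Poly_Mapping.lookup m x) * c) * d x)"
  unfolding sym_deriv_ext by (rule additive_ext_single) simp

lemma sym_deriv_add: "sym_deriv d (p + q) = sym_deriv d p + sym_deriv d q"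
  unfolding sym_deriv_ext
  by (rule additive_mapD[OF additive_ext_additive])
    (simp_all add: single_add algebra_simps sum.distrib)

lemma sym_deriv_mult: "sym_deriv d (p * q) = p * sym_deriv d q + sym_deriv d p * q"
proof -
  have *: "additive_map (\<lambda>p. sym_deriv d (p * q))" "additive_map (\<lambda>p. sym_deriv d (q * p))"
    "additive_map (\<lambda>p. p * sym_deriv d q + sym_deriv d p * q)"
    "additive_map (\<lambda>p. q * sym_deriv d p + sym_deriv d q * p)" for q
    by (simp_all add: additive_map_def sym_deriv_add algebra_simps)
  have "sym_deriv d (Poly_Mapping.single m a * Poly_Mapping.single n b) =
      Poly_Mapping.single m a * sym_deriv d (Poly_Mapping.single n b) +
      sym_deriv d (Poly_Mapping.single m a) * Poly_Mapping.single n b" for m n a b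
  proof -
    let ?S = "Poly_Mapping.keys m \<union> Poly_Mapping.keys n"
    let ?T = "\<lambda>m c x. Poly_Mapping.single (m - Poly_Mapping.single x 1) (of_nat (Poly_Mapping.lookup m x) * c)"
    have sup: "sym_deriv d (Poly_Mapping.single k c) = (\<Sum>x\<in>?S. ?T k c x * d x)"
      if "Poly_Mapping.keys k \<subseteq> ?S" for k c
      unfolding sym_deriv_single using that
      by (intro sum.mono_neutral_left) (auto simp: in_keys_iff)
    have shift: "Poly_Mapping.single (k + l - Poly_Mapping.single x 1) (of_nat (Poly_Mapping.lookup l x) * c)
        = Poly_Mapping.single (k + (l - Poly_Mapping.single x 1)) (of_nat (Poly_Mapping.lookup l x) * c)" for k l x c
    proof (cases "Poly_Mapping.lookup l x = 0")
      case False
      have "k + l - Poly_Mapping.single x 1 = k + (l - Poly_Mapping.single x 1)"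
        using False
        by (intro poly_mapping_eqI) (auto simp: lookup_add lookup_minus lookup_single when_def)
      thus ?thesis by simp
    qed simp
    have termwise: "?T (m + n) (a * b) x
        = Poly_Mapping.single m a * ?T n b x + ?T m a x * Poly_Mapping.single n b" for x
    proof -
      have "?T (m + n) (a * b) x
        = Poly_Mapping.single (m + n - Poly_Mapping.single x 1) (of_nat (Poly_Mapping.lookup n x) * (a * b))
        + Poly_Mapping.single (n + m - Poly_Mapping.single x 1) (of_nat (Poly_Mapping.lookup m x) * (a * b))"
        by (simp add: lookup_add algebra_simps flip: single_add)
      thus ?thesis
        unfolding shift by (simp add: mult_single mult_ac add_ac)
    qed
    show ?thesis
      unfolding mult_single[of m a n b] sup[OF keys_add] sup[OF Un_upper1] sup[OF Un_upper2] termwise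
      by (simp only: distrib_right sum.distrib sum_distrib_left sum_distrib_right mult.assoc)
        (simp only: mult.commute mult.left_commute)
  qed
  thus ?thesis
    by - (rule additive_map_eqI[OF *(1) *(3)], rule additive_map_eqI[OF *(2) *(4)])
qed

lemma derivation_sym_deriv: "derivation (sym_deriv d)"
  by (simp add: derivation_def sym_deriv_add sym_deriv_mult)

lemma sym_deriv_const [simp]: "sym_deriv d (sym_const c) = 0"
  by (simp add: sym_const_def sym_deriv_single)

lemma sym_deriv_embed:
  "sym_deriv d (sym_embed v) = (\<Sum>x\<in>Poly_Mapping.keys v. sym_const (Poly_Mapping.lookup v x) * d x)"
  unfolding sym_embed_def additive_map_sum[OF derivation_additive[OF derivation_sym_deriv]] sym_deriv_single
  by (simp add: sym_const_def)

lemma sym_deriv_embed_basis [simp]: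
  fixes d :: "'x \<Rightarrow> ('x, 'k::comm_ring_1) sym"
  shows "sym_deriv d (sym_embed (Poly_Mapping.single x 1)) = d x"
  by (simp add: sym_deriv_embed)

lemma sym_deriv_plus: "sym_deriv (\<lambda>x. d x + e x) p = sym_deriv d p + sym_deriv e p"
  by (simp add: sym_deriv_def algebra_simps sum.distrib)

lemma sym_deriv_times: "sym_deriv (\<lambda>x. s * d x) p = s * sym_deriv d p"
  by (simp add: sym_deriv_def algebra_simps sum_distrib_left)

lemma derivation_sym_bracket_left: "derivation (\<lambda>p. sym_bracket br p q)"
  unfolding sym_bracket_def by (rule derivation_sym_deriv)

lemma derivation_sym_bracket_right: "derivation (\<lambda>q. sym_bracket br p q)"
  unfolding derivation_def sym_bracket_def sym_deriv_add sym_deriv_mult sym_deriv_plus sym_deriv_times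
  by (simp add: sym_deriv_times mult.commute)

lemma sym_bracket_const [simp]:
  "sym_bracket br (sym_const c) q = 0" "sym_bracket br p (sym_const c) = 0"
  by (simp_all add: sym_bracket_def) (simp add: sym_deriv_def)

lemma sym_bracket_scal:
  "sym_bracket br (scal c p) q = scal c (sym_bracket br p q)"
  "sym_bracket br p (scal c q) = scal c (sym_bracket br p q)"
  by (simp_all add: scal_conv_sym_const derivation_mult[OF derivation_sym_bracket_left]
      derivation_mult[OF derivation_sym_bracket_right])

context
  fixes br :: "('x \<Rightarrow>\<^sub>0 'k::comm_ring_1) \<Rightarrow> ('x \<Rightarrow>\<^sub>0 'k) \<Rightarrow> ('x \<Rightarrow>\<^sub>0 'k)"
  assumes lie: "lie_bracket br"
begin

lemma sym_bracket_embed: "sym_bracket br (sym_embed u) (sym_embed v) = sym_embed (br u v)"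
proof -
  have br_add: "br (u + v) w = br u w + br v w" "br w (u + v) = br w u + br w v"
    and br_scal: "br (scal c u) v = scal c (br u v)" "br u (scal c v) = scal c (br u v)" for u v w c
    using lie by (auto simp: lie_bracket_def)
  note L = derivation_add[OF derivation_sym_bracket_left]
  note R = derivation_add[OF derivation_sym_bracket_right]
  have single: "Poly_Mapping.single x c = scal c (Poly_Mapping.single x 1)" for x :: 'x and c :: 'k
    by simp
  have *: "additive_map (\<lambda>u. sym_bracket br (sym_embed u) (sym_embed v))"
    "additive_map (\<lambda>u. sym_embed (br u v))"
    "additive_map (\<lambda>u. sym_bracket br (sym_embed v) (sym_embed u))"
    "additive_map (\<lambda>u. sym_embed (br v u))" for v
    by (simp_all add: additive_map_def br_add sym_embed_add L R)
  have "sym_bracket br (sym_embed (Poly_Mapping.single x a)) (sym_embed (Poly_Mapping.single y b))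
      = sym_embed (br (Poly_Mapping.single x a) (Poly_Mapping.single y b))" for x y a b
  proof -
    have "sym_bracket br (sym_embed (Poly_Mapping.single x 1)) (sym_embed (Poly_Mapping.single y 1))
      = sym_embed (br (Poly_Mapping.single x 1) (Poly_Mapping.single y 1))"
      by (simp add: sym_bracket_def del: One_nat_def)
    thus ?thesis
      by (subst (1 2) single[of x a], subst (1 2) single[of y b])
        (simp only: br_scal sym_embed_scal scal_conv_sym_const[symmetric] sym_bracket_scal)
  qed
  thus ?thesis
    by - (rule additive_map_eqI[OF *(1) *(2)], rule additive_map_eqI[OF *(3) *(4)])
qed

lemma lie_skew: "br u v = - br v u"
proof -
  have add: "br (u + v) w = br u w + br v w" "br w (u + v) = br w u + br w v" for u v w
    using lie by (auto simp: lie_bracket_def)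
  have "br (u + v) (u + v) = 0" "br u u = 0" "br v v = 0"
    using lie by (simp_all add: lie_bracket_def)
  thus ?thesis
    by (simp add: add eq_neg_iff_add_eq_0 add.commute)
qed

lemma sym_bracket_skew: "sym_bracket br p q = - sym_bracket br q p"
proof -
  let ?D = "\<lambda>p q. sym_bracket br p q + sym_bracket br q p"
  have D: "derivation (\<lambda>p. ?D p q)" "derivation (\<lambda>q. ?D p q)" for p q
    unfolding derivation_def
    by (simp_all add: derivation_add[OF derivation_sym_bracket_left] derivation_add[OF derivation_sym_bracket_right]
        derivation_mult[OF derivation_sym_bracket_left] derivation_mult[OF derivation_sym_bracket_right] algebra_simps)
  have 1: "?D (sym_embed u) (sym_embed v) = 0" for u v
    using lie_skew[of u v] by (simp add: sym_bracket_embed sym_embed_uminus)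
  have 2: "?D (sym_embed u) q = 0" for u q
    by (rule derivation_eq_0[OF D(2)]) (simp_all only: 1 sym_bracket_const add_0)
  have "?D p q = 0"
    by (rule derivation_eq_0[OF D(1)]) (simp_all only: 2 sym_bracket_const add_0)
  thus ?thesis by (simp add: eq_neg_iff_add_eq_0)
qed

lemma sym_bracket_jacobi:
  "sym_bracket br p (sym_bracket br q r) + sym_bracket br q (sym_bracket br r p)
     + sym_bracket br r (sym_bracket br p q) = 0"
proof -
  let ?J = "\<lambda>p q r. sym_bracket br p (sym_bracket br q r) + sym_bracket br q (sym_bracket br r p)
     + sym_bracket br r (sym_bracket br p q)"
  note L = derivation_add[OF derivation_sym_bracket_left] derivation_mult[OF derivation_sym_bracket_left]
  note R = derivation_add[OF derivation_sym_bracket_right] derivation_mult[OF derivation_sym_bracket_right]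
  have J: "derivation (\<lambda>p. ?J p q r)" for q r
  proof -
    have "?J (p * p') q r = p * ?J p' q r + ?J p q r * p'" for p p'
      using sym_bracket_skew[of q p] sym_bracket_skew[of q p'] sym_bracket_skew[of r p] sym_bracket_skew[of r p']
      by (simp add: L R derivation_uminus[OF derivation_sym_bracket_right]
          derivation_diff[OF derivation_sym_bracket_right] algebra_simps)
    moreover have "?J (p + p') q r = ?J p q r + ?J p' q r" for p p'
      by (simp add: L R algebra_simps)
    ultimately show ?thesis by (simp add: derivation_def)
  qed
  have cyc: "?J p q r = ?J q r p" for p q r by (simp add: add_ac)
  have cst: "?J (sym_const c) q r = 0" for c q r by (simp add: derivation_0[OF derivation_sym_bracket_right])
  have 0: "?J (sym_embed u) (sym_embed v) (sym_embed w) = 0" for u v w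
    using lie by (simp add: sym_bracket_embed lie_bracket_def flip: sym_embed_add)
  have 1: "?J p (sym_embed v) (sym_embed w) = 0" for p v w
    by (rule derivation_eq_0[OF J]) (simp_all only: cst 0)
  have 2: "?J p q (sym_embed w) = 0" for p q w
    unfolding cyc[of p q] by (rule derivation_eq_0[OF J])
      (simp_all only: cst, metis 1 cyc)
  show ?thesis
    unfolding cyc[of p q] cyc[of q r] by (rule derivation_eq_0[OF J])
      (simp_all only: cst, metis 2 cyc)
qed

theorem sym_bracket_unique:
  assumes "\<And>q. derivation (\<lambda>p. B p q)" "\<And>p. derivation (\<lambda>q. B p q)"
    and "\<And>c p q. B (scal c p) q = scal c (B p q)" "\<And>c p q. B p (scal c q) = scal c (B p q)"
    and "\<And>u v. B (sym_embed u) (sym_embed v) = sym_embed (br u v)"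
  shows "B = sym_bracket br"
proof (intro ext)
  fix p q
  have D1: "D 1 = 0" if "derivation D" for D :: "('x, 'k) sym \<Rightarrow> ('x, 'k) sym"
    using derivation_mult[OF that, of 1 1] by simp
  have const: "B (sym_const c) q = 0" "B p (sym_const c) = 0" for c p q
    using assms(3)[of c 1 q] assms(4)[of p c 1] D1[OF assms(1)[of q]] D1[OF assms(2)[of p]]
    by (simp_all add: scal_conv_sym_const)
  let ?D = "\<lambda>p q. B p q - sym_bracket br p q"
  have D: "derivation (\<lambda>p. ?D p q)" "derivation (\<lambda>q. ?D p q)" for p q
    unfolding derivation_def
    by (simp_all add: derivation_add[OF derivation_sym_bracket_left] derivation_add[OF derivation_sym_bracket_right]
        derivation_mult[OF derivation_sym_bracket_left] derivation_mult[OF derivation_sym_bracket_right]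
        derivation_add[OF assms(1)] derivation_add[OF assms(2)]
        derivation_mult[OF assms(1)] derivation_mult[OF assms(2)] algebra_simps)
  have 1: "?D (sym_embed u) q = 0" for u q
    by (rule derivation_eq_0[OF D(2)]) (simp_all add: const assms(5) sym_bracket_embed)
  have "?D p q = 0"
    by (rule derivation_eq_0[OF D(1)]) (simp_all add: const 1 del: right_minus_eq)
  thus "B p q = sym_bracket br p q" by simp
qed

lemma sym_bracket_in_span:
  assumes U: "\<And>u v. u \<in> U \<Longrightarrow> v \<in> U \<Longrightarrow> br u v \<in> U"
    and "p \<in> sym_span U" "q \<in> sym_span U"
  shows "sym_bracket br p q \<in> sym_span U"
  using assms(2)
proof induction
  case (const c)
  show ?case using sym_span.const[of 0 U] by simp
next
  case (embed u)
  show ?case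
    using assms(3)
  proof induction
    case (const c)
    show ?case using sym_span.const[of 0 U] by simp
  next
    case (embed v)
    thus ?case using \<open>u \<in> U\<close> by (simp add: sym_bracket_embed U sym_span.embed)
  qed (simp_all add: derivation_add[OF derivation_sym_bracket_right]
      derivation_mult[OF derivation_sym_bracket_right] sym_span.add sym_span.mult)
qed (simp_all add: derivation_add[OF derivation_sym_bracket_left]
      derivation_mult[OF derivation_sym_bracket_left] sym_span.add sym_span.mult assms(3))

end


section \<open>Poisson rings and Poisson primitive ideals\<close>

locale poisson_ring = cring R for R (structure) +
  fixes pb :: "'a \<Rightarrow> 'a \<Rightarrow> 'a"
  assumes pb_closed: "\<lbrakk>a \<in> carrier R; b \<in> carrier R\<rbrakk> \<Longrightarrow> pb a b \<in> carrier R"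
    and pb_add: "\<lbrakk>a \<in> carrier R; b \<in> carrier R; c \<in> carrier R\<rbrakk> \<Longrightarrow> pb (a \<oplus> b) c = pb a c \<oplus> pb b c"
    and pb_skew: "\<lbrakk>a \<in> carrier R; b \<in> carrier R\<rbrakk> \<Longrightarrow> pb a b = \<ominus> pb b a"
    and pb_jacobi: "\<lbrakk>a \<in> carrier R; b \<in> carrier R; c \<in> carrier R\<rbrakk> \<Longrightarrow>
      pb a (pb b c) \<oplus> pb b (pb c a) \<oplus> pb c (pb a b) = \<zero>"
    and pb_leibniz: "\<lbrakk>a \<in> carrier R; b \<in> carrier R; c \<in> carrier R\<rbrakk> \<Longrightarrow>
      pb (a \<otimes> b) c = a \<otimes> pb b c \<oplus> pb a c \<otimes> b"

lemma sym_ring_a_inv: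
  assumes "p \<in> sym_span U" shows "\<ominus>\<^bsub>sym_ring U\<^esub> p = - p"
proof -
  have "abelian_group (sym_ring U)"
    using cring_sym_ring[of U] by (simp add: cring_def ring_def)
  from abelian_group.minus_equality[OF this, of "- p" p] show ?thesis
    using assms sym_span_uminus[OF assms] by simp
qed

lemma poisson_ring_sym_ring:
  assumes "lie_bracket br" "\<And>u v. u \<in> U \<Longrightarrow> v \<in> U \<Longrightarrow> br u v \<in> U"
  shows "poisson_ring (sym_ring U) (sym_bracket br)"
proof (intro poisson_ring.intro cring_sym_ring poisson_ring_axioms.intro)
  note closed = sym_bracket_in_span[OF assms(1), of U, OF assms(2)]
  fix a b c assume abc: "a \<in> carrier (sym_ring U)" "b \<in> carrier (sym_ring U)"
  show "sym_bracket br a b \<in> carrier (sym_ring U)"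
    using abc by (simp add: closed)
  show "sym_bracket br a b = \<ominus>\<^bsub>sym_ring U\<^esub> sym_bracket br b a"
    using abc by (subst sym_bracket_skew[OF assms(1)]) (simp add: closed sym_ring_a_inv)
qed (simp_all add: derivation_add[OF derivation_sym_bracket_left]
    derivation_mult[OF derivation_sym_bracket_left] sym_bracket_jacobi[OF assms(1)])

definition poisson_ideal :: "('a, 'm) ring_scheme \<Rightarrow> ('a \<Rightarrow> 'a \<Rightarrow> 'a) \<Rightarrow> 'a set \<Rightarrow> bool" where
  "poisson_ideal R pb I \<longleftrightarrow> ideal I R \<and> (\<forall>a\<in>I. \<forall>s\<in>carrier R. pb a s \<in> I)"

definition prime_poisson_ideals :: "('a, 'm) ring_scheme \<Rightarrow> ('a \<Rightarrow> 'a \<Rightarrow> 'a) \<Rightarrow> 'a set set" where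
  "prime_poisson_ideals R pb = {I. poisson_ideal R pb I \<and> primeideal I R}"

definition poisson_primitive :: "('a, 'm) ring_scheme \<Rightarrow> ('a \<Rightarrow> 'a \<Rightarrow> 'a) \<Rightarrow> 'a set \<Rightarrow> bool" where
  "poisson_primitive R pb P \<longleftrightarrow>
     (\<exists>M. maximalideal M R \<and> poisson_ideal R pb P \<and> P \<subseteq> M \<and>
          (\<forall>I. poisson_ideal R pb I \<and> I \<subseteq> M \<longrightarrow> I \<subseteq> P))"

definition pspec_prim :: "('a, 'm) ring_scheme \<Rightarrow> ('a \<Rightarrow> 'a \<Rightarrow> 'a) \<Rightarrow> 'a set set" where
  "pspec_prim R pb = {P. poisson_primitive R pb P}"

definition pvariety :: "('a, 'm) ring_scheme \<Rightarrow> ('a \<Rightarrow> 'a \<Rightarrow> 'a) \<Rightarrow> 'a set \<Rightarrow> 'a set set" where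
  "pvariety R pb S = {P \<in> pspec_prim R pb. S \<subseteq> P}"

text \<open>
  The lemmas \<open>istopology_zariski\<close> and \<open>closedin_zariski\<close> below show that this family of open
  sets satisfies the axioms and that the closed sets are the sets \<open>pvariety R pb I\<close>.
\<close>

definition zariski :: "('a, 'm) ring_scheme \<Rightarrow> ('a \<Rightarrow> 'a \<Rightarrow> 'a) \<Rightarrow> 'a set topology" where
  "zariski R pb = topology (\<lambda>U. \<exists>I. poisson_ideal R pb I \<and> U = pspec_prim R pb - pvariety R pb I)"

definition irreducible_closedin :: "'b topology \<Rightarrow> 'b set \<Rightarrow> bool" where
  "irreducible_closedin X Z \<longleftrightarrow> closedin X Z \<and> Z \<noteq> {} \<and>
     (\<forall>A B. closedin X A \<and> closedin X B \<and> Z = A \<union> B \<longrightarrow> Z = A \<or> Z = B)"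

context poisson_ring
begin

lemma poisson_ideal_carrier: "poisson_ideal R pb (carrier R)"
  by (simp add: poisson_ideal_def oneideal pb_closed)

lemma poisson_ideal_Inter:
  assumes "\<And>I. I \<in> S \<Longrightarrow> poisson_ideal R pb I" "S \<noteq> {}"
  shows "poisson_ideal R pb (\<Inter>S)"
  using assms i_Intersect[of S] by (auto simp: poisson_ideal_def)

lemma poisson_primitive_Int:
  assumes P: "poisson_primitive R pb P" and I: "poisson_ideal R pb I" and J: "poisson_ideal R pb J"
    and sub: "I \<inter> J \<subseteq> P"
  shows "I \<subseteq> P \<or> J \<subseteq> P"
proof -
  from P obtain M where M: "maximalideal M R" and PM: "P \<subseteq> M"
    and max: "\<And>I. poisson_ideal R pb I \<Longrightarrow> I \<subseteq> M \<Longrightarrow> I \<subseteq> P"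
    by (auto simp: poisson_primitive_def)
  interpret M: primeideal M R by (rule maximalideal_prime[OF M])
  show ?thesis
  proof (rule ccontr)
    assume "\<not> ?thesis"
    with max I J have "\<not> I \<subseteq> M" "\<not> J \<subseteq> M" by blast+
    then obtain a b where ab: "a \<in> I" "a \<notin> M" "b \<in> J" "b \<notin> M" by blast
    from I J have I': "ideal I R" and J': "ideal J R" by (simp_all add: poisson_ideal_def)
    have c: "a \<in> carrier R" "b \<in> carrier R" using ab ideal.Icarr[OF I'] ideal.Icarr[OF J'] by auto
    have "a \<otimes> b \<in> I \<inter> J"
      using ideal.I_r_closed[OF I'] ideal.I_l_closed[OF J'] ab c by blast
    with sub PM have "a \<otimes> b \<in> M" by blast
    with M.I_prime[OF c] ab show False by blast
  qed
qed

lemma pvariety_Un: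
  assumes "poisson_ideal R pb I" "poisson_ideal R pb J"
  shows "pvariety R pb I \<union> pvariety R pb J = pvariety R pb (I \<inter> J)"
  using poisson_primitive_Int[OF _ assms] by (auto simp: pvariety_def pspec_prim_def)

lemma istopology_zariski:
  "istopology (\<lambda>U. \<exists>I. poisson_ideal R pb I \<and> U = pspec_prim R pb - pvariety R pb I)"
proof -
  let ?O = "\<lambda>I. pspec_prim R pb - pvariety R pb I"
  have inter: "?O I \<inter> ?O J = ?O (I \<inter> J) \<and> poisson_ideal R pb (I \<inter> J)"
    if "poisson_ideal R pb I" "poisson_ideal R pb J" for I J
    using that poisson_ideal_Inter[of "{I, J}"] by (auto simp flip: pvariety_Un[OF that])
  have union: "\<exists>I. poisson_ideal R pb I \<and> \<Union>\<K> = ?O I"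
    if K: "\<forall>K\<in>\<K>. \<exists>I. poisson_ideal R pb I \<and> K = ?O I" for \<K>
  proof -
    define A where "A = \<Union>{I. poisson_ideal R pb I \<and> ?O I \<in> \<K>}"
    define N where "N = \<Inter>{I. poisson_ideal R pb I \<and> A \<subseteq> I}"
    have "I \<subseteq> carrier R" if "poisson_ideal R pb I" for I
      using that ideal.Icarr[of I R] by (auto simp: poisson_ideal_def)
    hence "A \<subseteq> carrier R"
      unfolding A_def by (intro Union_least) simp
    hence N: "poisson_ideal R pb N"
      unfolding N_def using poisson_ideal_carrier by (intro poisson_ideal_Inter) auto
    have "N \<subseteq> P \<longleftrightarrow> A \<subseteq> P" if "P \<in> pspec_prim R pb" for P
    proof
      assume "A \<subseteq> P"
      moreover have "poisson_ideal R pb P" using that by (auto simp: pspec_prim_def poisson_primitive_def)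
      ultimately show "N \<subseteq> P" unfolding N_def by (intro Inter_lower) simp
    next
      have "A \<subseteq> N" unfolding N_def by (intro Inter_greatest) simp
      thus "N \<subseteq> P \<Longrightarrow> A \<subseteq> P" by simp
    qed
    hence "?O N = ?O A"
      by (auto simp: pvariety_def)
    also have "?O A = \<Union>\<K>"
    proof (rule Set.set_eqI)
      fix P
      have mem: "P \<in> ?O S \<longleftrightarrow> P \<in> pspec_prim R pb \<and> \<not> S \<subseteq> P" for S
        by (auto simp: pvariety_def)
      have sub: "\<not> A \<subseteq> P \<longleftrightarrow> (\<exists>I. poisson_ideal R pb I \<and> ?O I \<in> \<K> \<and> \<not> I \<subseteq> P)"
        unfolding A_def by (simp only: Sup_le_iff mem_Collect_eq Ball_def not_all not_imp conj_assoc)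
      have "P \<in> ?O A \<longleftrightarrow> P \<in> pspec_prim R pb \<and> (\<exists>I. poisson_ideal R pb I \<and> ?O I \<in> \<K> \<and> \<not> I \<subseteq> P)"
        using sub by (simp only: mem)
      also have "\<dots> \<longleftrightarrow> (\<exists>I. poisson_ideal R pb I \<and> ?O I \<in> \<K> \<and> P \<in> ?O I)"
        by (auto simp only: mem)
      also have "\<dots> \<longleftrightarrow> (\<exists>K\<in>\<K>. P \<in> K)"
      proof
        assume "\<exists>K\<in>\<K>. P \<in> K"
        then obtain K where "K \<in> \<K>" "P \<in> K" by (elim bexE)
        moreover from K \<open>K \<in> \<K>\<close> obtain I where "poisson_ideal R pb I" "K = ?O I" by (elim ballE exE conjE) auto
        ultimately show "\<exists>I. poisson_ideal R pb I \<and> ?O I \<in> \<K> \<and> P \<in> ?O I" by (intro exI[of _ I]) simp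
      qed auto
      finally show "P \<in> ?O A \<longleftrightarrow> P \<in> \<Union>\<K>" by simp
    qed
    finally show ?thesis using N by (intro exI[of _ N]) simp
  qed
  show ?thesis
    unfolding istopology_def
  proof (intro conjI allI impI)
    fix S T
    assume "\<exists>I. poisson_ideal R pb I \<and> S = ?O I" "\<exists>I. poisson_ideal R pb I \<and> T = ?O I"
    then obtain I J where "poisson_ideal R pb I" "S = ?O I" "poisson_ideal R pb J" "T = ?O J"
      by (elim exE conjE)
    thus "\<exists>I. poisson_ideal R pb I \<and> S \<inter> T = ?O I"
      using inter[of I J] by (intro exI[of _ "I \<inter> J"]) simp
  qed (rule union)
qed

lemma openin_zariski:
  "openin (zariski R pb) U \<longleftrightarrow> (\<exists>I. poisson_ideal R pb I \<and> U = pspec_prim R pb - pvariety R pb I)"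
  unfolding zariski_def by (simp add: topology_inverse'[OF istopology_zariski])

lemma topspace_zariski: "topspace (zariski R pb) = pspec_prim R pb"
proof -
  have "P \<noteq> carrier R" if "poisson_primitive R pb P" for P
  proof -
    from that obtain M where M: "maximalideal M R" "P \<subseteq> M" by (auto simp: poisson_primitive_def)
    hence "M \<subseteq> carrier R" "M \<noteq> carrier R"
      using ideal.Icarr[OF maximalideal.axioms(1)[OF M(1)]] maximalideal.I_notcarr[OF M(1)] by auto
    with M show ?thesis by blast
  qed
  moreover have "P \<subseteq> carrier R" if "poisson_primitive R pb P" for P
    using that ideal.Icarr by (auto simp: poisson_primitive_def poisson_ideal_def)
  ultimately have "pvariety R pb (carrier R) = {}"
    unfolding pvariety_def pspec_prim_def by blast
  hence "openin (zariski R pb) (pspec_prim R pb)"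
    unfolding openin_zariski using poisson_ideal_carrier by (metis Diff_empty)
  moreover have "U \<subseteq> pspec_prim R pb" if "openin (zariski R pb) U" for U
    using that unfolding openin_zariski by blast
  ultimately show ?thesis unfolding topspace_def by blast
qed

theorem closedin_zariski:
  "closedin (zariski R pb) Z \<longleftrightarrow> (\<exists>I. poisson_ideal R pb I \<and> Z = pvariety R pb I)"
proof -
  have "pvariety R pb I \<subseteq> pspec_prim R pb" for I by (auto simp: pvariety_def)
  thus ?thesis
    unfolding closedin_def topspace_zariski openin_zariski by (metis double_diff order_refl)
qed

end


section \<open>The Poisson algebras of the Witt algebras\<close>

definition S_W :: "(int, 'k::comm_ring_1) sym ring" where
  "S_W = sym_ring (UNIV :: 'k witt set)"

definition S_W_ge :: "(int, 'k::comm_ring_1) sym ring" where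
  "S_W_ge = sym_ring W_ge"

abbreviation witt_pb :: "(int, 'k::comm_ring_1) sym \<Rightarrow> (int, 'k) sym \<Rightarrow> (int, 'k) sym" where
  "witt_pb \<equiv> sym_bracket witt_bracket"

lemma witt_bracket_W_ge: "f \<in> W_ge \<Longrightarrow> g \<in> W_ge \<Longrightarrow> witt_bracket f g \<in> W_ge"
proof -
  have mult: "f * g \<in> W_ge" if "f \<in> W_ge" "g \<in> W_ge" for f g :: "'a witt"
    using that keys_mult[of f g] unfolding W_ge_def by fastforce
  have deriv: "laurent_deriv f \<in> W_ge" if "f \<in> W_ge" for f :: "'a witt"
  proof -
    have "Poly_Mapping.keys (laurent_deriv f) \<subseteq> (\<Union>n\<in>Poly_Mapping.keys f. Poly_Mapping.keys
        (Poly_Mapping.single (n - 1) (of_int n * Poly_Mapping.lookup f n)))"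
      unfolding laurent_deriv_def by (rule keys_sum)
    also have "\<dots> \<subseteq> {0..}"
    proof (intro UN_least)
      fix n assume "n \<in> Poly_Mapping.keys f"
      with that have "0 \<le> n" by (auto simp: W_ge_def)
      thus "Poly_Mapping.keys (Poly_Mapping.single (n - 1) (of_int n * Poly_Mapping.lookup f n)) \<subseteq> {0..}"
        by (cases "n = 0") auto
    qed
    finally show ?thesis by (simp add: W_ge_def)
  qed
  assume "f \<in> W_ge" "g \<in> W_ge"
  hence "f * laurent_deriv g \<in> W_ge" "laurent_deriv f * g \<in> W_ge" by (auto intro: mult deriv)
  thus ?thesis
    unfolding witt_bracket_def W_ge_def by (auto simp: in_keys_iff lookup_minus subset_iff) (metis diff_0_right)
qed

lemma poisson_ring_S_W: "poisson_ring S_W witt_pb"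
  unfolding S_W_def by (rule poisson_ring_sym_ring[OF lie_bracket_witt]) simp

lemma poisson_ring_S_W_ge: "poisson_ring S_W_ge witt_pb"
  unfolding S_W_ge_def by (rule poisson_ring_sym_ring[OF lie_bracket_witt witt_bracket_W_ge])

end

theory Submission
  imports
    Defs
    "HOL-Computational_Algebra.Polynomial_Factorial"
begin

text \<open>
  Write \<open>x\<^sub>n\<close> for the vector field \<open>t\<^sup>n\<partial>\<close>, so that \<open>{x\<^sub>m, x\<^sub>n} = (n - m) x\<^bsub>m+n-1\<^esub>\<close>; let \<open>S\<close> be the polynomial
  ring in all \<open>x\<^sub>n\<close> and \<open>A\<close> the subring generated by those with \<open>n \<ge> 0\<close>.

  The reason for the first bijection is that modulo a nonzero prime Poisson ideal the sequence
  \<open>(x\<^sub>n)\<close> satisfies a linear recurrence whose coefficients do not depend on \<open>n\<close>, and such a recurrence determines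
  the terms of negative index from the others.  The recurrence arises as follows.  If \<open>f\<close> lies in the
  ideal, then so does \<open>{x\<^sub>n, f} = \<Sum>i. (i - n) x\<^bsub>n+i-1\<^esub> \<partial>f/\<partial>x\<^sub>i\<close>, a recurrence whose coefficients depend
  linearly on \<open>n\<close>.  The dependence on \<open>n\<close> cancels when the relations of two elements \<open>f\<close>, \<open>g\<close> are
  combined: the Wronskian of the gradients \<open>\<Sum>i. (\<partial>f/\<partial>x\<^sub>i) t\<^sup>i\<close> and \<open>\<Sum>i. (\<partial>g/\<partial>x\<^sub>i) t\<^sup>i\<close> annihilates the
  sequence (\<open>chi_wronskian\<close>), and for \<open>g = {x\<^sub>m, f}\<close> with large \<open>m\<close> it does not vanish modulo the ideal
  (\<open>wronskian_notin\<close>).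

  Injectivity.  A nonzero prime Poisson ideal \<open>J\<close> of \<open>S\<close> meets \<open>A\<close> in a nonzero ideal: a recurrence over \<open>S\<close> gives one
  over \<open>A\<close> by elimination, and a recurrence over \<open>A\<close> cannot hold among fresh indeterminates
  (\<open>contraction_nonzero\<close>).  Hence there is a recurrence \<open>w\<close> that only depends on \<open>J \<inter> A\<close>; solving it
  backwards shows that every \<open>f \<in> S\<close> becomes congruent to an element of \<open>A\<close> after multiplication by
  a power of the lowest coefficient of \<open>w\<close>, so \<open>J\<close> is determined by \<open>J \<inter> A\<close>
  (\<open>contraction_subset\<close>).

  Surjectivity.  Given a nonzero \<open>Q\<close> in \<open>A\<close>, a recurrence of minimal order modulo \<open>Q\<close> has constant term
  \<open>s \<notin> Q\<close>, because bracketing with \<open>x\<^sub>0 = \<partial>\<close> yields another recurrence (\<open>invertible_recurrence\<close>).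
  Solving backwards defines a homomorphism \<open>S \<rightarrow> A[1/s]\<close>, and \<open>J\<close> is the preimage of \<open>Q[1/s]\<close>.  It is
  stable under brackets because two two-sided sequences that satisfy the same recurrence and agree for
  large indices agree everywhere (\<open>annihilated_in\<close>, \<open>prime_extension\<close>).

  For the second bijection, \<open>Z \<mapsto> \<Inter>Z\<close> identifies the irreducible closed sets of Poisson primitive
  ideals with the prime Poisson ideals (\<open>bij_betw_irreducible_prime\<close>).  This needs two facts: Poisson
  primitive ideals are prime (\<open>core_prime\<close>), and every prime Poisson ideal is an intersection of Poisson
  primitive ones.  The latter follows from the Nullstellensatz in countably many variables over an
  uncountable algebraically closed field (\<open>maximal_avoiding\<close>, \<open>residue_field_const\<close>).
\<close>

section \<open>Ideals of a subring\<close>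

text \<open>
  Ideals of subrings of a type that is a commutative ring; for subalgebras generated by vectors,
  \<open>ideal_sym_ring\<close> and \<open>primeideal_sym_ring\<close> identify them with ideals in the record-based sense.
\<close>

locale ideal_in =
  fixes A I :: "'a::comm_ring_1 set"
  assumes one_A: "1 \<in> A"
    and add_A: "\<And>a b. a \<in> A \<Longrightarrow> b \<in> A \<Longrightarrow> a + b \<in> A"
    and mult_A: "\<And>a b. a \<in> A \<Longrightarrow> b \<in> A \<Longrightarrow> a * b \<in> A"
    and uminus_A: "\<And>a. a \<in> A \<Longrightarrow> - a \<in> A"
    and I_subset: "I \<subseteq> A"
    and zero_I: "0 \<in> I"
    and add_I: "\<And>a b. a \<in> I \<Longrightarrow> b \<in> I \<Longrightarrow> a + b \<in> I"
    and mult_I: "\<And>s a. s \<in> A \<Longrightarrow> a \<in> I \<Longrightarrow> s * a \<in> I"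
begin

lemma mult_I2: "a \<in> I \<Longrightarrow> s \<in> A \<Longrightarrow> a * s \<in> I"
  by (subst mult.commute) (rule mult_I)

lemma uminus_I: "a \<in> I \<Longrightarrow> - a \<in> I"
  using mult_I[of "- 1" a] uminus_A[OF one_A] by simp

lemma diff_I: "a \<in> I \<Longrightarrow> b \<in> I \<Longrightarrow> a - b \<in> I"
  using add_I[of a "- b"] uminus_I by simp

lemma diff_A: "a \<in> A \<Longrightarrow> b \<in> A \<Longrightarrow> a - b \<in> A"
  using add_A[of a "- b"] uminus_A by simp

lemma zero_A: "0 \<in> A"
  using I_subset zero_I by blast

lemma sum_A: "(\<And>x. x \<in> S \<Longrightarrow> f x \<in> A) \<Longrightarrow> sum f S \<in> A"
  by (induction S rule: infinite_finite_induct) (auto simp: zero_A add_A)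

lemma sum_I: "(\<And>x. x \<in> S \<Longrightarrow> f x \<in> I) \<Longrightarrow> sum f S \<in> I"
  by (induction S rule: infinite_finite_induct) (auto simp: zero_I add_I)

lemma prod_A: "(\<And>x. x \<in> S \<Longrightarrow> f x \<in> A) \<Longrightarrow> prod f S \<in> A"
  by (induction S rule: infinite_finite_induct) (auto simp: one_A mult_A)

lemma power_A: "a \<in> A \<Longrightarrow> a ^ n \<in> A"
  by (induction n) (auto simp: one_A mult_A)

lemma of_nat_A: "of_nat n \<in> A"
  by (induction n) (auto simp: zero_A one_A add_A)

lemma of_int_A: "of_int z \<in> A"
  by (cases z rule: int_cases2) (simp_all add: of_nat_A uminus_A)

lemma in_I_if_add_left: "a + b \<in> I \<Longrightarrow> a \<in> I \<Longrightarrow> b \<in> I"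
  using diff_I[of "a + b" a] by simp

lemma in_I_if_add_right: "a + b \<in> I \<Longrightarrow> b \<in> I \<Longrightarrow> a \<in> I"
  using diff_I[of "a + b" b] by simp

end

locale prime_in = ideal_in +
  assumes one_notin: "1 \<notin> I"
    and prime_I: "\<And>a b. a \<in> A \<Longrightarrow> b \<in> A \<Longrightarrow> a * b \<in> I \<Longrightarrow> a \<in> I \<or> b \<in> I"
begin

lemma cancel_I: "s * a \<in> I \<Longrightarrow> s \<in> A \<Longrightarrow> a \<in> A \<Longrightarrow> s \<notin> I \<Longrightarrow> a \<in> I"
  using prime_I by blast

lemma power_notin: "s \<in> A \<Longrightarrow> s \<notin> I \<Longrightarrow> s ^ n \<notin> I"
  by (induction n) (use prime_I power_A one_notin in auto)

lemma cancel_power: "s ^ n * a \<in> I \<Longrightarrow> s \<in> A \<Longrightarrow> a \<in> A \<Longrightarrow> s \<notin> I \<Longrightarrow> a \<in> I"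
  using cancel_I power_notin power_A by blast

text \<open>
  The rank of a matrix does not grow under field extension: if the columns of a matrix over \<open>B\<close> are
  dependent over the fraction field of \<open>A/I\<close>, then they are dependent over that of the image of \<open>B\<close>.
  Fractions are avoided by Gaussian elimination with cross-multiplication.
\<close>

lemma relation_over_subring:
  assumes "finite T" "B \<subseteq> A" "\<And>a b. a \<in> B \<Longrightarrow> b \<in> B \<Longrightarrow> a * b \<in> B"
    "\<And>a b. a \<in> B \<Longrightarrow> b \<in> B \<Longrightarrow> a - b \<in> B" "1 \<in> B"
    "\<And>n i. n \<in> N \<Longrightarrow> i \<in> T \<Longrightarrow> v n i \<in> B"
    "\<And>i. i \<in> T \<Longrightarrow> w i \<in> A" "i0 \<in> T" "w i0 \<notin> I"
    "\<And>n. n \<in> N \<Longrightarrow> (\<Sum>i\<in>T. w i * v n i) \<in> I"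
  shows "\<exists>u i0. (\<forall>i\<in>T. u i \<in> B) \<and> i0 \<in> T \<and> u i0 \<notin> I \<and> (\<forall>n\<in>N. (\<Sum>i\<in>T. u i * v n i) \<in> I)"
  using assms(1,6-)
proof (induction T arbitrary: v i0 rule: finite_induct)
  case empty
  thus ?case by simp
next
  case (insert k T)
  have B0: "0 \<in> B" using assms(4)[OF assms(5) assms(5)] by simp
  have Bm: "- a \<in> B" if "a \<in> B" for a using assms(4)[OF B0 that] by simp
  have Ba: "a + b \<in> B" if "a \<in> B" "b \<in> B" for a b using assms(4)[OF that(1) Bm[OF that(2)]] by simp
  have Bs: "sum g S \<in> B" if "\<And>i. i \<in> S \<Longrightarrow> g i \<in> B" for g and S :: "'b set"
    using that by (induction S rule: infinite_finite_induct) (auto simp: B0 Ba)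
  show ?case
  proof (cases "\<forall>n\<in>N. v n k \<in> I")
    case True
    have "(\<Sum>i\<in>insert k T. (if i = k then 1 else 0) * v n i) = v n k" for n
      using insert.hyps by (simp add: if_distrib[of "\<lambda>x. x * _"] sum.delta cong: if_cong)
    thus ?thesis using True B0 assms(5) one_notin
      by (intro exI[of _ "\<lambda>i. if i = k then 1 else 0"] exI[of _ k]) (auto simp: insert.hyps)
  next
    case False
    then obtain n0 where n0: "n0 \<in> N" "v n0 k \<notin> I" by blast
    \<comment> \<open>Clear column \<open>k\<close> with the pivot in row \<open>n0\<close>.\<close>
    define v' where "v' = (\<lambda>n i. v n0 k * v n i - v n k * v n0 i)"
    have vB: "v n i \<in> B" if "n \<in> N" "i \<in> insert k T" for n i using insert.prems(1) that by blast
    have vA: "v n i \<in> A" if "n \<in> N" "i \<in> insert k T" for n i using vB[OF that] assms(2) by blast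
    have "\<exists>i\<in>T. w i \<notin> I"
    proof (rule ccontr)
      assume "\<not> ?thesis"
      hence T: "\<And>i. i \<in> T \<Longrightarrow> w i \<in> I" by blast
      hence "w k \<notin> I" using insert.prems(3,4) by blast
      moreover have "(\<Sum>i\<in>T. w i * v n0 i) \<in> I"
        by (intro sum_I mult_I2 T vA n0) auto
      with insert.prems(5)[OF n0(1)] have "w k * v n0 k \<in> I"
        using insert.hyps by (auto intro: in_I_if_add_right)
      ultimately show False using n0 prime_I[of "w k" "v n0 k"] insert.prems(2)[of k] vA[of n0 k] by auto
    qed
    then obtain i1 where i1: "i1 \<in> T" "w i1 \<notin> I" by blast
    have rel: "(\<Sum>i\<in>T. w i * v' n i) \<in> I" if "n \<in> N" for n
    proof -
      have "(\<Sum>i\<in>T. w i * v' n i) = v n0 k * (\<Sum>i\<in>insert k T. w i * v n i) - v n k * (\<Sum>i\<in>insert k T. w i * v n0 i)"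
        using insert.hyps
        by (simp add: v'_def algebra_simps sum_subtractf sum_distrib_left)
      also have "\<dots> \<in> I"
        using insert.prems(5) that n0 vA by (intro diff_I mult_I) auto
      finally show ?thesis .
    qed
    have "\<exists>u i0. (\<forall>i\<in>T. u i \<in> B) \<and> i0 \<in> T \<and> u i0 \<notin> I \<and> (\<forall>n\<in>N. (\<Sum>i\<in>T. u i * v' n i) \<in> I)"
      using insert.prems(2) vB n0
      by (intro insert.IH[OF _ _ i1 rel]) (auto simp: v'_def intro!: assms(3,4))
    then obtain u i2 where u: "\<forall>i\<in>T. u i \<in> B" "i2 \<in> T" "u i2 \<notin> I" "\<forall>n\<in>N. (\<Sum>i\<in>T. u i * v' n i) \<in> I"
      by blast
    \<comment> \<open>Back substitution; the factor \<open>v n0 k\<close> replaces division by the pivot.\<close>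
    define u' where "u' = (\<lambda>i. if i = k then - (\<Sum>i\<in>T. u i * v n0 i) else u i * v n0 k)"
    have k: "i \<in> T \<Longrightarrow> i \<noteq> k" for i using insert.hyps by blast
    have "(\<Sum>i\<in>insert k T. u' i * v n i) = (\<Sum>i\<in>T. u i * v' n i)" for n
    proof -
      have "(\<Sum>i\<in>T. u' i * v n i) = (\<Sum>i\<in>T. u i * v n0 k * v n i)"
        by (rule sum.cong) (auto simp: u'_def k)
      thus ?thesis using insert.hyps
        by (simp add: u'_def v'_def algebra_simps sum_subtractf sum_distrib_left)
    qed
    moreover have "u' i \<in> B" if "i \<in> insert k T" for i
      using that u(1) vB n0 by (auto simp: u'_def intro!: Bm Bs assms(3))
    moreover have "u' i2 \<notin> I"
      using u n0 prime_I[of "u i2" "v n0 k"] assms(2) vA[of n0 k] k by (auto simp: u'_def)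
    ultimately show ?thesis using u by (intro exI[of _ u'] exI[of _ i2]) auto
  qed
qed

end


section \<open>Pairing of sequences with polynomials\<close>

text \<open>
  For \<open>v\<close> viewed as the functional \<open>t\<^sup>n \<mapsto> v n\<close> on Laurent polynomials, \<open>chi v n p\<close> is the value at
  \<open>t\<^sup>n p\<close>.  The polynomial \<open>p\<close> annihilates the sequence, that is, gives a linear recurrence for it, when
  this vanishes for all \<open>n\<close>.
\<close>

definition chi :: "(int \<Rightarrow> 'a::comm_ring_1) \<Rightarrow> int \<Rightarrow> 'a poly \<Rightarrow> 'a" where
  "chi v n p = (\<Sum>k\<le>degree p. coeff p k * v (n + int k))"

text \<open>
  The Euler derivation \<open>t d/dt\<close>.
\<close>

definition euler :: "'a::idom poly \<Rightarrow> 'a poly" where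
  "euler p = pCons 0 (pderiv p)"

lemma coeff_euler [simp]: "coeff (euler p) k = of_nat k * coeff p k"
  by (cases k) (simp_all add: euler_def coeff_pderiv)

lemma chi_bound: "degree p \<le> N \<Longrightarrow> chi v n p = (\<Sum>k\<le>N. coeff p k * v (n + int k))"
  unfolding chi_def by (intro sum.mono_neutral_left) (auto simp: coeff_eq_0)

lemma chi_0 [simp]: "chi v n 0 = 0"
  by (simp add: chi_def)

lemma chi_add: "chi v n (p + q) = chi v n p + chi v n q"
proof -
  let ?N = "max (degree p) (degree q)"
  show ?thesis
    by (subst (1 2 3) chi_bound[where N = ?N]) (auto simp: degree_add_le algebra_simps sum.distrib)
qed

lemma chi_smult: "chi v n (smult a p) = a * chi v n p"
  by (subst (1 2) chi_bound[where N = "degree p"])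
    (auto simp: degree_smult_le sum_distrib_left mult.assoc)

lemma chi_diff: "chi v n (p - q) = chi v n p - chi v n q"
  using chi_add[of v n "p - q" q] by simp

lemma chi_pCons: "chi v n (pCons a p) = a * v n + chi v (n + 1) p"
proof -
  have "chi v n (pCons a p) = (\<Sum>k\<le>Suc (degree p). coeff (pCons a p) k * v (n + int k))"
    by (rule chi_bound) (rule degree_pCons_le)
  also have "\<dots> = a * v n + (\<Sum>k\<le>degree p. coeff p k * v (n + 1 + int k))"
    by (subst sum.atMost_Suc_shift) (simp add: add_ac)
  finally show ?thesis by (simp add: chi_def)
qed

text \<open>
  Laurent polynomials act on sequences by shifts, so \<open>\<lambda>m. chi v m q\<close> is the sequence \<open>q\<close> acting on \<open>v\<close>.
  This module structure replaces all manipulations of nested sums below.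
\<close>

lemma chi_mult: "chi v n (p * q) = chi (\<lambda>m. chi v m q) n p"
proof (induction p arbitrary: n)
  case (pCons a p)
  have "chi v n (pCons 0 (p * q)) = chi v (n + 1) (p * q)" by (simp add: chi_pCons)
  thus ?case using pCons by (simp add: chi_pCons chi_add chi_smult)
qed simp

lemma chi_shift: "chi (\<lambda>m. v (m + s)) n p = chi v (n + s) p"
  by (simp add: chi_def add_ac)

lemma chi_plus: "chi (\<lambda>m. u m + v m) n p = chi u n p + chi v n p"
  and chi_minus: "chi (\<lambda>m. u m - v m) n p = chi u n p - chi v n p"
  and chi_times: "chi (\<lambda>m. c * v m) n p = c * chi v n p"
  by (simp_all add: chi_def algebra_simps sum.distrib sum_subtractf sum_distrib_left)

lemma degree_euler_le: "degree (euler p) \<le> degree p"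
  by (intro degree_le) (simp add: coeff_eq_0)

lemma chi_weighted:
  fixes v :: "int \<Rightarrow> 'a::idom"
  shows "chi (\<lambda>m. of_int m * v m) n p = of_int n * chi v n p + chi v n (euler p)"
  unfolding chi_bound[OF degree_euler_le]
  by (simp add: chi_def algebra_simps sum.distrib sum_distrib_left)

context ideal_in
begin

lemma chi_in_I:
  assumes "\<And>k. coeff p k \<in> A" "\<And>k. v (n + int k) \<in> I"
  shows "chi v n p \<in> I"
  unfolding chi_def using assms by (intro sum_I mult_I) auto

lemma chi_annihilated_mult:
  assumes "A = UNIV" "\<And>n. chi v n w \<in> I"
  shows "chi v n (w * p) \<in> I"
  unfolding mult.commute[of w p] chi_mult by (rule chi_in_I) (use assms in auto)

end

text \<open>
  A recurrence can be solved backwards, because its lowest coefficient outside the prime ideal is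
  cancellable; so a two-sided solution that vanishes for large indices vanishes everywhere.
\<close>

lemma (in prime_in) annihilated_in:
  assumes A: "A = UNIV" and w: "coeff w a \<notin> I"
    and rel: "\<And>n. chi v n w \<in> I" and start: "\<And>n. n \<ge> n0 \<Longrightarrow> v n \<in> I"
  shows "v n \<in> I"
proof -
  define b where "b = (LEAST k. coeff w k \<notin> I)"
  have b: "coeff w b \<notin> I" unfolding b_def using w by (rule LeastI)
  have below: "coeff w k \<in> I" if "k < b" for k
    using not_less_Least[of k "\<lambda>k. coeff w k \<notin> I"] that by (auto simp: b_def)
  have bdeg: "b \<le> degree w" using b zero_I by (metis coeff_eq_0 leI)
  have "\<forall>i. n0 - int m \<le> i \<longrightarrow> v i \<in> I" for m
  proof (induction m)
    case 0
    thus ?case using start by simp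
  next
    case (Suc m)
    have "v i \<in> I" if i: "n0 - int (Suc m) \<le> i" for i
    proof (cases "n0 - int m \<le> i")
      case True
      thus ?thesis using Suc by blast
    next
      case False
      hence ieq: "i = n0 - int (Suc m)" using i by simp
      have "chi v (i - int b) w = coeff w b * v i + (\<Sum>k\<in>{..degree w} - {b}. coeff w k * v (i - int b + int k))"
        using bdeg by (simp add: chi_def sum.remove[of "{..degree w}" b])
      moreover have "(\<Sum>k\<in>{..degree w} - {b}. coeff w k * v (i - int b + int k)) \<in> I"
      proof (rule sum_I)
        fix k assume k: "k \<in> {..degree w} - {b}"
        show "coeff w k * v (i - int b + int k) \<in> I"
        proof (cases "k < b")
          case True
          thus ?thesis using below A by (intro mult_I2) auto
        next
          case False
          with k have "n0 - int m \<le> i - int b + int k" using ieq by auto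
          thus ?thesis using Suc A by (intro mult_I) auto
        qed
      qed
      ultimately have "coeff w b * v i \<in> I"
        using rel[of "i - int b"] by (metis in_I_if_add_right)
      thus ?thesis using b A cancel_I by blast
    qed
    thus ?case by blast
  qed
  from this[of "nat (n0 - n)"] show ?thesis by simp
qed


section \<open>Partial derivatives and the Poisson bracket\<close>

text \<open>
  The generator \<open>x\<^sub>n\<close> of the symmetric algebra, which stands for \<open>t\<^sup>n\<partial>\<close>.
\<close>

definition wvar :: "int \<Rightarrow> (int, 'k::comm_ring_1) sym" where
  "wvar n = sym_embed (Poly_Mapping.single n 1)"

definition partial :: "'x \<Rightarrow> ('x, 'k::comm_ring_1) sym \<Rightarrow> ('x, 'k) sym" where
  "partial i = sym_deriv (\<lambda>x. if x = i then 1 else 0)"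

definition indets :: "('x, 'k::comm_ring_1) sym \<Rightarrow> 'x set" where
  "indets p = (\<Union>m\<in>Poly_Mapping.keys p. Poly_Mapping.keys m)"

lemma finite_indets [simp]: "finite (indets p)"
  by (simp add: indets_def)

lemma derivation_partial: "derivation (partial i)"
  unfolding partial_def by (rule derivation_sym_deriv)

lemma partial_wvar: "partial i (wvar n) = (if n = i then 1 else 0)"
  by (simp add: partial_def wvar_def del: One_nat_def)

lemma partial_const [simp]: "partial i (sym_const c) = 0"
  by (simp add: partial_def)

lemma lookup_partial:
  fixes p :: "('x, 'k::comm_ring_1) sym"
  shows "Poly_Mapping.lookup (partial i p) m =
     of_nat (Suc (Poly_Mapping.lookup m i)) * Poly_Mapping.lookup p (m + Poly_Mapping.single i 1)"
proof (rule additive_map_eqI[where f = "\<lambda>p. Poly_Mapping.lookup (partial i p) m" and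
      g = "\<lambda>p. of_nat (Suc (Poly_Mapping.lookup m i)) * Poly_Mapping.lookup p (m + Poly_Mapping.single i 1)"])
  show "additive_map (\<lambda>p. Poly_Mapping.lookup (partial i p) m)"
    by (simp add: additive_map_def derivation_add[OF derivation_partial] lookup_add)
  show "additive_map (\<lambda>p. of_nat (Suc (Poly_Mapping.lookup m i)) * Poly_Mapping.lookup p (m + Poly_Mapping.single i 1))"
    by (simp add: additive_map_def lookup_add algebra_simps)
next
  fix m' :: "'x \<Rightarrow>\<^sub>0 nat" and c :: 'k
  have "partial i (Poly_Mapping.single m' c) = Poly_Mapping.single (m' - Poly_Mapping.single i 1) (of_nat (Poly_Mapping.lookup m' i) * c)"
    by (auto simp: partial_def sym_deriv_single if_distrib[of "\<lambda>x. _ * x"] sum.delta in_keys_iff cong: if_cong)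
  moreover have "m' - Poly_Mapping.single i 1 = m \<longleftrightarrow> m' = m + Poly_Mapping.single i 1" if "Poly_Mapping.lookup m' i \<noteq> 0"
  proof
    assume "m' - Poly_Mapping.single i 1 = m"
    thus "m' = m + Poly_Mapping.single i 1" using that
      by (intro poly_mapping_eqI) (auto simp: lookup_add lookup_minus lookup_single when_def)
  qed simp
  ultimately show "Poly_Mapping.lookup (partial i (Poly_Mapping.single m' c)) m =
     of_nat (Suc (Poly_Mapping.lookup m i)) * Poly_Mapping.lookup (Poly_Mapping.single m' c) (m + Poly_Mapping.single i 1)"
    by (cases "Poly_Mapping.lookup m' i = 0")
      (auto simp: lookup_single when_def lookup_add)
qed

lemma partial_eq_0: "i \<notin> indets p \<Longrightarrow> partial i p = 0"
proof (rule poly_mapping_eqI)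
  fix m :: "'a \<Rightarrow>\<^sub>0 nat" assume "i \<notin> indets p"
  moreover have "i \<in> Poly_Mapping.keys (m + Poly_Mapping.single i 1)"
    unfolding in_keys_iff lookup_add by simp
  ultimately have "m + Poly_Mapping.single i 1 \<notin> Poly_Mapping.keys p"
    by (auto simp: indets_def)
  thus "Poly_Mapping.lookup (partial i p) m = Poly_Mapping.lookup 0 m"
    by (simp add: lookup_partial in_keys_iff)
qed

lemma sym_deriv_expand:
  assumes "finite F" "indets p \<subseteq> F"
  shows "sym_deriv d p = (\<Sum>i\<in>F. partial i p * d i)"
proof -
  let ?T = "\<lambda>m x. Poly_Mapping.single (m - Poly_Mapping.single x 1)
       (of_nat (Poly_Mapping.lookup m x) * Poly_Mapping.lookup p m)"
  have ext: "(\<Sum>x\<in>Poly_Mapping.keys m. ?T m x * e x) = (\<Sum>x\<in>F. ?T m x * e x)"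
    if "m \<in> Poly_Mapping.keys p" for m e
  proof (rule sum.mono_neutral_left[OF assms(1)])
    show "Poly_Mapping.keys m \<subseteq> F" using that assms(2) by (auto simp: indets_def)
  qed (simp add: in_keys_iff)
  have exp: "sym_deriv e p = (\<Sum>x\<in>F. (\<Sum>m\<in>Poly_Mapping.keys p. ?T m x) * e x)" for e
    unfolding sym_deriv_def sum_distrib_right by (subst sum.swap) (intro sum.cong refl ext)
  have "partial i p = (\<Sum>m\<in>Poly_Mapping.keys p. ?T m i)" if "i \<in> F" for i
    unfolding partial_def exp using assms(1) that
    by (simp add: if_distrib[of "\<lambda>x. _ * x"] sum.delta cong: if_cong)
  thus ?thesis unfolding exp by simp
qed

lemma of_int_sym_const: "(of_int z :: ('x, 'k::comm_ring_1) sym) = sym_const (of_int z)"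
proof -
  have nat: "(of_nat n :: ('x, 'k) sym) = sym_const (of_nat n)" for n
    by (induction n) (simp_all add: sym_const_add)
  show ?thesis by (cases z rule: int_cases2) (simp_all add: nat sym_const_uminus)
qed

lemma witt_pb_wvar: "witt_pb (wvar m) (wvar n) = of_int (n - m) * wvar (m + n - 1)"
proof -
  have "witt_bracket (Poly_Mapping.single m 1) (Poly_Mapping.single n (1::'a)) =
      scal (of_int (n - m)) (Poly_Mapping.single (m + n - 1) 1)"
    by (simp add: witt_bracket_def laurent_deriv_single mult_single algebra_simps flip: single_diff)
  thus ?thesis
    by (simp only: wvar_def sym_bracket_embed[OF lie_bracket_witt] sym_embed_scal of_int_sym_const)
qed

lemmas derivation_ad = derivation_sym_bracket_right[of witt_bracket]

lemma witt_pb_expand: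
  assumes "finite F" "indets p \<subseteq> F"
  shows "witt_pb p q = (\<Sum>i\<in>F. partial i p * witt_pb (wvar i) q)"
proof -
  have "witt_pb (wvar i) q = sym_deriv (\<lambda>y. sym_embed (witt_bracket (Poly_Mapping.single i 1) (Poly_Mapping.single y 1))) q" for i
    unfolding wvar_def by (simp add: sym_bracket_def del: One_nat_def)
  thus ?thesis using sym_deriv_expand[OF assms] by (simp add: sym_bracket_def)
qed

lemma witt_pb_wvar_expand:
  assumes "finite F" "indets p \<subseteq> F"
  shows "witt_pb (wvar n) p = (\<Sum>i\<in>F. partial i p * (of_int (i - n) * wvar (n + i - 1)))"
proof -
  have "witt_pb (wvar n) p = - witt_pb p (wvar n)"
    by (rule sym_bracket_skew[OF lie_bracket_witt])
  also have "\<dots> = (\<Sum>i\<in>F. partial i p * - witt_pb (wvar i) (wvar n))"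
    by (simp add: witt_pb_expand[OF assms] sum_negf)
  also have "\<dots> = (\<Sum>i\<in>F. partial i p * (of_int (i - n) * wvar (n + i - 1)))"
    by (intro sum.cong refl) (simp add: witt_pb_wvar algebra_simps)
  finally show ?thesis .
qed

text \<open>
  The commutator of the derivations \<open>\<partial>/\<partial>x\<^sub>j\<close> and \<open>{x\<^sub>m, -}\<close> is a derivation, so it is determined by the
  generators.
\<close>

lemma partial_witt_pb:
  fixes p :: "(int, 'k::comm_ring_1) sym"
  shows "partial j (witt_pb (wvar m) p) = witt_pb (wvar m) (partial j p) + of_int (j - 2 * m + 1) * partial (j - m + 1) p"
proof -
  let ?D = "\<lambda>p :: (int, 'k) sym. partial j (witt_pb (wvar m) p) - witt_pb (wvar m) (partial j p) - of_int (j - 2 * m + 1) * partial (j - m + 1) p"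
  have "derivation ?D"
    unfolding derivation_def
    by (simp add: derivation_add[OF derivation_partial] derivation_mult[OF derivation_partial]
        derivation_add[OF derivation_ad] derivation_mult[OF derivation_ad] algebra_simps)
  hence "?D p = 0"
  proof (rule derivation_eq_0)
    fix c :: 'k show "?D (sym_const c) = 0"
      by (simp add: derivation_0[OF derivation_partial] derivation_0[OF derivation_ad])
  next
    fix x
    have *: "partial j (witt_pb (wvar m) (wvar x)) = (if m + x - 1 = j then of_int (x - m) else (0 :: (int, 'k) sym))"
      unfolding witt_pb_wvar of_int_sym_const
      by (simp add: derivation_mult[OF derivation_partial] partial_wvar)
    have "?D (wvar x) = 0"
      using sym_bracket_const(2)[of witt_bracket "wvar m :: (int, 'k) sym" 1]
        sym_bracket_const(2)[of witt_bracket "wvar m :: (int, 'k) sym" 0]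
      by (auto simp: * partial_wvar)
    thus "?D (sym_embed (Poly_Mapping.single x 1)) = 0" unfolding wvar_def .
  qed
  thus ?thesis by (simp add: algebra_simps)
qed


section \<open>Recurrences modulo a Poisson ideal\<close>

text \<open>
  The differential of \<open>f\<close>, an element of the free module on the \<open>t\<^sup>i\<partial>\<close>, divided by \<open>t\<^sup>c\<close>; the shift makes it
  a polynomial when \<open>f\<close> has no variables of index below \<open>c\<close>.
\<close>

definition grad :: "int \<Rightarrow> (int, 'k::field) sym \<Rightarrow> (int, 'k) sym poly" where
  "grad c f = Abs_poly (\<lambda>k. partial (c + int k) f)"

lemma coeff_grad [simp]: "coeff (grad c f) k = partial (c + int k) f"
proof -
  have "c + int k \<in> indets f" if "partial (c + int k) f \<noteq> 0" for k
    using that partial_eq_0[of "c + int k" f] by argo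
  hence "{k. partial (c + int k) f \<noteq> 0} \<subseteq> (\<lambda>k. c + int k) -` indets f"
    by (simp add: subset_iff)
  moreover have "finite ((\<lambda>k. c + int k) -` indets f)"
    by (intro finite_vimageI) (auto simp: inj_def)
  ultimately have "finite {k. partial (c + int k) f \<noteq> 0}" by (rule finite_subset)
  hence "\<forall>\<^sub>\<infinity>k. partial (c + int k) f = 0" unfolding MOST_iff_cofinite .
  thus ?thesis unfolding grad_def by (subst Abs_poly_inverse) simp_all
qed

text \<open>
  The bracket with \<open>x\<^sub>n\<close> pairs the differential of \<open>f\<close> with the sequence \<open>x\<close>.  With \<open>p\<close> for the gradient,
  \<open>{x\<^sub>n, f}\<close> is the functional \<open>x\<close> evaluated at \<open>t\<^sup>n p' - n t\<^bsup>n-1\<^esup> p\<close>, up to the shift by \<open>c\<close>.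
\<close>

lemma witt_pb_wvar_chi:
  assumes "\<And>i. i < c \<Longrightarrow> partial i f = 0"
  shows "witt_pb (wvar n) f =
    chi wvar (n + c - 1) (euler (grad c f)) + of_int (c - n) * chi wvar (n + c - 1) (grad c f)"
proof -
  obtain N lo where N: "degree (grad c f) \<le> N" "indets f \<subseteq> {lo..c + int N}"
  proof -
    obtain l h where lh: "indets f \<subseteq> {l..h}"
    proof
      show "indets f \<subseteq> {Min (indets f)..Max (indets f)}" by auto
    qed
    show ?thesis
    proof (rule that)
      have "h \<le> c + int (max (degree (grad c f)) (nat (h - c)))" by simp
      thus "indets f \<subseteq> {l..c + int (max (degree (grad c f)) (nat (h - c)))}"
        using lh by (meson atLeastAtMost_iff order_trans subset_iff)
    qed simp
  qed
  have "witt_pb (wvar n) f = (\<Sum>i\<in>{lo..c + int N}. partial i f * (of_int (i - n) * wvar (n + i - 1)))"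
    by (rule witt_pb_wvar_expand) (use N in auto)
  also have "\<dots> = (\<Sum>i\<in>{c..c + int N}. partial i f * (of_int (i - n) * wvar (n + i - 1)))"
  proof (rule sum.mono_neutral_cong)
    fix i assume "i \<in> {c..c + int N} - {lo..c + int N}"
    hence "i \<notin> indets f" using N(2) by auto
    thus "partial i f * (of_int (i - n) * wvar (n + i - 1)) = 0"
      by (simp add: partial_eq_0)
  qed (use assms in auto)
  also have "\<dots> = (\<Sum>k\<le>N. partial (c + int k) f * (of_int (c + int k - n) * wvar (n + (c + int k) - 1)))"
    by (rule sum.reindex_bij_witness[of _ "\<lambda>k. c + int k" "\<lambda>i. nat (i - c)"]) auto
  also have "\<dots> = chi wvar (n + c - 1) (euler (grad c f)) + of_int (c - n) * chi wvar (n + c - 1) (grad c f)"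
    unfolding chi_bound[OF N(1)] chi_bound[OF order_trans[OF degree_euler_le N(1)]]
    by (simp add: algebra_simps sum.distrib sum_subtractf sum_distrib_left)
  finally show ?thesis .
qed

text \<open>
  This is \<open>t\<close> times the Wronskian \<open>p' q - p q'\<close>.  The factor \<open>t\<close> makes the coefficient formula symmetric.
\<close>

definition wronskian :: "'a::idom poly \<Rightarrow> 'a poly \<Rightarrow> 'a poly" where
  "wronskian p q = euler p * q - p * euler q"

lemma coeff_wronskian:
  "coeff (wronskian p q) e = (\<Sum>k\<le>e. of_int (2 * int k - int e) * (coeff p k * coeff q (e - k)))"
  unfolding wronskian_def coeff_diff coeff_mult sum_subtractf[symmetric]
  by (intro sum.cong refl) (simp add: algebra_simps of_nat_diff)

text \<open>
  Let \<open>p\<close>, \<open>q\<close> be the gradients.  Combining the brackets \<open>{x\<^sub>m, f}\<close> with the coefficients of \<open>h = q t\<^sup>n\<close> gives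
  the pairing with \<open>p' h - p h'\<close>; exchange the roles and take \<open>h = p t\<^sup>n\<close> for \<open>g\<close>.  The terms in which \<open>t\<^sup>n\<close> is
  differentiated coincide, and the rest of the difference is twice the pairing with the Wronskian.
\<close>

lemma chi_wronskian:
  assumes "\<And>i. i < c \<Longrightarrow> partial i f = 0" "\<And>i. i < c \<Longrightarrow> partial i g = 0"
  shows "2 * chi wvar (n + c - 1) (wronskian (grad c f) (grad c g)) =
    chi (\<lambda>m. witt_pb (wvar m) f) n (grad c g) - chi (\<lambda>m. witt_pb (wvar m) g) n (grad c f)"
proof -
  have shift: "chi (\<lambda>m. chi wvar (m + c - 1) r) n q = chi wvar (n + c - 1) (q * r)" for n r and q :: "(int, 'a) sym poly"
    using chi_shift[of "\<lambda>m. chi wvar m r" "c - 1" n q] by (simp add: chi_mult algebra_simps)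
  have *: "chi (\<lambda>m. witt_pb (wvar m) f) n q =
     chi wvar (n + c - 1) (q * euler (grad c f)) + of_int (c - n) * chi wvar (n + c - 1) (q * grad c f)
      - chi wvar (n + c - 1) (euler q * grad c f)"
    if "\<And>i. i < c \<Longrightarrow> partial i f = 0" for f and q :: "(int, 'a) sym poly"
  proof -
    let ?u = "\<lambda>m. chi wvar (m + c - 1) (euler (grad c f))" and ?v = "\<lambda>m. chi wvar (m + c - 1) (grad c f)"
    have "(\<lambda>m. witt_pb (wvar m) f) = (\<lambda>m. (?u m + of_int c * ?v m) - of_int m * ?v m)"
      by (simp add: fun_eq_iff witt_pb_wvar_chi[OF that] algebra_simps)
    thus ?thesis
      by (simp only: chi_minus chi_plus chi_times chi_weighted shift) (simp add: algebra_simps)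
  qed
  have "chi wvar (n + c - 1) (wronskian (grad c f) (grad c g)) =
      chi wvar (n + c - 1) (grad c g * euler (grad c f)) - chi wvar (n + c - 1) (grad c f * euler (grad c g))"
    by (simp only: wronskian_def chi_diff mult.commute)
  thus ?thesis
    by (simp only: *[OF assms(1), of "grad c g"] *[OF assms(2), of "grad c f"] mult.commute[of "grad c g" "grad c f"]
        mult.commute[of "euler (grad c f)" "grad c g"] mult.commute[of "euler (grad c g)" "grad c f"])
      (simp add: algebra_simps)
qed

text \<open>
  Bracketing a recurrence with \<open>x\<^sub>j\<close> produces a recurrence with new coefficients, up to a
  multiple of the original one that is linear in \<open>n\<close>.
\<close>

lemma chi_wvar_bracket:
  "witt_pb (wvar j) (chi wvar n w) =
     chi wvar n (map_poly (witt_pb (wvar j)) w) + chi wvar (n + j - 1) (euler w)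
       + of_int (n - j) * chi wvar (n + j - 1) w"
proof -
  have deg: "degree (map_poly (witt_pb (wvar j)) w) \<le> degree w"
    by (intro degree_le) (simp add: coeff_map_poly derivation_0[OF derivation_ad] coeff_eq_0)
  have "witt_pb (wvar j) (chi wvar n w) =
      (\<Sum>k\<le>degree w. witt_pb (wvar j) (coeff w k * wvar (n + int k)))"
    unfolding chi_def by (rule additive_map_sum[OF derivation_additive[OF derivation_ad]])
  also have "\<dots> = (\<Sum>k\<le>degree w. witt_pb (wvar j) (coeff w k) * wvar (n + int k)
      + coeff w k * (of_int (n + int k - j) * wvar (n + j - 1 + int k)))"
    by (intro sum.cong refl) (simp add: derivation_mult[OF derivation_ad] witt_pb_wvar algebra_simps)
  finally show ?thesis
    unfolding chi_bound[OF degree_euler_le] chi_bound[OF deg] chi_def[of wvar _ w]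
    by (simp add: coeff_map_poly derivation_0[OF derivation_ad] algebra_simps sum.distrib sum_subtractf sum_distrib_left)
qed

lemma indets_partial: "indets (partial i f) \<subseteq> indets f"
proof
  fix x assume "x \<in> indets (partial i f)"
  then obtain m where m: "Poly_Mapping.lookup (partial i f) m \<noteq> 0" "x \<in> Poly_Mapping.keys m"
    by (auto simp: indets_def in_keys_iff)
  hence "m + Poly_Mapping.single i 1 \<in> Poly_Mapping.keys f"
    by (auto simp: lookup_partial in_keys_iff)
  moreover have "x \<in> Poly_Mapping.keys (m + Poly_Mapping.single i 1)"
    using m(2) unfolding in_keys_iff lookup_add by simp
  ultimately show "x \<in> indets f" by (auto simp: indets_def)
qed

lemma indets_wvar: "indets (wvar n) \<subseteq> {n}"
  by (auto simp: indets_def wvar_def sym_embed_single split: if_splits)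

lemma indets_const [simp]: "indets (sym_const c) = {}"
  by (auto simp: indets_def sym_const_def split: if_splits)

text \<open>
  Prime Poisson ideals of the polynomial ring on the \<open>x\<^sub>n\<close> with \<open>n \<in> X\<close>, for \<open>X\<close> all integers or the
  non-negative ones; \<open>prime_poisson_witt\<close> makes the correspondence precise.  By the Leibniz rule
  it is enough to ask for closure under brackets with generators.
\<close>

locale witt_prime = prime_in "{p. indets p \<subseteq> X}" J
  for X and J :: "(int, 'k::field_char_0) sym set" +
  assumes bracket_J: "\<And>n f. n \<in> X \<Longrightarrow> f \<in> J \<Longrightarrow> witt_pb (wvar n) f \<in> J"
begin

abbreviation "A \<equiv> {p :: (int, 'k) sym. indets p \<subseteq> X}"

lemma const_A: "sym_const c \<in> A"
  by simp

lemma partial_A: "f \<in> A \<Longrightarrow> partial i f \<in> A"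
  using indets_partial[of i f] by auto

lemma const_cancel: "sym_const c * f \<in> J \<Longrightarrow> c \<noteq> 0 \<Longrightarrow> f \<in> J"
  using mult_I[OF const_A[of "1 / c"], of "sym_const c * f"]
  by (simp add: mult.assoc[symmetric] flip: sym_const_mult)

lemma of_int_cancel: "of_int z * f \<in> J \<Longrightarrow> z \<noteq> 0 \<Longrightarrow> f \<in> J"
  using const_cancel[of "of_int z" f] by (simp add: of_int_sym_const)

lemma partial_outside: "i \<notin> X \<Longrightarrow> f \<in> A \<Longrightarrow> partial i f = 0"
  by (rule partial_eq_0) auto

text \<open>
  In characteristic \<open>0\<close> an ideal closed under all partial derivatives contains, with any nonzero
  element, a nonzero constant, obtained by differentiating a monomial of top degree away.
\<close>

lemma exists_partial_notin:
  assumes "f \<in> J" "f \<noteq> 0"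
  shows "\<exists>f\<in>J. \<exists>i. partial i f \<notin> J"
proof (rule ccontr)
  assume "\<not> ?thesis"
  hence closed: "partial i f \<in> J" if "f \<in> J" for i f using that by blast
  define mdeg where "mdeg = (additive_ext (\<lambda>_ n. n) :: (int \<Rightarrow>\<^sub>0 nat) \<Rightarrow> nat)"
  have mdeg_add: "mdeg (m + m') = mdeg m + mdeg m'" for m m'
    unfolding mdeg_def by (rule additive_mapD[OF additive_ext_additive]) simp_all
  have mdeg_single: "mdeg (Poly_Mapping.single i 1) = 1" for i
    unfolding mdeg_def by (subst additive_ext_single) simp_all
  have const: "1 \<in> J" if f: "f \<in> J" "f \<noteq> 0" and partial: "\<And>i. partial i f = 0" for f
  proof -
    have "Poly_Mapping.lookup f m = 0" if "m \<noteq> 0" for m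
    proof -
      from that obtain i where i: "Poly_Mapping.lookup m i \<noteq> 0"
        by (metis poly_mapping_eqI lookup_zero)
      have "m = (m - Poly_Mapping.single i 1) + Poly_Mapping.single i 1"
        using i by (intro poly_mapping_eqI) (auto simp: lookup_add lookup_minus lookup_single when_def)
      moreover have "Poly_Mapping.lookup (partial i f) (m - Poly_Mapping.single i 1) = 0"
        by (simp add: partial)
      ultimately show ?thesis unfolding lookup_partial by (metis mult_eq_0_iff of_nat_eq_0_iff nat.distinct(2))
    qed
    hence "f = sym_const (Poly_Mapping.lookup f 0)"
      unfolding sym_const_def by (intro poly_mapping_eqI) (auto simp: lookup_single when_def)
    thus "1 \<in> J" using f const_cancel[of "Poly_Mapping.lookup f 0" 1] by fastforce
  qed
  have "1 \<in> J" if "f \<in> J" "f \<noteq> 0" "\<And>m. m \<in> Poly_Mapping.keys f \<Longrightarrow> mdeg m \<le> n" for f n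
    using that
  proof (induction n arbitrary: f)
    case 0
    have "partial i f = 0" for i
    proof (rule poly_mapping_eqI)
      fix m
      have "m + Poly_Mapping.single i 1 \<notin> Poly_Mapping.keys f"
        using 0(3)[of "m + Poly_Mapping.single i 1"] unfolding mdeg_add mdeg_single by auto
      thus "Poly_Mapping.lookup (partial i f) m = Poly_Mapping.lookup 0 m"
        by (simp add: lookup_partial in_keys_iff)
    qed
    thus ?case using const 0 by blast
  next
    case (Suc n)
    show ?case
    proof (cases "\<forall>i. partial i f = 0")
      case True
      thus ?thesis using const Suc.prems by blast
    next
      case False
      then obtain i where i: "partial i f \<noteq> 0" by blast
      have "mdeg m \<le> n" if "m \<in> Poly_Mapping.keys (partial i f)" for m
      proof -
        have "m + Poly_Mapping.single i 1 \<in> Poly_Mapping.keys f"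
          using that by (auto simp: lookup_partial in_keys_iff)
        thus ?thesis using Suc.prems(3) mdeg_add mdeg_single by fastforce
      qed
      thus ?thesis using Suc.IH[of "partial i f"] i closed[OF Suc.prems(1)] by blast
    qed
  qed
  moreover have "\<exists>n. \<forall>m\<in>Poly_Mapping.keys f. mdeg m \<le> n"
    by (intro exI[of _ "Max (mdeg ` Poly_Mapping.keys f)"]) simp
  ultimately show False using assms one_notin by blast
qed

text \<open>
  Modulo the ideal, the gradient of \<open>f\<close> has a top term of index \<open>d\<close>.  Bracketing with \<open>x\<^sub>m\<close> for large \<open>m\<close>
  moves it to index \<open>d + m - 1\<close> with coefficient multiplied by \<open>d - m\<close>.  Two gradients of different degrees have a
  nonzero Wronskian.
\<close>

lemma wronskian_notin:
  assumes f: "f \<in> J" "partial i0 f \<notin> J" and c: "\<And>i. i < c \<Longrightarrow> partial i f = 0" and X: "{2..} \<subseteq> X"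
  shows "\<exists>m\<in>X. (\<forall>i<c. partial i (witt_pb (wvar m) f) = 0) \<and>
     (\<exists>e. coeff (wronskian (grad c f) (grad c (witt_pb (wvar m) f))) e \<notin> J)"
proof -
  define T where "T = {i. partial i f \<notin> J}"
  have T: "finite T"
  proof (rule finite_subset[OF _ finite_indets[of f]])
    show "T \<subseteq> indets f" unfolding T_def using partial_eq_0 zero_I by (metis (mono_tags, lifting) mem_Collect_eq subsetI)
  qed
  define d where "d = Max T"
  have dT: "d \<in> T" unfolding d_def by (rule Max_in[OF T]) (use f in \<open>auto simp: T_def\<close>)
  hence d: "partial d f \<notin> J" by (simp add: T_def)
  have above: "partial i f \<in> J" if "i > d" for i
    using that Max_ge[OF T, of i] unfolding T_def d_def by (meson leD mem_Collect_eq)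
  have cd: "c \<le> d" using d c[of d] zero_I by (metis leI)
  \<comment> \<open>\<open>m \<ge> 2\<close> makes the degrees differ, and \<open>m > d\<close> makes the new top coefficient nonzero.\<close>
  define m where "m = max 2 (d + 1)"
  have m: "m \<ge> 2" "m > d" "m \<in> X" using X by (auto simp: m_def)
  let ?g = "witt_pb (wvar m) f"
  have gc: "partial i ?g = 0" if "i < c" for i
    unfolding partial_witt_pb using c[of i] c[of "i - m + 1"] that m by (simp add: derivation_0[OF derivation_ad])
  have gabove: "partial j ?g \<in> J" if "j > d + m - 1" for j
    unfolding partial_witt_pb using that m
    by (intro add_I mult_I bracket_J above of_int_A) auto
  have fA: "partial i f \<in> A" for i using f I_subset by (intro partial_A) auto
  have gA: "partial i ?g \<in> A" for i using bracket_J[OF m(3) f(1)] I_subset by (intro partial_A) auto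
  have gtop: "partial (d + m - 1) ?g \<notin> J"
  proof
    assume *: "partial (d + m - 1) ?g \<in> J"
    have "witt_pb (wvar m) (partial (d + m - 1) f) \<in> J" using m by (intro bracket_J above) auto
    moreover have "d + m - 1 - 2 * m + 1 = d - m" "d + m - 1 - m + 1 = d" by simp_all
    ultimately have "of_int (d - m) * partial d f \<in> J"
      using * in_I_if_add_left unfolding partial_witt_pb by metis
    thus False using of_int_cancel[of "d - m"] m d by auto
  qed
  define a b where "a = nat (d - c)" and "b = nat (d + m - 1 - c)"
  have ab: "c + int a = d" "c + int b = d + m - 1" using cd m by (simp_all add: a_def b_def)
  let ?t = "\<lambda>k. of_int (2 * int k - int (a + b)) * (coeff (grad c f) k * coeff (grad c ?g) (a + b - k))"
  have eq: "coeff (wronskian (grad c f) (grad c ?g)) (a + b) = ?t a + (\<Sum>k\<in>{..a + b} - {a}. ?t k)"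
    unfolding coeff_wronskian by (rule sum.remove) auto
  have rest: "(\<Sum>k\<in>{..a + b} - {a}. ?t k) \<in> J"
  proof (rule sum_I)
    fix k assume k: "k \<in> {..a + b} - {a}"
    show "?t k \<in> J"
    proof (cases "k > a")
      case True
      hence "partial (c + int k) f \<in> J" using ab by (intro above) simp
      thus ?thesis unfolding coeff_grad by (intro mult_I[OF of_int_A] mult_I2 gA)
    next
      case False
      hence "partial (c + int (a + b - k)) ?g \<in> J" using k ab by (intro gabove) (simp add: of_nat_diff)
      thus ?thesis unfolding coeff_grad by (intro mult_I[OF of_int_A] mult_I fA)
    qed
  qed
  \<comment> \<open>The integer factor is \<open>a - b = 1 - m\<close>, which is a unit in the field.\<close>
  have top: "?t a \<notin> J"
  proof
    assume "?t a \<in> J"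
    hence "coeff (grad c f) a * coeff (grad c ?g) (a + b - a) \<in> J"
      by (rule of_int_cancel) (use ab m in linarith)
    hence "partial d f * partial (d + m - 1) ?g \<in> J" using ab by simp
    thus False using prime_I[OF fA gA] d gtop by blast
  qed
  have "coeff (wronskian (grad c f) (grad c ?g)) (a + b) \<notin> J"
  proof
    assume "coeff (wronskian (grad c f) (grad c ?g)) (a + b) \<in> J"
    hence "?t a \<in> J" unfolding eq using rest by (rule in_I_if_add_right)
    with top show False by contradiction
  qed
  thus ?thesis using m gc by blast
qed

lemma chi_wronskian_in:
  assumes "f \<in> J" "g \<in> J" "\<And>i. i < c \<Longrightarrow> partial i f = 0" "\<And>i. i < c \<Longrightarrow> partial i g = 0" "{n..} \<subseteq> X"
  shows "chi wvar (n + c - 1) (wronskian (grad c f) (grad c g)) \<in> J"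
proof (rule of_int_cancel)
  have fg: "f \<in> A" "g \<in> A" using assms(1,2) I_subset by blast+
  have X: "n + int k \<in> X" for k using assms(5) by auto
  have "chi (\<lambda>m. witt_pb (wvar m) f) n (grad c g) \<in> J" "chi (\<lambda>m. witt_pb (wvar m) g) n (grad c f) \<in> J"
    unfolding chi_def coeff_grad by (intro sum_I mult_I partial_A fg bracket_J X assms(1,2))+
  thus "of_int 2 * chi wvar (n + c - 1) (wronskian (grad c f) (grad c g)) \<in> J"
    using chi_wronskian[of c f g n] assms(3,4) diff_I by simp
qed simp

lemma coeff_wronskian_A:
  assumes "f \<in> A" "g \<in> A"
  shows "coeff (wronskian (grad c f) (grad c g)) k \<in> A"
  unfolding coeff_wronskian coeff_grad by (intro sum_A mult_A of_int_A partial_A assms)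

end


section \<open>Contraction is injective\<close>

lemma W_ge_carrier: "sym_span W_ge = {p :: (int, 'k::comm_ring_1) sym. indets p \<subseteq> {0..}}"
  by (auto simp: sym_span_W_ge indets_def)

lemma indets_0 [simp]: "indets (0 :: ('x, 'k::comm_ring_1) sym) = {}"
  and indets_1 [simp]: "indets (1 :: ('x, 'k::comm_ring_1) sym) = {}"
  by (simp_all add: indets_def)

lemma nonneg_closed:
  fixes p q :: "(int, 'k::comm_ring_1) sym"
  shows "indets (1 :: (int, 'k) sym) \<subseteq> {0..}"
    "indets p \<subseteq> {0..} \<Longrightarrow> indets q \<subseteq> {0..} \<Longrightarrow> indets (p + q) \<subseteq> {0..}"
    "indets p \<subseteq> {0..} \<Longrightarrow> indets q \<subseteq> {0..} \<Longrightarrow> indets (p * q) \<subseteq> {0..}"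
    "indets p \<subseteq> {0..} \<Longrightarrow> indets (- p) \<subseteq> {0..}"
    "indets p \<subseteq> {0..} \<Longrightarrow> 0 \<le> n \<Longrightarrow> indets (witt_pb (wvar n) p) \<subseteq> {0..}"
proof -
  have *: "indets p \<subseteq> {0..} \<longleftrightarrow> p \<in> sym_span W_ge" for p :: "(int, 'k) sym" by (simp add: W_ge_carrier)
  show "indets (1 :: (int, 'k) sym) \<subseteq> {0..}" by simp
  have w: "wvar n \<in> sym_span W_ge" if "0 \<le> n" for n :: int
    using indets_wvar[of n] that by (auto simp: W_ge_carrier)
  show "indets p \<subseteq> {0..} \<Longrightarrow> indets q \<subseteq> {0..} \<Longrightarrow> indets (p + q) \<subseteq> {0..}"
    "indets p \<subseteq> {0..} \<Longrightarrow> indets q \<subseteq> {0..} \<Longrightarrow> indets (p * q) \<subseteq> {0..}"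
    "indets p \<subseteq> {0..} \<Longrightarrow> indets (- p) \<subseteq> {0..}"
    "indets p \<subseteq> {0..} \<Longrightarrow> 0 \<le> n \<Longrightarrow> indets (witt_pb (wvar n) p) \<subseteq> {0..}"
    unfolding * using w sym_bracket_in_span[OF lie_bracket_witt witt_bracket_W_ge, of "wvar n" p]
    by (auto intro: sym_span.add sym_span.mult sym_span_uminus)
qed

lemma witt_prime_contract:
  assumes "witt_prime UNIV (J :: (int, 'k::field_char_0) sym set)"
  shows "witt_prime {0..} (J \<inter> {p. indets p \<subseteq> {0..}})"
proof -
  interpret J: witt_prime UNIV J by fact
  show ?thesis
  proof (unfold_locales, goal_cases)
    case (10 a b)
    thus ?case using J.prime_I[of a b] by auto
  next
    case 9
    thus ?case using J.one_notin by blast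
  next
    case (11 n f)
    thus ?case using J.bracket_J[of n f] nonneg_closed(5)[of f n] by auto
  qed (simp_all add: nonneg_closed J.zero_I J.add_I J.mult_I)
qed

text \<open>
  The elements that become congruent to a polynomial in non-negative variables after multiplication by
  a power of the coefficient \<open>s\<close> form a subalgebra.  The recurrence puts \<open>x\<^sub>n\<close> with \<open>n < 0\<close> into it by
  descending induction, because \<open>s x\<^sub>n\<close> is a combination of later variables.
\<close>

lemma reduce_to_nonneg:
  fixes K :: "(int, 'k::field_char_0) sym set"
  assumes K: "ideal_in UNIV K"
    and coeffs: "\<And>k. indets (coeff w k) \<subseteq> {0..}" "\<And>k. k < a \<Longrightarrow> coeff w k \<in> K"
    and rel: "\<And>n. n < 0 \<Longrightarrow> chi wvar (n - int a) w \<in> K"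
  shows "\<exists>M g. indets g \<subseteq> {0..} \<and> coeff w a ^ M * f - g \<in> K"
proof -
  interpret K: ideal_in UNIV K by fact
  define s where "s = coeff w a"
  have s: "indets s \<subseteq> {0..}" by (simp add: s_def coeffs)
  note cl = nonneg_closed
  have spow: "indets (s ^ M) \<subseteq> {0..}" for M
    by (induction M) (auto simp: cl s)
  define B where "B = {f. \<exists>M g. indets g \<subseteq> {0..} \<and> s ^ M * f - g \<in> K}"
  have KB: "f \<in> B" if "f \<in> K" for f
    unfolding B_def using that indets_const[of 0] K.mult_I[of 1 f]
    by (intro CollectI exI[of _ 0]) (auto intro!: exI[of _ 0])
  have nonnegB: "f \<in> B" if "indets f \<subseteq> {0..}" for f
    unfolding B_def using that K.zero_I by (intro CollectI exI[of _ 0] exI[of _ f]) auto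
  have addB: "f + g \<in> B" if "f \<in> B" "g \<in> B" for f g
  proof -
    from that obtain M f' N g' where f: "indets f' \<subseteq> {0..}" "s ^ M * f - f' \<in> K"
      and g: "indets g' \<subseteq> {0..}" "s ^ N * g - g' \<in> K" by (auto simp: B_def)
    have "s ^ N * (s ^ M * f - f') + s ^ M * (s ^ N * g - g') \<in> K"
      by (intro K.add_I K.mult_I f g) auto
    hence "s ^ (M + N) * (f + g) - (s ^ N * f' + s ^ M * g') \<in> K"
      by (simp add: algebra_simps power_add)
    moreover have "indets (s ^ N * f' + s ^ M * g') \<subseteq> {0..}" by (intro cl spow f g)
    ultimately show ?thesis unfolding B_def by blast
  qed
  have multB: "f * g \<in> B" if "f \<in> B" "g \<in> B" for f g
  proof -
    from that obtain M f' N g' where f: "indets f' \<subseteq> {0..}" "s ^ M * f - f' \<in> K"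
      and g: "indets g' \<subseteq> {0..}" "s ^ N * g - g' \<in> K" by (auto simp: B_def)
    have "(s ^ N * g) * (s ^ M * f - f') + f' * (s ^ N * g - g') \<in> K"
      by (intro K.add_I K.mult_I f g) auto
    hence "s ^ (M + N) * (f * g) - f' * g' \<in> K"
      by (simp add: algebra_simps power_add)
    moreover have "indets (f' * g') \<subseteq> {0..}" by (intro cl f g)
    ultimately show ?thesis unfolding B_def by blast
  qed
  have sumB: "sum h T \<in> B" if "\<And>x. x \<in> T \<Longrightarrow> h x \<in> B" for h and T :: "nat set"
    using that by (induction T rule: infinite_finite_induct) (auto intro: addB KB K.zero_I)
  have cancelB: "f \<in> B" if "s * f \<in> B" for f
  proof -
    from that obtain M g where "indets g \<subseteq> {0..}" "s ^ M * (s * f) - g \<in> K" by (auto simp: B_def)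
    thus ?thesis unfolding B_def by (intro CollectI exI[of _ "Suc M"] exI[of _ g]) (simp add: mult_ac)
  qed
  have negB: "- f \<in> B" if "f \<in> B" for f
    using multB[OF nonnegB[of "- 1"] that] cl(4)[OF cl(1)] by simp
  have step: "\<forall>n. - int m \<le> n \<longrightarrow> wvar n \<in> B" for m
  proof (induction m)
    case 0
    thus ?case using indets_wvar nonnegB by fastforce
  next
    case (Suc m)
    have "wvar n \<in> B" if n: "- int (Suc m) \<le> n" for n
    proof (cases "- int m \<le> n")
      case True
      thus ?thesis using Suc by blast
    next
      case False
      hence neq: "n = - int (Suc m)" using n by simp
      define N where "N = max (degree w) a"
      let ?R = "\<Sum>k\<in>{..N} - {a}. coeff w k * wvar (n - int a + int k)"
      have "chi wvar (n - int a) w = s * wvar n + ?R"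
        by (subst chi_bound[of w N]) (simp_all add: N_def s_def sum.remove[of "{.._}" a])
      hence "s * wvar n + ?R \<in> B"
        using KB[OF rel[of n]] neq by simp
      moreover have "?R \<in> B"
      proof (rule sumB)
        fix k assume k: "k \<in> {..N} - {a}"
        show "coeff w k * wvar (n - int a + int k) \<in> B"
        proof (cases "k < a")
          case True
          thus ?thesis using coeffs(2) by (intro KB K.mult_I2) auto
        next
          case False
          with k have "- int m \<le> n - int a + int k" using neq by auto
          hence "wvar (n - int a + int k) \<in> B" using Suc by blast
          thus ?thesis by (rule multB[OF nonnegB[OF coeffs(1)]])
        qed
      qed
      ultimately have "s * wvar n + ?R + - ?R \<in> B" by (rule addB[OF _ negB])
      hence "s * wvar n \<in> B" by simp
      thus ?thesis by (rule cancelB)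
    qed
    thus ?case by (intro allI impI)
  qed
  have wB: "wvar n \<in> B" for n
    using step[of "nat (- n)"] by auto
  have embedB: "sym_embed u \<in> B" for u
  proof (induction u rule: poly_mapping_single_induct)
    case zero
    thus ?case using KB K.zero_I by simp
  next
    case (single x c)
    have "sym_const c * wvar x \<in> B" by (rule multB[OF nonnegB wB]) simp
    thus ?case by (simp add: wvar_def flip: sym_embed_scal)
  next
    case (add p q)
    thus ?case by (simp add: sym_embed_add addB)
  qed
  have "f \<in> sym_span UNIV" by (simp add: sym_span_UNIV)
  hence "f \<in> B"
    by induction (simp_all add: addB multB embedB nonnegB)
  thus ?thesis by (simp add: B_def s_def)
qed

text \<open>
  The recurrence modulo \<open>J\<close> has coefficients in the large ring; elimination replaces it by one whose
  coefficients only involve non-negative variables, but which is only known for indices \<open>n \<ge> 0\<close>.  If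
  \<open>J\<close> contained no nonzero element of the small ring, it would be an identity between polynomials.
\<close>

lemma contraction_nonzero:
  fixes J :: "(int, 'k::field_char_0) sym set"
  assumes J: "witt_prime UNIV J" and nz: "J \<noteq> {0}"
  shows "\<exists>f\<in>J. f \<noteq> 0 \<and> indets f \<subseteq> {0..}"
proof (rule ccontr)
  interpret J: witt_prime UNIV J by fact
  assume neg: "\<not> ?thesis"
  from nz J.zero_I obtain f0 where "f0 \<in> J" "f0 \<noteq> 0" by blast
  then obtain f i0 where f: "f \<in> J" "partial i0 f \<notin> J" using J.exists_partial_notin by blast
  define c where "c = Min (indets f)"
  have c: "partial i f = 0" if "i < c" for i
    using that by (intro partial_eq_0) (auto simp: c_def dest: Min_le[rotated])
  obtain m e where m: "\<forall>i<c. partial i (witt_pb (wvar m) f) = 0"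
      "coeff (wronskian (grad c f) (grad c (witt_pb (wvar m) f))) e \<notin> J" (is "coeff ?w e \<notin> J")
    using J.wronskian_notin[OF f, of c] c by auto
  have rel: "chi wvar n ?w \<in> J" for n
    using J.chi_wronskian_in[OF f(1) J.bracket_J[OF _ f(1)], of m c "n - c + 1"] c m by simp
  have "e \<le> degree ?w" using m J.zero_I by (metis coeff_eq_0 leI)
  have "\<exists>u i0. (\<forall>i\<in>{..degree ?w}. u i \<in> {p. indets p \<subseteq> {0..}}) \<and> i0 \<in> {..degree ?w} \<and> u i0 \<notin> J \<and>
      (\<forall>n\<in>{0..}. (\<Sum>i\<in>{..degree ?w}. u i * wvar (n + int i)) \<in> J)"
  proof (rule J.relation_over_subring[where w = "coeff ?w" and ?i0.0 = e])
    show "(\<Sum>i\<le>degree ?w. coeff ?w i * wvar (n + int i)) \<in> J" for n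
      using rel[of n] unfolding chi_def .
    show "wvar (n + int i) \<in> {p. indets p \<subseteq> {0..}}" if "n \<in> {0..}" for n i
      using that indets_wvar[of "n + int i"] by auto
    show "a - b \<in> {p. indets p \<subseteq> {0..}}" if "a \<in> {p. indets p \<subseteq> {0..}}" "b \<in> {p. indets p \<subseteq> {0..}}"
      for a b :: "(int, 'k) sym"
      using that nonneg_closed(2)[of a "- b"] nonneg_closed(4)[of b] by simp
  qed (use m \<open>e \<le> _\<close> in \<open>simp_all add: nonneg_closed\<close>)
  then obtain u i1 where u: "\<forall>i\<in>{..degree ?w}. u i \<in> {p. indets p \<subseteq> {0..}}" "i1 \<in> {..degree ?w}" "u i1 \<notin> J"
    and urel: "\<forall>n\<in>{0..}. (\<Sum>i\<in>{..degree ?w}. u i * wvar (n + int i)) \<in> J" by (elim exE conjE)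
  \<comment> \<open>For this \<open>n\<close> all \<open>x\<^bsub>n+i\<^esub>\<close> are fresh for the coefficients, so \<open>\<partial>/\<partial>x\<^bsub>n+i\<^esub>\<close> isolates a coefficient.\<close>
  define n where "n = Max (insert 0 (\<Union>i\<le>degree ?w. indets (u i))) + 1"
  have n: "j < n" if "j \<in> indets (u i)" "i \<le> degree ?w" for i j
  proof -
    have "j \<le> Max (insert 0 (\<Union>i\<le>degree ?w. indets (u i)))" using that by (intro Max_ge) auto
    thus ?thesis by (simp add: n_def)
  qed
  have "0 \<le> Max (insert 0 (\<Union>i\<le>degree ?w. indets (u i)))" by (intro Max_ge) auto
  hence n0: "n \<ge> 0" by (simp add: n_def)
  have "indets (\<Sum>i\<in>T. u i * wvar (n + int i)) \<subseteq> {0..}" if "T \<subseteq> {..degree ?w}" for T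
  proof -
    have "finite T" using that finite_subset by blast
    thus ?thesis using that
    proof induction
      case empty
      thus ?case by simp
    next
      case (insert i T)
      have "indets (u i) \<subseteq> {0..}" using u(1) insert.prems by blast
      moreover have "indets (wvar (n + int i) :: (int, 'k) sym) \<subseteq> {0..}"
        using n0 indets_wvar[of "n + int i"] by auto
      ultimately show ?case using insert by (simp add: nonneg_closed)
    qed
  qed
  hence "(\<Sum>i\<le>degree ?w. u i * wvar (n + int i)) = 0"
    using neg urel n0 by blast
  hence "partial (n + int i1) (\<Sum>i\<le>degree ?w. u i * wvar (n + int i)) = 0"
    by (simp add: derivation_0[OF derivation_partial])
  moreover have "partial (n + int i1) (\<Sum>i\<le>degree ?w. u i * wvar (n + int i)) =
      (\<Sum>i\<le>degree ?w. u i * (if i = i1 then 1 else 0))"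
    unfolding additive_map_sum[OF derivation_additive[OF derivation_partial]]
  proof (intro sum.cong refl)
    fix i assume "i \<in> {..degree ?w}"
    hence "partial (n + int i1) (u i) = 0" using n[of "n + int i1" i] by (intro partial_eq_0) auto
    thus "partial (n + int i1) (u i * wvar (n + int i)) = u i * (if i = i1 then 1 else 0)"
      by (simp add: derivation_mult[OF derivation_partial] partial_wvar)
  qed
  ultimately have "u i1 = 0" using u(2) by (simp add: if_distrib[of "\<lambda>x. _ * x"] cong: if_cong)
  thus False using u(3) J.zero_I by simp
qed

text \<open>
  The Wronskian of an element of the common contraction gives one recurrence that holds modulo both
  ideals, so every \<open>h\<close> has the same reduction to the small ring modulo both.
\<close>

lemma contraction_subset:
  fixes J1 J2 :: "(int, 'k::field_char_0) sym set"
  assumes J1: "witt_prime UNIV J1" and J2: "witt_prime UNIV J2"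
    and eq: "J1 \<inter> {p. indets p \<subseteq> {0..}} = J2 \<inter> {p. indets p \<subseteq> {0..}}"
  shows "J1 \<subseteq> J2"
proof (cases "J1 = {0}")
  case True
  interpret J2: witt_prime UNIV J2 by fact
  show ?thesis using True J2.zero_I by simp
next
  case False
  interpret J1: witt_prime UNIV J1 by fact
  interpret J2: witt_prime UNIV J2 by fact
  define Q where "Q = J1 \<inter> {p. indets p \<subseteq> {0..}}"
  interpret Q: witt_prime "{0..}" Q
    unfolding Q_def by (rule witt_prime_contract[OF J1])
  from contraction_nonzero[OF J1 False] obtain f0 where "f0 \<in> Q" "f0 \<noteq> 0" by (auto simp: Q_def)
  then obtain f i0 where f: "f \<in> Q" "partial i0 f \<notin> Q" using Q.exists_partial_notin by blast
  have zero: "partial i g = 0" if "g \<in> Q" "i < 0" for g i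
    using that Q.I_subset by (intro Q.partial_outside) auto
  obtain m e where m: "m \<ge> 0" "coeff (wronskian (grad 0 f) (grad 0 (witt_pb (wvar m) f))) e \<notin> Q" (is "coeff ?w e \<notin> Q")
    using Q.wronskian_notin[OF f, of 0] zero[OF f(1)] by auto
  have g: "witt_pb (wvar m) f \<in> Q" using Q.bracket_J f m by simp
  have Q12: "q \<in> J1" "q \<in> J2" if "q \<in> Q" for q using that eq by (auto simp: Q_def)
  have rel: "chi wvar n ?w \<in> J1 \<inter> J2" for n
    using J1.chi_wronskian_in[OF Q12(1)[OF f(1)] Q12(1)[OF g], of 0 "n + 1"]
      J2.chi_wronskian_in[OF Q12(2)[OF f(1)] Q12(2)[OF g], of 0 "n + 1"] zero[OF f(1)] zero[OF g] by simp
  have coeffs: "indets (coeff ?w k) \<subseteq> {0..}" for k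
    using Q.coeff_wronskian_A[of f "witt_pb (wvar m) f"] f g Q.I_subset by auto
  define a where "a = (LEAST k. coeff ?w k \<notin> Q)"
  have a: "coeff ?w a \<notin> Q" unfolding a_def using m(2) by (rule LeastI)
  have below: "coeff ?w k \<in> Q" if "k < a" for k
    using not_less_Least[of k "\<lambda>k. coeff ?w k \<notin> Q"] that by (auto simp: a_def)
  have K: "ideal_in UNIV (J1 \<inter> J2)"
    by unfold_locales (auto intro: J1.zero_I J2.zero_I J1.add_I J2.add_I J1.mult_I J2.mult_I)
  show ?thesis
  proof
    fix h assume h: "h \<in> J1"
    obtain M g where g: "indets g \<subseteq> {0..}" "coeff ?w a ^ M * h - g \<in> J1 \<inter> J2"
      using reduce_to_nonneg[OF K coeffs, of a h] below Q12 rel by blast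
    have "coeff ?w a ^ M * h - (coeff ?w a ^ M * h - g) \<in> J1"
      by (rule J1.diff_I, rule J1.mult_I) (use g h in auto)
    hence "g \<in> J1" by simp
    hence "g \<in> J2" using g eq by blast
    hence "coeff ?w a ^ M * h - g + g \<in> J2" using g by (intro J2.add_I) auto
    moreover have "coeff ?w a \<notin> J2" using a coeffs[of a] eq by (auto simp: Q_def)
    ultimately show "h \<in> J2" using J2.cancel_power[of _ M h] by simp
  qed
qed


section \<open>Contraction is surjective\<close>

lemma (in ideal_in) top_coeff_notin:
  assumes "coeff p k0 \<notin> I"
  obtains e where "coeff p e \<notin> I" "\<And>k. k > e \<Longrightarrow> coeff p k \<in> I"
proof -
  let ?T = "{k. coeff p k \<notin> I}"
  have fin: "finite ?T"
  proof (rule finite_subset)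
    show "?T \<subseteq> {..degree p}" using zero_I coeff_eq_0[of p] by (force simp: not_le[symmetric])
  qed simp
  show ?thesis
  proof (rule that)
    show "coeff p (Max ?T) \<notin> I" using Max_in[OF fin] assms by blast
    show "coeff p k \<in> I" if "k > Max ?T" for k using Max_ge[OF fin, of k] that by fastforce
  qed
qed

text \<open>
  Take a recurrence \<open>w\<close> of minimal order \<open>E\<close> modulo \<open>Q\<close>.  Bracketing it with \<open>x\<^sub>0\<close> shows that \<open>u = {x\<^sub>0, w} + w'\<close>
  also annihilates the sequence, so by minimality \<open>u\<close> is proportional to \<open>w\<close> modulo \<open>Q\<close>.  Comparing
  coefficients of \<open>t\<^sup>k\<close>, if \<open>w\<^sub>k\<close> vanishes modulo \<open>Q\<close> then so does \<open>w\<^bsub>k+1\<^esub>\<close>.  Hence \<open>w\<^sub>0\<close>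
  does not vanish, as otherwise all of \<open>w\<close> would.
\<close>

lemma invertible_recurrence:
  fixes Q :: "(int, 'k::field_char_0) sym set"
  assumes "witt_prime {0..} Q" "Q \<noteq> {0}"
  shows "\<exists>w. (\<forall>k. indets (coeff w k) \<subseteq> {0..}) \<and> coeff w 0 \<notin> Q \<and> (\<forall>n\<ge>0. chi wvar n w \<in> Q)"
proof -
  interpret Q: witt_prime "{0..}" Q by fact
  from assms(2) Q.zero_I obtain f0 where "f0 \<in> Q" "f0 \<noteq> 0" by blast
  then obtain f i0 where f: "f \<in> Q" "partial i0 f \<notin> Q" using Q.exists_partial_notin by blast
  have zero: "partial i g = 0" if "g \<in> Q" "i < 0" for g i
    using that Q.I_subset by (intro Q.partial_outside) auto
  obtain m e0 where m: "m \<ge> 0" "coeff (wronskian (grad 0 f) (grad 0 (witt_pb (wvar m) f))) e0 \<notin> Q" (is "coeff ?w0 e0 \<notin> Q")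
    using Q.wronskian_notin[OF f, of 0] zero[OF f(1)] by auto
  have g: "witt_pb (wvar m) f \<in> Q" using Q.bracket_J f m by simp
  define good where "good = (\<lambda>w e. (\<forall>k. coeff w k \<in> Q.A) \<and> (\<forall>n\<ge>0. chi wvar n w \<in> Q)
    \<and> coeff w e \<notin> Q \<and> (\<forall>k>e. coeff w k \<in> Q))"
  have rel0: "chi wvar n ?w0 \<in> Q" if "n \<ge> 0" for n
    using Q.chi_wronskian_in[OF f(1) g, of 0 "n + 1"] zero[OF f(1)] zero[OF g] that by simp
  have coeffs0: "coeff ?w0 k \<in> Q.A" for k
    using Q.I_subset f(1) g by (intro Q.coeff_wronskian_A) auto
  obtain e1 where "good ?w0 e1"
    using Q.top_coeff_notin[OF m(2)] rel0 coeffs0 unfolding good_def by metis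
  hence ex: "\<exists>e w. good w e" by blast
  define E where "E = (LEAST e. \<exists>w. good w e)"
  have "\<exists>w. good w E" unfolding E_def using ex by (rule LeastI_ex)
  then obtain w where w: "\<And>k. coeff w k \<in> Q.A" "\<And>n. n \<ge> 0 \<Longrightarrow> chi wvar n w \<in> Q"
      "coeff w E \<notin> Q" "\<And>k. k > E \<Longrightarrow> coeff w k \<in> Q" unfolding good_def by blast
  have minimal: "\<not> good p e" if "e < E" for p e
    using not_less_Least[of e "\<lambda>e. \<exists>w. good w e"] that by (auto simp: E_def)
  let ?\<delta> = "witt_pb (wvar 0)"
  define u where "u = map_poly ?\<delta> w + pderiv w"
  have u: "coeff u k = ?\<delta> (coeff w k) + of_nat (Suc k) * coeff w (Suc k)" for k
    by (simp add: u_def coeff_map_poly coeff_pderiv derivation_0[OF derivation_ad])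
  have uA: "coeff u k \<in> Q.A" for k
    unfolding u using w(1)[of k] by (intro Q.add_A Q.mult_A Q.of_nat_A w(1)) (simp add: nonneg_closed)
  have urel: "chi wvar n u \<in> Q" if "n \<ge> 0" for n
  proof -
    have "chi wvar n u = ?\<delta> (chi wvar n w) - of_int n * chi wvar (n - 1) w"
      by (simp add: chi_wvar_bracket u_def chi_add euler_def chi_pCons)
    also have "\<dots> \<in> Q"
    proof (cases "n = 0")
      case True
      thus ?thesis using w(2)[of 0] by (simp add: Q.bracket_J)
    next
      case False
      thus ?thesis using w(2) that by (intro Q.diff_I Q.mult_I Q.bracket_J Q.of_int_A) auto
    qed
    finally show ?thesis .
  qed
  \<comment> \<open>Cross-multiplication cancels the top term, so \<open>p\<close> has order below \<open>E\<close> modulo \<open>Q\<close>.\<close>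
  define p where "p = smult (coeff w E) u - smult (coeff u E) w"
  have p: "coeff p k = coeff w E * coeff u k - coeff u E * coeff w k" for k
    by (simp add: p_def)
  have pQ: "coeff p k \<in> Q" for k
  proof (rule ccontr)
    assume "coeff p k \<notin> Q"
    then obtain e where e: "coeff p e \<notin> Q" "\<And>k. k > e \<Longrightarrow> coeff p k \<in> Q"
      using Q.top_coeff_notin by blast
    have "coeff p k \<in> Q" if "k \<ge> E" for k
    proof (cases "k = E")
      case True
      thus ?thesis by (simp add: p Q.zero_I)
    next
      case False
      with that have k: "k > E" "Suc k > E" by auto
      have "coeff u k \<in> Q" unfolding u using k
        by (intro Q.add_I Q.mult_I Q.bracket_J w(4) Q.of_nat_A) auto
      thus ?thesis unfolding p using w(1,4) uA k by (intro Q.diff_I Q.mult_I) auto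
    qed
    hence "e < E" using e(1) not_le by blast
    moreover have "good p e"
    proof -
      have "chi wvar n p = coeff w E * chi wvar n u - coeff u E * chi wvar n w" for n
        by (simp add: p_def chi_diff chi_smult)
      moreover have "coeff w E * chi wvar n u - coeff u E * chi wvar n w \<in> Q" if "n \<ge> 0" for n
        by (intro Q.diff_I Q.mult_I urel w uA that)
      moreover have "coeff p k \<in> Q.A" for k
        unfolding p by (intro Q.diff_A Q.mult_A w uA)
      ultimately show ?thesis using e by (simp add: good_def)
    qed
    ultimately show False using minimal by blast
  qed
  have "coeff w 0 \<notin> Q"
  proof
    assume w0: "coeff w 0 \<in> Q"
    have "coeff w k \<in> Q" for k
    proof (induction k)
      case (Suc k)
      have "coeff u E * coeff w k \<in> Q" by (intro Q.mult_I uA Suc)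
      with pQ[of k] have "coeff w E * coeff u k \<in> Q" unfolding p using Q.add_I by fastforce
      hence "coeff u k \<in> Q" using Q.cancel_I w(1,3) uA by blast
      moreover have "?\<delta> (coeff w k) \<in> Q" by (intro Q.bracket_J Suc) simp
      ultimately have "of_nat (Suc k) * coeff w (Suc k) \<in> Q" unfolding u by (rule Q.in_I_if_add_left)
      thus ?case using Q.of_int_cancel[of "int (Suc k)"] by simp
    qed (rule w0)
    with w(3) show False by blast
  qed
  thus ?thesis using w by blast
qed

lemma backward_extension:
  fixes c :: "nat \<Rightarrow> 'f::field"
  assumes "c 0 \<noteq> 0"
  shows "\<exists>v. (\<forall>n\<ge>0. v n = b n) \<and> (\<forall>n<0. (\<Sum>k\<le>D. c k * v (n + int k)) = 0)"
proof -
  \<comment> \<open>\<open>V m\<close> is correct at all indices from \<open>- m\<close> on; each step fixes one more value.\<close>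
  define V where "V = rec_nat b (\<lambda>m v. v(- int (Suc m) := - (\<Sum>k=1..D. c k * v (int k - int (Suc m))) / c 0))"
  have V_0: "V 0 = b"
    and V_Suc: "V (Suc m) = (V m)(- int (Suc m) := - (\<Sum>k=1..D. c k * V m (int k - int (Suc m))) / c 0)" for m
    by (simp_all add: V_def)
  define v where "v = (\<lambda>n. V (nat (- n)) n)"
  have stable: "V (M + d) n = V M n" if "- int M \<le> n" for M d n
    by (induction d) (use that in \<open>simp_all add: V_Suc\<close>)
  have v: "V M n = v n" if "- int M \<le> n" for M n
    using stable[of "nat (- n)" n "M - nat (- n)"] that by (simp add: v_def)
  have "(\<Sum>k\<le>D. c k * v (n + int k)) = 0" if "n < 0" for n
  proof -
    define m where "m = nat (- n) - 1"
    have n: "n = - int (Suc m)" using that by (simp add: m_def)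
    have "v n = - (\<Sum>k=1..D. c k * V m (int k - int (Suc m))) / c 0"
      using v[of "Suc m" n] V_Suc[of m] n by simp
    also have "(\<Sum>k=1..D. c k * V m (int k - int (Suc m))) = (\<Sum>k=1..D. c k * v (n + int k))"
      by (intro sum.cong refl) (simp add: v n algebra_simps)
    finally have "c 0 * v n = - (\<Sum>k=1..D. c k * v (n + int k))" using assms by simp
    moreover have "(\<Sum>k\<le>D. c k * v (n + int k)) = c 0 * v n + (\<Sum>k=1..D. c k * v (n + int k))"
      by (simp add: atMost_atLeast0 sum.atLeast_Suc_atMost)
    ultimately show ?thesis by simp
  qed
  moreover have "v n = b n" if "n \<ge> 0" for n using v[of 0 n] that by (simp add: V_0)
  ultimately show ?thesis by blast
qed

lemma to_fract_sum: "to_fract (sum f T) = (\<Sum>x\<in>T. to_fract (f x))"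
  by (induction T rule: infinite_finite_induct) simp_all

lemma sym_embed_wvar:
  "sym_embed u = (\<Sum>x\<in>Poly_Mapping.keys u. sym_const (Poly_Mapping.lookup u x) * wvar x)"
  by (simp add: sym_embed_def wvar_def sym_embed_single)

text \<open>
  The homomorphism \<open>S \<rightarrow> A[1/s]\<close>, with the fraction field of \<open>S\<close> as a convenient codomain, that is the
  identity on \<open>A\<close> and sends the variables of negative index to the backward solution of the recurrence.
\<close>

lemma fraction_hom:
  fixes w :: "(int, 'k::field_char_0) sym poly"
  assumes w: "coeff w 0 \<noteq> 0" "\<And>k. indets (coeff w k) \<subseteq> {0..}"
  shows "\<exists>F :: (int, 'k) sym \<Rightarrow> (int, 'k) sym fract.
    (\<forall>p q. F (p + q) = F p + F q) \<and> (\<forall>p q. F (p * q) = F p * F q) \<and>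
    (\<forall>p. indets p \<subseteq> {0..} \<longrightarrow> F p = to_fract p) \<and> (\<forall>n<0. F (chi wvar n w) = 0)"
proof -
  obtain v :: "int \<Rightarrow> (int, 'k) sym fract" where v: "\<And>n. n \<ge> 0 \<Longrightarrow> v n = to_fract (wvar n)"
      "\<And>n. n < 0 \<Longrightarrow> (\<Sum>k\<le>degree w. to_fract (coeff w k) * v (n + int k)) = 0"
    using backward_extension[of "\<lambda>k. to_fract (coeff w k)" "\<lambda>n. to_fract (wvar n)" "degree w"] w(1)
    by auto
  define h where "h = (\<lambda>c. to_fract (sym_const c :: (int, 'k) sym))"
  define \<phi> where "\<phi> = additive_ext (\<lambda>x c. h c * v x)"
  have h: "h (a + b) = h a + h b" "h (a * b) = h a * h b" "h 1 = 1" "h 0 = 0" for a b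
    by (simp_all add: h_def sym_const_add sym_const_mult)
  have \<phi>_add: "\<phi> (x + y) = \<phi> x + \<phi> y" for x y
    unfolding \<phi>_def by (rule additive_mapD[OF additive_ext_additive]) (simp_all add: h algebra_simps)
  have \<phi>_single: "\<phi> (Poly_Mapping.single x c) = h c * v x" for x c
    unfolding \<phi>_def by (rule additive_ext_single) (simp add: h)
  have \<phi>_scal: "\<phi> (scal c x) = h c * \<phi> x" for c x
  proof (rule additive_map_eqI[where f = "\<lambda>x. \<phi> (scal c x)" and g = "\<lambda>x. h c * \<phi> x"])
    show "additive_map (\<lambda>x. \<phi> (scal c x))" "additive_map (\<lambda>x. h c * \<phi> x)"
      by (simp_all add: additive_map_def scal_add \<phi>_add algebra_simps)
  qed (simp add: \<phi>_single h)
  have "\<exists>F. algebra_hom_on h (sym_span UNIV) F \<and> (\<forall>u\<in>UNIV. F (sym_embed u) = \<phi> u)"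
    by (rule sym_universal_exists[where X = UNIV]) (simp_all add: h \<phi>_add \<phi>_scal)
  then obtain F where F: "algebra_hom_on h UNIV F" "\<And>u. F (sym_embed u) = \<phi> u"
    by (auto simp: sym_span_UNIV)
  have Fadd: "F (p + q) = F p + F q" and Fmult: "F (p * q) = F p * F q" and Fconst: "F (sym_const c) = h c" for p q c
    using F(1) by (simp_all add: algebra_hom_on_def)
  have Fwvar: "F (wvar n) = v n" for n
    by (simp add: wvar_def F(2) \<phi>_single h)
  have Fsum: "F (sum f T) = (\<Sum>x\<in>T. F (f x))" for f and T :: "'b set"
    by (rule additive_map_sum) (simp add: additive_map_def Fadd)
  have Fnonneg: "F p = to_fract p" if "indets p \<subseteq> {0..}" for p
  proof (rule sym_universal_unique[where U = W_ge and h = h])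
    show "algebra_hom_on h (sym_span W_ge) F" "algebra_hom_on h (sym_span W_ge) to_fract"
      using F(1) by (simp_all add: algebra_hom_on_def h_def)
    show "p \<in> sym_span W_ge" using that by (simp add: W_ge_carrier)
    show "F (sym_embed u) = to_fract (sym_embed u)" if "u \<in> W_ge" for u
      unfolding sym_embed_wvar Fsum to_fract_sum
      by (intro sum.cong refl) (use that in \<open>auto simp: Fmult Fconst Fwvar h_def v(1) W_ge_def\<close>)
  qed
  have "F (chi wvar n w) = 0" if "n < 0" for n
    unfolding chi_def Fsum using v(2)[OF that] by (simp add: Fmult Fwvar Fnonneg[OF w(2)])
  thus ?thesis using Fadd Fmult Fnonneg by blast
qed

text \<open>
  As a sequence in \<open>j\<close>, \<open>{x\<^sub>j, g}\<close> is the sum of a combination of shifts of \<open>x\<close> and \<open>j\<close> times another.  The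
  recurrence \<open>w\<close> kills the former, and \<open>w\<^sup>2\<close> kills both.  So the brackets with \<open>j \<ge> 0\<close> control all others.
\<close>

lemma bracket_all_if_nonneg:
  fixes J :: "(int, 'k::field_char_0) sym set"
  assumes J: "prime_in UNIV J" and rel: "\<And>n. chi wvar n w \<in> J" and a: "coeff w a \<notin> J"
    and nonneg: "\<And>j. j \<ge> 0 \<Longrightarrow> witt_pb (wvar j) g \<in> J"
  shows "witt_pb (wvar j) g \<in> J"
proof -
  interpret J: prime_in UNIV J by fact
  define c where "c = Min (indets g)"
  have c: "partial i g = 0" if "i < c" for i
    using that by (intro partial_eq_0) (auto simp: c_def dest: Min_le[rotated])
  let ?P = "grad c g" and ?\<gamma> = "\<lambda>m. witt_pb (wvar m) g"
  \<comment> \<open>\<open>\<beta>\<close> is \<open>w\<close> acting on the sequence of brackets; applying \<open>w\<close> once more lands in \<open>J\<close>.\<close>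
  define \<beta> where "\<beta> = (\<lambda>n. chi ?\<gamma> n w)"
  have shift: "chi (\<lambda>m. chi wvar (m + c - 1) r) n q = chi wvar (n + c - 1) (q * r)" for n r and q :: "(int, 'k) sym poly"
    using chi_shift[of "\<lambda>m. chi wvar m r" "c - 1" n q] by (simp add: chi_mult algebra_simps)
  have kill: "chi wvar n (w * q) \<in> J" for n q
    by (rule J.chi_annihilated_mult) (simp_all add: rel)
  have \<beta>: "\<beta> n = chi wvar (n + c - 1) (w * euler ?P) + of_int (c - n) * chi wvar (n + c - 1) (w * ?P)
      - chi wvar (n + c - 1) (euler w * ?P)" for n
  proof -
    let ?u = "\<lambda>m. chi wvar (m + c - 1) (euler ?P)" and ?v = "\<lambda>m. chi wvar (m + c - 1) ?P"
    have "?\<gamma> = (\<lambda>m. (?u m + of_int c * ?v m) - of_int m * ?v m)"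
      by (simp add: fun_eq_iff witt_pb_wvar_chi[OF c] algebra_simps)
    thus ?thesis unfolding \<beta>_def
      by (simp only: chi_minus chi_plus chi_times chi_weighted shift) (simp add: algebra_simps)
  qed
  have \<beta>rel: "chi \<beta> n w \<in> J" for n
  proof -
    have "chi (\<lambda>m. \<beta> m + chi wvar (m + c - 1) (euler w * ?P)) n w \<in> J"
      by (rule J.chi_in_I) (auto simp: \<beta> intro!: J.add_I J.mult_I kill)
    hence "chi \<beta> n w + chi wvar (n + c - 1) (w * (euler w * ?P)) \<in> J"
      by (simp only: chi_plus shift)
    thus ?thesis using kill by (rule J.in_I_if_add_right)
  qed
  have "\<beta> n \<in> J" for n
  proof (rule J.annihilated_in[OF refl a \<beta>rel])
    show "\<beta> n \<in> J" if "n \<ge> 0" for n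
      unfolding \<beta>_def by (rule J.chi_in_I) (use that nonneg in auto)
  qed
  thus ?thesis unfolding \<beta>_def
    by (rule J.annihilated_in[OF refl a _ nonneg])
qed

text \<open>
  For nonzero \<open>Q\<close>, with \<open>F\<close> the homomorphism of \<open>fraction_hom\<close>, \<open>J\<close> is the preimage of the extension of \<open>Q\<close>
  to \<open>A[1/s]\<close>; it is prime and contracts to \<open>Q\<close> because \<open>s \<notin> Q\<close>.  To see that \<open>J\<close> is Poisson, let \<open>L\<close> be
  the set of \<open>f \<in> J\<close> whose brackets with all \<open>x\<^sub>j\<close>, \<open>j \<ge> 0\<close>, lie in \<open>J\<close>.  It is an ideal, it contains \<open>Q\<close> and
  the recurrence relations, and \<open>s f \<in> L\<close> implies \<open>f \<in> L\<close>; as \<open>J\<close> is generated by \<open>Q\<close> and these relations up to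
  powers of \<open>s\<close>, \<open>L = J\<close>.
\<close>

lemma prime_extension:
  fixes Q :: "(int, 'k::field_char_0) sym set"
  assumes Q: "witt_prime {0..} Q"
  shows "\<exists>J. witt_prime UNIV J \<and> J \<inter> {p. indets p \<subseteq> {0..}} = Q"
proof (cases "Q = {0}")
  case True
  have "witt_prime UNIV {0 :: (int, 'k) sym}"
    by unfold_locales (auto simp: derivation_0[OF derivation_ad])
  moreover have "{0} \<inter> {p. indets p \<subseteq> {0..}} = Q" using True by auto
  ultimately show ?thesis by blast
next
  case False
  interpret Q: witt_prime "{0..}" Q by fact
  obtain w where w: "\<And>k. indets (coeff w k) \<subseteq> {0..}" "coeff w 0 \<notin> Q" "\<And>n. n \<ge> 0 \<Longrightarrow> chi wvar n w \<in> Q"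
    using invertible_recurrence[OF Q False] by blast
  define s where "s = coeff w 0"
  have sA: "s \<in> Q.A" using w(1) by (simp add: s_def)
  have sQ: "s \<notin> Q" using w(2) by (simp add: s_def)
  have "coeff w 0 \<noteq> 0" using w(2) Q.zero_I by force
  from fraction_hom[OF this w(1)] obtain F :: "(int, 'k) sym \<Rightarrow> (int, 'k) sym fract"
    where Fadd: "\<And>p q. F (p + q) = F p + F q" and Fmult: "\<And>p q. F (p * q) = F p * F q"
      and Fid: "\<And>p. p \<in> Q.A \<Longrightarrow> F p = to_fract p" and Frel: "\<And>n. n < 0 \<Longrightarrow> F (chi wvar n w) = 0"
    by auto
  have F0: "F 0 = 0" by (subst Fid) simp_all
  have Fdiff: "F (p - q) = F p - F q" for p q using Fadd[of "p - q" q] by simp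
  have Finj: "p = q" if "F p = F q" "p \<in> Q.A" "q \<in> Q.A" for p q
    using that by (simp add: Fid)
  have powA: "s ^ M \<in> Q.A" for M by (rule Q.power_A[OF sA])
  have kerF: "ideal_in UNIV {f. F f = 0}"
    by unfold_locales (auto simp: F0 Fadd Fmult)
  have reduce: "\<exists>M g. g \<in> Q.A \<and> F (s ^ M * f) = F g" for f
  proof -
    have "\<exists>M g. indets g \<subseteq> {0..} \<and> coeff w 0 ^ M * f - g \<in> {f. F f = 0}"
      by (rule reduce_to_nonneg[OF kerF w(1)]) (simp_all add: Frel)
    thus ?thesis by (auto simp: s_def Fdiff)
  qed
  define J where "J = {f. \<exists>M g. g \<in> Q \<and> F (s ^ M * f) = F g}"
  have QA: "g \<in> Q.A" if "g \<in> Q" for g using that Q.I_subset by blast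
  have J_reduced: "g \<in> Q" if f: "f \<in> J" and g: "g \<in> Q.A" "F (s ^ M * f) = F g" for f g M
  proof -
    from f obtain N q where q: "q \<in> Q" "F (s ^ N * f) = F q" by (auto simp: J_def)
    have "F (s ^ N * g) = F (s ^ M * q)"
      using g(2) q(2) by (simp add: Fmult mult_ac flip: g(2) q(2))
    hence "s ^ N * g = s ^ M * q" using g(1) QA[OF q(1)] by (intro Finj Q.mult_A powA)
    hence "s ^ N * g \<in> Q" using Q.mult_I[OF powA q(1)] by simp
    thus ?thesis using Q.cancel_power sA sQ g(1) by blast
  qed
  have contract: "J \<inter> Q.A = Q"
  proof (intro equalityI subsetI IntI)
    fix f assume "f \<in> J \<inter> Q.A"
    thus "f \<in> Q" using J_reduced[of f f 0] by simp
  next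
    fix f assume "f \<in> Q"
    thus "f \<in> J" unfolding J_def by (intro CollectI exI[of _ 0] exI[of _ f]) simp
  qed (use QA in blast)
  have Jprime: "prime_in UNIV J"
  proof (unfold_locales)
    show "0 \<in> J" using contract Q.zero_I by blast
    show "a + b \<in> J" if "a \<in> J" "b \<in> J" for a b
    proof -
      from that obtain M f N g where f: "f \<in> Q" "F (s ^ M * a) = F f" and g: "g \<in> Q" "F (s ^ N * b) = F g"
        by (auto simp: J_def)
      have "F (s ^ (M + N) * (a + b)) = F (s ^ N * f + s ^ M * g)"
        using f(2) g(2) by (simp add: Fmult Fadd power_add algebra_simps flip: f(2) g(2))
      moreover have "s ^ N * f + s ^ M * g \<in> Q" by (intro Q.add_I Q.mult_I powA f g)
      ultimately show ?thesis unfolding J_def by blast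
    qed
    show "r * a \<in> J" if "a \<in> J" for r a
    proof -
      from that obtain M f where f: "f \<in> Q" "F (s ^ M * a) = F f" by (auto simp: J_def)
      obtain N g where g: "g \<in> Q.A" "F (s ^ N * r) = F g" using reduce by blast
      have "F (s ^ (M + N) * (r * a)) = F (g * f)"
        by (simp add: Fmult power_add mult_ac flip: f(2) g(2))
      moreover have "g * f \<in> Q" by (intro Q.mult_I g f)
      ultimately show ?thesis unfolding J_def by blast
    qed
    show "1 \<notin> J" using contract Q.one_A Q.one_notin by blast
    show "a \<in> J \<or> b \<in> J" if ab: "a * b \<in> J" for a b
    proof -
      obtain M f where f: "f \<in> Q.A" "F (s ^ M * a) = F f" using reduce by blast
      obtain N g where g: "g \<in> Q.A" "F (s ^ N * b) = F g" using reduce by blast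
      have "F (s ^ (M + N) * (a * b)) = F (f * g)"
        by (simp add: Fmult power_add mult_ac flip: f(2) g(2))
      hence "f * g \<in> Q" using J_reduced[OF ab] Q.mult_A f g by blast
      hence "f \<in> Q \<or> g \<in> Q" using Q.prime_I f g by blast
      thus ?thesis using f g unfolding J_def by blast
    qed
  qed auto
  interpret J: prime_in UNIV J by fact
  have QJ: "q \<in> J" if "q \<in> Q" for q using contract that by blast
  have sJ: "s \<notin> J" using contract sA sQ by blast
  have rel: "chi wvar n w \<in> J" for n
  proof (cases "n < 0")
    case True
    thus ?thesis unfolding J_def using Q.zero_I
      by (intro CollectI exI[of _ 0]) (auto simp: Frel F0 intro!: bexI[of _ 0])
  next
    case False
    thus ?thesis using w(3) QJ by simp
  qed
  have kill: "chi wvar n (w * q) \<in> J" for n q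
    by (rule J.chi_annihilated_mult) (simp_all add: rel)
  have rel_bracket: "witt_pb (wvar j) (chi wvar n w) \<in> J" if j: "j \<ge> 0" for j n
  proof -
    \<comment> \<open>The bracketed relations again satisfy the recurrence, and for \<open>n \<ge> 0\<close> they lie in \<open>Q\<close>.\<close>
    define \<rho> where "\<rho> = (\<lambda>n. witt_pb (wvar j) (chi wvar n w))"
    have shift: "chi (\<lambda>m. chi wvar (m + j - 1) r) n q = chi wvar (n + j - 1) (q * r)" for n r and q :: "(int, 'k) sym poly"
      using chi_shift[of "\<lambda>m. chi wvar m r" "j - 1" n q] by (simp add: chi_mult algebra_simps)
    have \<rho>rel: "chi \<rho> n w \<in> J" for n
    proof -
      have "chi (\<lambda>m. of_int (m - j) * chi wvar (m + j - 1) w) n w \<in> J"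
        by (rule J.chi_in_I) (auto intro: J.mult_I rel)
      moreover have "\<rho> = (\<lambda>m. (chi wvar m (map_poly (witt_pb (wvar j)) w) + chi wvar (m + j - 1) (euler w))
          + of_int (m - j) * chi wvar (m + j - 1) w)"
        unfolding \<rho>_def chi_wvar_bracket ..
      ultimately show ?thesis
        by (simp only: chi_plus shift chi_mult[symmetric]) (intro J.add_I kill)
    qed
    have start: "\<rho> n \<in> J" if "n \<ge> 0" for n
      unfolding \<rho>_def using j w(3)[OF that] by (intro QJ Q.bracket_J) auto
    have "\<rho> n \<in> J"
      by (rule J.annihilated_in[OF refl _ \<rho>rel start]) (use sJ in \<open>simp add: s_def\<close>)
    thus ?thesis by (simp add: \<rho>_def)
  qed
  define L where "L = {f \<in> J. \<forall>j\<ge>0. witt_pb (wvar j) f \<in> J}"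
  have L: "ideal_in UNIV L"
  proof unfold_locales
    show "0 \<in> L" by (simp add: L_def J.zero_I derivation_0[OF derivation_ad])
    show "a + b \<in> L" if "a \<in> L" "b \<in> L" for a b
      using that by (auto simp: L_def derivation_add[OF derivation_ad] intro: J.add_I)
    show "r * a \<in> L" if "a \<in> L" for r a
      using that by (auto simp: L_def derivation_mult[OF derivation_ad] intro!: J.add_I J.mult_I)
  qed auto
  interpret L: ideal_in UNIV L by fact
  have QL: "q \<in> L" if "q \<in> Q" for q
    unfolding L_def using that by (auto intro: QJ Q.bracket_J)
  have relL: "chi wvar n w \<in> L" for n
    by (simp add: L_def rel rel_bracket)
  have cancelL: "f \<in> L" if f: "s * f \<in> L" for f
  proof -
    have fJ: "f \<in> J" using f sJ J.cancel_I[of s f] by (simp add: L_def)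
    have "witt_pb (wvar j) f \<in> J" if "j \<ge> 0" for j
    proof -
      have "s * witt_pb (wvar j) f + witt_pb (wvar j) s * f \<in> J"
        using f that by (simp add: L_def derivation_mult[OF derivation_ad])
      moreover have "witt_pb (wvar j) s * f \<in> J" by (rule J.mult_I) (simp_all add: fJ)
      ultimately have "s * witt_pb (wvar j) f \<in> J" by (rule J.in_I_if_add_right)
      thus ?thesis using sJ J.cancel_I[of s] by blast
    qed
    thus ?thesis using fJ by (simp add: L_def)
  qed
  have JL: "f \<in> L" if f: "f \<in> J" for f
  proof -
    have "\<exists>M g. indets g \<subseteq> {0..} \<and> coeff w 0 ^ M * f - g \<in> L"
      by (rule reduce_to_nonneg[OF L w(1)]) (simp_all add: relL)
    then obtain M g where g: "g \<in> Q.A" "s ^ M * f - g \<in> L" by (auto simp: s_def)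
    have "s ^ M * f - (s ^ M * f - g) \<in> J"
      by (rule J.diff_I[OF J.mult_I[OF _ f]]) (use g in \<open>simp_all add: L_def\<close>)
    hence "g \<in> J" by simp
    hence "g \<in> Q" using g contract by blast
    hence "(s ^ M * f - g) + g \<in> L" by (rule L.add_I[OF g(2) QL])
    hence "s ^ M * f \<in> L" by simp
    thus ?thesis
    proof (induction M)
      case (Suc M)
      hence "s * (s ^ M * f) \<in> L" by (simp add: mult_ac)
      thus ?case by (rule Suc.IH[OF cancelL])
    qed simp
  qed
  have "witt_pb (wvar j) f \<in> J" if "f \<in> J" for f j
    by (rule bracket_all_if_nonneg[OF Jprime rel, of 0])
      (use JL[OF that] sJ in \<open>auto simp: L_def s_def\<close>)
  hence "witt_prime UNIV J"
    using Jprime by (simp add: witt_prime_def witt_prime_axioms_def)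
  thus ?thesis using contract by blast
qed


section \<open>Differential ideals\<close>

text \<open>
  A Poisson ideal is an ideal stable under the derivations \<open>{-, s}\<close>; the results on cores of prime ideals
  hold for any family of derivations.
\<close>

locale diff_ring =
  fixes A :: "'a::comm_ring_1 set" and Ds :: "('a \<Rightarrow> 'a) set"
  assumes Ds_derivation: "\<And>D. D \<in> Ds \<Longrightarrow> derivation D"
    and Ds_closed: "\<And>D a. D \<in> Ds \<Longrightarrow> a \<in> A \<Longrightarrow> D a \<in> A"
begin

definition diff_ideal :: "'a set \<Rightarrow> bool" where
  "diff_ideal I \<longleftrightarrow> ideal_in A I \<and> (\<forall>D\<in>Ds. \<forall>a\<in>I. D a \<in> I)"

lemmas D_add = derivation_add[OF Ds_derivation]
lemmas D_mult = derivation_mult[OF Ds_derivation]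
lemmas D_0 = derivation_0[OF Ds_derivation]

text \<open>
  The core consists of the elements all of whose iterated derivatives lie in \<open>M\<close>; collecting them by the
  number of derivations keeps every stage an ideal.
\<close>

lemma core_exists:
  assumes M: "ideal_in A M"
  obtains P where "diff_ideal P" "P \<subseteq> M" "\<And>I. diff_ideal I \<Longrightarrow> I \<subseteq> M \<Longrightarrow> I \<subseteq> P"
proof -
  define C where "C = rec_nat M (\<lambda>_ I. {f \<in> I. \<forall>D\<in>Ds. D f \<in> I})"
  have C_0: "C 0 = M" and C_Suc: "C (Suc n) = {f \<in> C n. \<forall>D\<in>Ds. D f \<in> C n}" for n
    by (simp_all add: C_def)
  have ideal: "ideal_in A (C n)" for n
  proof (induction n)
    case (Suc n)
    interpret I: ideal_in A "C n" by (rule Suc)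
    show ?case
    proof unfold_locales
      show "s * a \<in> C (Suc n)" if "s \<in> A" "a \<in> C (Suc n)" for s a
        using that by (simp add: C_Suc D_mult I.add_I I.mult_I I.mult_I2 Ds_closed)
      show "C (Suc n) \<subseteq> A" using I.I_subset by (auto simp: C_Suc)
    qed (simp_all add: C_Suc D_0 D_add I.one_A I.add_A I.mult_A I.uminus_A I.zero_I I.add_I)
  qed (simp add: C_0 M)
  interpret M: ideal_in A M by fact
  define P where "P = (\<Inter>n. C n)"
  have "ideal_in A P"
  proof unfold_locales
    show "s * a \<in> P" if "s \<in> A" "a \<in> P" for s a
      using that ideal_in.mult_I[OF ideal] by (auto simp: P_def)
    show "a + b \<in> P" if "a \<in> P" "b \<in> P" for a b
      using that ideal_in.add_I[OF ideal] by (auto simp: P_def)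
    show "0 \<in> P" using ideal_in.zero_I[OF ideal] by (auto simp: P_def)
    show "P \<subseteq> A" using M.I_subset C_0 by (auto simp: P_def)
  qed (auto simp: M.one_A M.add_A M.mult_A M.uminus_A)
  moreover have "D a \<in> P" if "D \<in> Ds" "a \<in> P" for D a
  proof -
    have "a \<in> C (Suc n)" for n using that by (auto simp: P_def)
    thus ?thesis using that(1) by (auto simp: P_def C_Suc)
  qed
  ultimately have "diff_ideal P" by (simp add: diff_ideal_def)
  moreover have "P \<subseteq> M" using C_0 by (auto simp: P_def)
  moreover have "I \<subseteq> P" if "diff_ideal I" "I \<subseteq> M" for I
  proof -
    have "I \<subseteq> C n" for n
    proof (induction n)
      case (Suc n)
      thus ?case using that(1) unfolding diff_ideal_def C_Suc by blast
    qed (simp add: C_0 that)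
    thus ?thesis by (auto simp: P_def)
  qed
  ultimately show ?thesis by (rule that)
qed

lemma D_power: "D \<in> Ds \<Longrightarrow> x * D (x ^ n) = of_nat n * (x ^ n * D x)"
proof (induction n)
  case 0
  thus ?case using D_mult[of D 1 1] by simp
next
  case (Suc n)
  have "x * D (x ^ Suc n) = x * (x * D (x ^ n)) + x * (D x * x ^ n)"
    by (simp add: D_mult[OF Suc.prems] distrib_left)
  also have "\<dots> = of_nat (Suc n) * (x ^ Suc n * D x)"
    unfolding Suc.IH[OF Suc.prems] by (simp add: algebra_simps)
  finally show ?case .
qed

text \<open>
  The radical of a differential ideal is differential: starting from \<open>a\<^sup>n\<close>, each application of \<open>D\<close>
  followed by a multiplication with \<open>D a\<close> trades one factor \<open>a\<close> for two factors \<open>D a\<close>, up to an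
  integer, which is invertible.
\<close>

lemma diff_ideal_power:
  assumes P: "diff_ideal P" and inv: "\<And>n. n > 0 \<Longrightarrow> \<exists>r\<in>A. r * of_nat n = 1"
    and D: "D \<in> Ds" and a: "a \<in> A" "a ^ n \<in> P"
  shows "D a ^ (2 * n) \<in> P"
proof -
  interpret P: ideal_in A P using P by (simp add: diff_ideal_def)
  have DP: "D x \<in> P" if "x \<in> P" for x using P D that by (simp add: diff_ideal_def)
  note DA = Ds_closed[OF D]
  have "a ^ (n - k) * D a ^ (2 * k) \<in> P" if "k \<le> n" for k
    using that
  proof (induction k)
    case (Suc k)
    define m where "m = n - Suc k"
    have m: "n - k = Suc m" using Suc.prems by (simp add: m_def)
    let ?x = "D a" and ?y = "D a ^ (2 * k)"
    have IH: "a ^ Suc m * ?y \<in> P" using Suc m by simp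
    have e: "D (a ^ Suc m) = of_nat (Suc m) * (a ^ m * ?x)" for m
    proof (induction m)
      case (Suc m)
      have "D (a ^ Suc (Suc m)) = a * D (a ^ Suc m) + ?x * a ^ Suc m"
        by (simp add: D_mult[OF D])
      thus ?case unfolding Suc by (simp add: algebra_simps)
    qed simp
    have "?x * D (a ^ Suc m * ?y) = a ^ Suc m * (?x * D ?y) + ?x * (D (a ^ Suc m) * ?y)"
      by (simp add: D_mult[OF D] algebra_simps)
    also have "\<dots> = of_nat (2 * k) * D ?x * (a ^ Suc m * ?y) + of_nat (Suc m) * (a ^ m * ?x ^ (2 * Suc k))"
      unfolding D_power[OF D] e by (simp add: algebra_simps)
    finally have "of_nat (2 * k) * D ?x * (a ^ Suc m * ?y) + of_nat (Suc m) * (a ^ m * ?x ^ (2 * Suc k)) \<in> P"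
      using P.mult_I[OF DA[OF a(1)] DP[OF IH]] by simp
    moreover have "of_nat (2 * k) * D ?x * (a ^ Suc m * ?y) \<in> P"
      by (rule P.mult_I[OF P.mult_A[OF P.of_nat_A DA[OF DA[OF a(1)]]] IH])
    ultimately have *: "of_nat (Suc m) * (a ^ m * ?x ^ (2 * Suc k)) \<in> P" by (rule P.in_I_if_add_left)
    obtain r where "r \<in> A" "r * of_nat (Suc m) = 1" using inv[of "Suc m"] by blast
    with P.mult_I[OF this(1) *] show ?case by (simp add: m_def mult.assoc[symmetric])
  qed (use a in simp)
  from this[of n] show ?thesis by simp
qed

text \<open>
  The core \<open>P\<close> of \<open>M\<close> is radical, since its radical is a differential ideal in \<open>M\<close>.  For a radical
  differential ideal all quotients \<open>(P : a)\<close> are differential ideals.  If \<open>a b \<in> P\<close> and \<open>(P : a) \<subseteq> M\<close>, then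
  \<open>b \<in> (P : a) \<subseteq> P\<close>; otherwise some \<open>c \<notin> M\<close> satisfies \<open>a c \<in> P\<close>, and \<open>a \<in> (P : c) \<subseteq> M\<close> gives \<open>a \<in> P\<close>.
\<close>

lemma core_prime:
  assumes M: "prime_in A M" and P: "diff_ideal P" "P \<subseteq> M"
    and largest: "\<And>I. diff_ideal I \<Longrightarrow> I \<subseteq> M \<Longrightarrow> I \<subseteq> P"
    and inv: "\<And>n. n > 0 \<Longrightarrow> \<exists>r\<in>A. r * of_nat n = 1"
  shows "prime_in A P"
proof -
  interpret M: prime_in A M by fact
  interpret P: ideal_in A P using P by (simp add: diff_ideal_def)
  have DP: "D x \<in> P" if "x \<in> P" "D \<in> Ds" for x D using P that by (simp add: diff_ideal_def)
  define N where "N = {a \<in> A. \<exists>n. a ^ n \<in> P}"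
  have "ideal_in A N"
  proof unfold_locales
    show "0 \<in> N" unfolding N_def using P.zero_I P.zero_A by (auto intro: exI[of _ 1])
    show "s * a \<in> N" if "s \<in> A" "a \<in> N" for s a
      using that by (auto simp: N_def power_mult_distrib intro!: P.mult_A exI[of _ "_ :: nat"] P.mult_I P.power_A)
    show "a + b \<in> N" if ab: "a \<in> N" "b \<in> N" for a b
    proof -
      from ab obtain m n where A: "a \<in> A" "b \<in> A" and mn: "a ^ m \<in> P" "b ^ n \<in> P" by (auto simp: N_def)
      have "of_nat (m + n choose k) * a ^ k * b ^ (m + n - k) \<in> P" if "k \<le> m + n" for k
      proof (cases "m \<le> k")
        case True
        hence "a ^ k = a ^ (k - m) * a ^ m" by (simp flip: power_add)
        hence "a ^ k \<in> P" using P.mult_I[OF P.power_A[OF A(1)] mn(1)] by simp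
        thus ?thesis by (intro P.mult_I2[OF P.mult_I] P.of_nat_A P.power_A A)
      next
        case False
        hence "b ^ (m + n - k) = b ^ (m - k) * b ^ n" by (simp flip: power_add)
        hence "b ^ (m + n - k) \<in> P" using P.mult_I[OF P.power_A[OF A(2)] mn(2)] by simp
        thus ?thesis by (intro P.mult_I P.mult_A P.of_nat_A P.power_A A)
      qed
      hence "(a + b) ^ (m + n) \<in> P" unfolding binomial_ring by (intro P.sum_I) simp
      thus ?thesis using A P.add_A by (auto simp: N_def)
    qed
  qed (auto simp: N_def P.one_A P.add_A P.mult_A P.uminus_A)
  moreover have "D a \<in> N" if "a \<in> N" "D \<in> Ds" for a D
    using that diff_ideal_power[OF P(1) inv, of D a] Ds_closed unfolding N_def by blast
  ultimately have "diff_ideal N" by (simp add: diff_ideal_def)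
  moreover have "N \<subseteq> M" unfolding N_def using M.power_notin P(2) by blast
  ultimately have "N \<subseteq> P" by (rule largest)
  hence radical: "a \<in> P" if "a \<in> A" "a ^ n \<in> P" for a n using that by (auto simp: N_def)
  have quotient: "diff_ideal {b \<in> A. a * b \<in> P}" if a: "a \<in> A" for a
  proof -
    have "ideal_in A {b \<in> A. a * b \<in> P}"
    proof unfold_locales
      show "s * b \<in> {b \<in> A. a * b \<in> P}" if "s \<in> A" "b \<in> {b \<in> A. a * b \<in> P}" for s b
        using that P.mult_I[of s "a * b"] by (simp add: P.mult_A mult.left_commute)
    qed (auto simp: P.one_A P.add_A P.mult_A P.uminus_A P.zero_A P.zero_I distrib_left intro: P.add_I)
    moreover have "a * D b \<in> P" if b: "b \<in> A" "a * b \<in> P" and D: "D \<in> Ds" for b D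
    proof -
      note DA = Ds_closed[OF D]
      have "a * D b * D (a * b) \<in> P" by (rule P.mult_I[OF P.mult_A[OF a DA[OF b(1)]] DP[OF b(2) D]])
      moreover have "a * D b * D (a * b) = (D a * D b) * (a * b) + (a * D b) ^ 2"
        by (simp add: D_mult[OF D] algebra_simps power2_eq_square)
      moreover have "(D a * D b) * (a * b) \<in> P" by (rule P.mult_I[OF P.mult_A[OF DA[OF a] DA[OF b(1)]] b(2)])
      ultimately have "(a * D b) ^ 2 \<in> P" using P.in_I_if_add_left by metis
      thus ?thesis by (rule radical[rotated]) (intro P.mult_A a DA b)
    qed
    ultimately show ?thesis by (simp add: diff_ideal_def Ds_closed)
  qed
  show ?thesis
  proof unfold_locales
    show "1 \<notin> P" using P(2) M.one_notin by blast
    show "a \<in> P \<or> b \<in> P" if ab: "a \<in> A" "b \<in> A" "a * b \<in> P" for a b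
    proof (cases "{b \<in> A. a * b \<in> P} \<subseteq> M")
      case True
      thus ?thesis using largest[OF quotient[OF ab(1)]] ab by blast
    next
      case False
      then obtain c where c: "c \<in> A" "a * c \<in> P" "c \<notin> M" by blast
      have "{b \<in> A. c * b \<in> P} \<subseteq> M" using c M.cancel_I P(2) by blast
      hence "{b \<in> A. c * b \<in> P} \<subseteq> P" by (rule largest[OF quotient[OF c(1)]])
      thus ?thesis using ab(1) c(2) by (auto simp: mult.commute)
    qed
  qed
qed

end


section \<open>Closed points over an uncountable field\<close>

lemma countable_finite_support:
  assumes "countable (UNIV :: 'x set)" "countable (UNIV :: 'b::zero set)"
  shows "countable (UNIV :: ('x \<Rightarrow>\<^sub>0 'b) set)"
proof -
  let ?g = "\<lambda>m :: 'x \<Rightarrow>\<^sub>0 'b. (\<lambda>x. (x, Poly_Mapping.lookup m x)) ` Poly_Mapping.keys m"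
  have "inj ?g"
  proof (rule injI, rule poly_mapping_eqI)
    fix m n :: "'x \<Rightarrow>\<^sub>0 'b" and x assume eq: "?g m = ?g n"
    have "(x, y) \<in> ?g m \<longleftrightarrow> Poly_Mapping.lookup m x = y \<and> y \<noteq> 0" for m :: "'x \<Rightarrow>\<^sub>0 'b" and y
      by (auto simp: in_keys_iff)
    thus "Poly_Mapping.lookup m x = Poly_Mapping.lookup n x" using eq by metis
  qed
  moreover have "countable (UNIV :: ('x \<times> 'b) set)"
    using countable_SIGMA[OF assms(1), of "\<lambda>_. UNIV :: 'b set"] assms(2) by simp
  hence "countable {S :: ('x \<times> 'b) set. finite S}"
    using countable_Collect_finite_subset[of UNIV] by simp
  hence "countable (range ?g)" by (rule countable_subset[rotated]) auto
  ultimately show ?thesis by (simp add: countable_image_inj_eq)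
qed

interpretation poly_mapping_space: vector_space "scal :: 'k::field \<Rightarrow> ('x \<Rightarrow>\<^sub>0 'k) \<Rightarrow> ('x \<Rightarrow>\<^sub>0 'k)"
  by unfold_locales (auto intro!: poly_mapping_eqI simp: lookup_add algebra_simps)

lemma keys_subset_span:
  assumes "finite F" "Poly_Mapping.keys v \<subseteq> F"
  shows "(v :: 'x \<Rightarrow>\<^sub>0 'k::field) \<in> poly_mapping_space.span ((\<lambda>m. Poly_Mapping.single m 1) ` F)"
proof -
  have "v = (\<Sum>x\<in>Poly_Mapping.keys v. scal (Poly_Mapping.lookup v x) (Poly_Mapping.single x 1))"
    by (simp add: poly_mapping_sum_singles)
  also have "\<dots> \<in> poly_mapping_space.span ((\<lambda>m. Poly_Mapping.single m 1) ` F)"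
    using assms(2) by (intro poly_mapping_space.span_sum poly_mapping_space.span_scale poly_mapping_space.span_base) auto
  finally show ?thesis .
qed

lemma linear_dependence:
  fixes d :: "'c \<Rightarrow> ('x \<Rightarrow>\<^sub>0 'k::field)"
  assumes "finite F" "\<And>c. c \<in> C \<Longrightarrow> Poly_Mapping.keys (d c) \<subseteq> F" "infinite C" "inj_on d C"
  obtains T l c0 where "finite T" "T \<subseteq> C" "(\<Sum>c\<in>T. scal (l c) (d c)) = 0" "c0 \<in> T" "l c0 \<noteq> 0"
proof -
  let ?B = "(\<lambda>m. Poly_Mapping.single m 1) ` F :: ('x \<Rightarrow>\<^sub>0 'k) set"
  have "d ` C \<subseteq> poly_mapping_space.span ?B" using keys_subset_span[OF assms(1)] assms(2) by blast
  moreover have "infinite (d ` C)" using assms(3,4) finite_imageD by blast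
  ultimately have "poly_mapping_space.dependent (d ` C)"
    using poly_mapping_space.independent_span_bound[of ?B "d ` C"] assms(1) by blast
  then obtain t u v where t: "finite t" "t \<subseteq> d ` C" "(\<Sum>v\<in>t. scal (u v) v) = 0" "v \<in> t" "u v \<noteq> 0"
    unfolding poly_mapping_space.dependent_explicit by blast
  obtain T where T: "T \<subseteq> C" "t = d ` T" using t(2) by (meson subset_imageE)
  have inj: "inj_on d T" using T assms(4) inj_on_subset by blast
  obtain c0 where c0: "c0 \<in> T" "v = d c0" using t(4) T by blast
  show ?thesis
  proof (rule that[of T "u \<circ> d" c0])
    show "finite T" using t(1) T inj finite_imageD by blast
    show "(\<Sum>c\<in>T. scal ((u \<circ> d) c) (d c)) = 0"
      using t(3) unfolding T(2) by (simp add: sum.reindex[OF inj])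
  qed (use T c0 t in auto)
qed

definition eval_at :: "('x, 'k::field) sym \<Rightarrow> 'k poly \<Rightarrow> ('x, 'k) sym" where
  "eval_at b q = poly (map_poly sym_const q) b"

lemma eval_at_pCons: "eval_at b (pCons c q) = sym_const c + b * eval_at b q"
  by (simp add: eval_at_def map_poly_pCons)

lemma eval_at_0 [simp]: "eval_at b 0 = 0"
  by (simp add: eval_at_def)

lemma eval_at_add: "eval_at b (p + q) = eval_at b p + eval_at b q"
proof -
  have "map_poly sym_const (p + q) = map_poly sym_const p + (map_poly sym_const q :: ('a, 'b) sym poly)"
    by (intro poly_eqI) (simp add: coeff_map_poly sym_const_add)
  thus ?thesis by (simp add: eval_at_def)
qed

lemma eval_at_smult: "eval_at b (smult c q) = sym_const c * eval_at b q"
  by (induction q) (simp_all add: eval_at_pCons sym_const_mult algebra_simps)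

lemma eval_at_mult: "eval_at b (p * q) = eval_at b p * eval_at b q"
  by (induction p) (simp_all add: eval_at_add eval_at_smult eval_at_pCons algebra_simps)

lemma eval_at_sum: "eval_at b (sum f T) = (\<Sum>x\<in>T. eval_at b (f x))"
  by (induction T rule: infinite_finite_induct) (simp_all add: eval_at_add)

lemma eval_at_linear_prod: "eval_at b (\<Prod>c\<in>T. [:- c, 1:]) = (\<Prod>c\<in>T. b - sym_const c)"
proof -
  have 1: "eval_at b 1 = 1"
    using eval_at_pCons[of b 1 0] by (simp add: one_pCons)
  have lin: "eval_at b [:- c, 1:] = b - sym_const c" for c
    by (simp add: eval_at_pCons sym_const_uminus)
  show ?thesis
    by (induction T rule: infinite_finite_induct) (simp_all add: 1 lin eval_at_mult del: mult_pCons_left)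
qed

text \<open>
  An element that is algebraic over an algebraically closed field is congruent to a constant modulo a prime ideal.
\<close>

lemma root_mod_prime:
  fixes M :: "('x, 'k::alg_closed_field) sym set"
  assumes M: "prime_in A M" and const: "\<And>c. sym_const c \<in> A" and b: "b \<in> A"
    and q: "q \<noteq> 0" "eval_at b q \<in> M"
  shows "\<exists>c. b - sym_const c \<in> M"
proof -
  interpret M: prime_in A M by fact
  have A: "eval_at b p \<in> A" for p
    by (induction p) (auto simp: M.zero_A eval_at_pCons intro: M.add_A M.mult_A const b)
  show ?thesis
    using q
  proof (induction "degree q" arbitrary: q)
    case 0
    then obtain c where q: "q = [:c:]" by (metis degree_eq_zeroE)
    hence "c \<noteq> 0" "sym_const c \<in> M" using 0 by (auto simp: eval_at_pCons)
    hence "sym_const (1 / c) * sym_const c \<in> M" by (intro M.mult_I const)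
    hence "1 \<in> M" using \<open>c \<noteq> 0\<close> by (simp flip: sym_const_mult)
    thus ?case using M.one_notin by contradiction
  next
    case (Suc n)
    then obtain r where "poly q r = 0" using alg_closed_imp_poly_has_root[of q] by auto
    then obtain p where p: "q = [:- r, 1:] * p" by (meson poly_eq_0_iff_dvd dvdE)
    have "p \<noteq> 0" using p Suc.prems by auto
    hence "degree q = Suc (degree p)" unfolding p by (subst degree_mult_eq) auto
    hence deg: "n = degree p" using Suc.hyps by simp
    have "(b - sym_const r) * eval_at b p \<in> M"
      using Suc.prems(2) unfolding p eval_at_mult by (simp add: eval_at_pCons sym_const_uminus)
    hence "b - sym_const r \<in> M \<or> eval_at b p \<in> M"
      using M.prime_I A M.diff_A[OF b const] by blast
    thus ?case using Suc.hyps(1)[OF deg \<open>p \<noteq> 0\<close>] by blast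
  qed
qed

text \<open>
  An ideal maximal among those that contain no power of \<open>a\<close> is prime.  The last property says that
  \<open>a\<close> becomes divisible by every nonzero element of the quotient up to powers: inverting \<open>a\<close> turns
  the quotient into a field.
\<close>

lemma maximal_avoiding:
  fixes a :: "'a::comm_ring_1"
  assumes J: "prime_in A J" and a: "a \<in> A" "a \<notin> J"
  obtains M where "prime_in A M" "J \<subseteq> M" "a \<notin> M"
    "\<And>b. b \<in> A \<Longrightarrow> b \<notin> M \<Longrightarrow> \<exists>d\<in>A. \<exists>n. a ^ n - d * b \<in> M"
proof -
  interpret J: prime_in A J by fact
  define S where "S = {I. ideal_in A I \<and> J \<subseteq> I \<and> (\<forall>n. a ^ n \<notin> I)}"
  have "J \<in> S" unfolding S_def using J.power_notin[OF a] J.ideal_in_axioms by simp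
  moreover have "\<Union>C \<in> S" if C: "C \<noteq> {}" "subset.chain S C" for C
  proof -
    have CS: "I \<in> C \<Longrightarrow> I \<in> S" for I using C(2) by (auto simp: subset.chain_def)
    have CI: "ideal_in A I" if "I \<in> C" for I using CS[OF that] by (simp add: S_def)
    have "ideal_in A (\<Union>C)"
    proof unfold_locales
      show "x + y \<in> \<Union>C" if xy: "x \<in> \<Union>C" "y \<in> \<Union>C" for x y
      proof -
        obtain I K where IK: "x \<in> I" "I \<in> C" "y \<in> K" "K \<in> C" using xy by blast
        hence "I \<subseteq> K \<or> K \<subseteq> I" using C(2) by (auto simp: subset.chain_def)
        thus ?thesis using IK ideal_in.add_I[OF CI] by blast
      qed
      show "0 \<in> \<Union>C" using C(1) ideal_in.zero_I[OF CI] by blast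
      show "\<Union>C \<subseteq> A" using ideal_in.I_subset[OF CI] by blast
      show "s * x \<in> \<Union>C" if "s \<in> A" "x \<in> \<Union>C" for s x
        using that ideal_in.mult_I[OF CI] by blast
    qed (simp_all add: J.one_A J.add_A J.mult_A J.uminus_A)
    thus ?thesis using CS C(1) by (fastforce simp: S_def)
  qed
  ultimately obtain M where M: "M \<in> S" "\<And>I. I \<in> S \<Longrightarrow> M \<subseteq> I \<Longrightarrow> I = M"
    using subset_Zorn_nonempty[of S] by blast
  interpret M: ideal_in A M using M(1) by (simp add: S_def)
  have JM: "J \<subseteq> M" and powM: "a ^ n \<notin> M" for n using M(1) by (auto simp: S_def)
  have witness: "\<exists>d\<in>A. \<exists>n. a ^ n - d * b \<in> M" if b: "b \<in> A" "b \<notin> M" for b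
  proof (rule ccontr)
    assume neg: "\<not> ?thesis"
    define I where "I = {x \<in> A. \<exists>d\<in>A. x - d * b \<in> M}"
    have "ideal_in A I"
    proof unfold_locales
      show "0 \<in> I" using M.zero_A M.zero_I by (auto simp: I_def intro!: bexI[of _ 0])
      show "x + y \<in> I" if xy: "x \<in> I" "y \<in> I" for x y
      proof -
        obtain d e where d: "d \<in> A" "x - d * b \<in> M" "e \<in> A" "y - e * b \<in> M" using xy by (auto simp: I_def)
        have "(x - d * b) + (y - e * b) \<in> M" by (intro M.add_I d)
        hence "(x + y) - (d + e) * b \<in> M" by (simp add: algebra_simps)
        thus ?thesis using xy d M.add_A by (auto simp: I_def)
      qed
      show "s * x \<in> I" if s: "s \<in> A" "x \<in> I" for s x
      proof -
        obtain d where d: "d \<in> A" "x - d * b \<in> M" using s by (auto simp: I_def)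
        have "s * (x - d * b) \<in> M" by (intro M.mult_I d s)
        hence "s * x - (s * d) * b \<in> M" by (simp add: algebra_simps)
        thus ?thesis using s d M.mult_A by (auto simp: I_def)
      qed
    qed (auto simp: I_def M.one_A M.add_A M.mult_A M.uminus_A)
    moreover have MI: "M \<subseteq> I"
      using M.I_subset M.zero_A by (auto simp: I_def intro!: bexI[of _ 0])
    moreover have "a ^ n \<notin> I" for n using neg by (auto simp: I_def)
    ultimately have "I \<in> S" using JM by (auto simp: S_def)
    hence "I = M" using M(2) MI by blast
    moreover have "b \<in> I" using b M.one_A M.zero_I by (auto simp: I_def intro!: bexI[of _ 1])
    ultimately show False using b by blast
  qed
  have "prime_in A M"
  proof unfold_locales
    show "1 \<notin> M" using powM[of 0] by simp
    show "b \<in> M \<or> b' \<in> M" if bb: "b \<in> A" "b' \<in> A" "b * b' \<in> M" for b b'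
    proof (rule ccontr)
      assume "\<not> ?thesis"
      then obtain d n d' n' where d: "d \<in> A" "a ^ n - d * b \<in> M" and d': "d' \<in> A" "a ^ n' - d' * b' \<in> M"
        using witness bb by metis
      have "a ^ n' * (a ^ n - d * b) + d * b * (a ^ n' - d' * b') + d * d' * (b * b') \<in> M"
        by (intro M.add_I M.mult_I M.mult_A M.power_A d d' bb a)
      hence "a ^ (n + n') \<in> M" by (simp add: algebra_simps power_add)
      thus False using powM by blast
    qed
  qed
  thus ?thesis using JM powM[of 1] witness by (intro that) auto
qed

text \<open>
  The Nullstellensatz in countably many variables.  If no \<open>b - c\<close> with constant \<open>c\<close> is in \<open>M\<close>, each of them divides
  a power of \<open>a\<close>, with cofactor \<open>d\<^sub>c\<close>.  By uncountability infinitely many \<open>c\<close> share the exponent and the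
  support of \<open>d\<^sub>c\<close>, so these \<open>d\<^sub>c\<close> are linearly dependent.  As \<open>d\<^sub>c\<close> is \<open>a\<^sup>m / (b - c)\<close> modulo \<open>M\<close>, clearing
  denominators gives a polynomial equation for \<open>b\<close> over the field, hence a root \<open>c\<close> with \<open>b - c \<in> M\<close>.
\<close>

lemma residue_field_const:
  fixes M :: "('x, 'k::alg_closed_field) sym set"
  assumes unc: "uncountable (UNIV :: 'k set)" and cnt: "countable (UNIV :: 'x set)"
    and M: "prime_in A M" and const: "\<And>c. sym_const c \<in> A"
    and a: "a \<in> A" "a \<notin> M"
    and witness: "\<And>b. b \<in> A \<Longrightarrow> b \<notin> M \<Longrightarrow> \<exists>d\<in>A. \<exists>n. a ^ n - d * b \<in> M"
    and b: "b \<in> A"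
  shows "\<exists>c. b - sym_const c \<in> M"
proof (rule ccontr)
  interpret M: prime_in A M by fact
  assume neg: "\<not> ?thesis"
  let ?L = "\<lambda>c. b - sym_const c"
  have L: "?L c \<in> A" "?L c \<notin> M" for c using neg M.diff_A[OF b const] by auto
  have "\<exists>d n. d \<in> A \<and> a ^ n - d * ?L c \<in> M" for c using witness[OF L] by blast
  then obtain d n where d: "\<And>c. d c \<in> A" "\<And>c. a ^ n c - d c * ?L c \<in> M" by metis
  define key where "key = (\<lambda>c. (n c, Poly_Mapping.keys (d c)))"
  have "countable (UNIV :: ('x \<Rightarrow>\<^sub>0 nat) set)" by (rule countable_finite_support[OF cnt]) simp
  hence "countable {F :: ('x \<Rightarrow>\<^sub>0 nat) set. finite F}"
    using countable_Collect_finite_subset[of UNIV] by simp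
  hence "countable ((UNIV :: nat set) \<times> {F :: ('x \<Rightarrow>\<^sub>0 nat) set. finite F})" by simp
  hence "countable (range key)" by (rule countable_subset[rotated]) (auto simp: key_def)
  moreover have "UNIV = (\<Union>y\<in>range key. key -` {y})" by auto
  ultimately obtain y where y: "uncountable (key -` {y})"
    using unc countable_UN[of "range key" "\<lambda>y. key -` {y}"] by metis
  define C where "C = key -` {y}"
  have infC: "infinite C" using y countable_finite by (auto simp: C_def)
  obtain m F where mF: "y = (m, F)" by force
  have C: "n c = m" "Poly_Mapping.keys (d c) = F" if "c \<in> C" for c
    using that by (auto simp: C_def key_def mF)
  obtain c1 where "c1 \<in> C" using infC by (metis finite.emptyI ex_in_conv)
  hence finF: "finite F" using C(2) finite_keys by blast
  have inj: "inj_on d C"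
  proof (rule inj_onI, rule ccontr)
    fix c c' assume c: "c \<in> C" "c' \<in> C" "d c = d c'" "c \<noteq> c'"
    have diff: "(a ^ m - d c * ?L c) - (a ^ m - d c * ?L c') \<in> M"
      by (rule M.diff_I) (use d(2)[of c] d(2)[of c'] C(1) c in simp_all)
    have "sym_const (c - c') = (sym_const c - sym_const c' :: ('x, 'k) sym)"
      by (simp add: sym_const_def single_diff)
    hence "(a ^ m - d c * ?L c) - (a ^ m - d c * ?L c') = d c * sym_const (c - c')"
      by (simp only:) (simp add: algebra_simps)
    with diff have "d c * sym_const (c - c') \<in> M" by simp
    hence "d c * sym_const (c - c') * sym_const (1 / (c - c')) \<in> M" by (rule M.mult_I2[OF _ const])
    hence "d c \<in> M" using c(4) by (simp add: mult.assoc flip: sym_const_mult)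
    hence "(a ^ m - d c * ?L c) + d c * ?L c \<in> M"
      using d(2)[of c] C(1)[OF c(1)] L by (intro M.add_I M.mult_I2) auto
    thus False using M.power_notin[OF a] by simp
  qed
  obtain T l c0 where T: "finite T" "T \<subseteq> C" "(\<Sum>c\<in>T. scal (l c) (d c)) = 0" "c0 \<in> T" "l c0 \<noteq> 0"
    using linear_dependence[OF finF _ infC inj] C(2) by blast
  define q where "q = (\<Sum>c\<in>T. smult (l c) (\<Prod>c'\<in>T - {c}. [:- c', 1:]))"
  let ?Pi = "\<lambda>c. \<Prod>c'\<in>T - {c}. ?L c'"
  have q: "eval_at b q = (\<Sum>c\<in>T. sym_const (l c) * ?Pi c)"
    by (simp add: q_def eval_at_sum eval_at_smult eval_at_linear_prod)
  \<comment> \<open>At \<open>c0\<close> only one summand survives, so \<open>q\<close> is not the zero polynomial.\<close>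
  have "poly q c0 = (\<Sum>c\<in>T. if c = c0 then l c0 * (\<Prod>c'\<in>T - {c0}. c0 - c') else 0)"
    unfolding q_def poly_sum poly_smult poly_prod
    using T(1,4) by (intro sum.cong refl) (auto intro!: prod_zero)
  also have "\<dots> \<noteq> 0" using T by simp
  finally have "q \<noteq> 0" by auto
  have "(\<Sum>c\<in>T. sym_const (l c) * ?Pi c * (a ^ m - d c * ?L c)) \<in> M"
    using d(2) C(1) T(2) by (intro M.sum_I M.mult_I M.mult_A M.prod_A const L) force
  moreover have "(\<Sum>c\<in>T. sym_const (l c) * ?Pi c * (d c * ?L c)) = 0"
  proof -
    have "(\<Sum>c\<in>T. sym_const (l c) * ?Pi c * (d c * ?L c)) = (\<Sum>c\<in>T. prod ?L T * scal (l c) (d c))"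
      by (intro sum.cong refl) (simp add: scal_conv_sym_const prod.remove[OF T(1)] mult_ac)
    also have "\<dots> = 0" by (simp add: T(3) flip: sum_distrib_left)
    finally show ?thesis .
  qed
  ultimately have "a ^ m * eval_at b q \<in> M"
    by (simp add: q right_diff_distrib sum_subtractf sum_distrib_left mult_ac)
  moreover have "eval_at b q \<in> A"
    unfolding q by (intro M.sum_A M.mult_A M.prod_A const L)
  ultimately have "eval_at b q \<in> M" using M.cancel_power a by blast
  with root_mod_prime[OF M const b \<open>q \<noteq> 0\<close>] neg show False by blast
qed


section \<open>Irreducible closed sets of Poisson primitive ideals\<close>

context poisson_ring
begin

lemma pvariety_Inter:
  assumes "closedin (zariski R pb) Z"
  shows "pvariety R pb (\<Inter>Z) = Z"
proof -
  obtain I where I: "Z = pvariety R pb I"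
    using assms closedin_zariski by blast
  hence "I \<subseteq> \<Inter>Z" by (auto simp: pvariety_def)
  thus ?thesis using I by (auto simp: pvariety_def)
qed

lemma prime_ideals_Int:
  assumes "primeideal P R" "ideal I R" "ideal J R" "I \<inter> J \<subseteq> P"
  shows "I \<subseteq> P \<or> J \<subseteq> P"
proof (rule ccontr)
  assume "\<not> ?thesis"
  hence "\<not> I \<subseteq> P" "\<not> J \<subseteq> P" by simp_all
  then obtain a b where ab: "a \<in> I" "a \<notin> P" "b \<in> J" "b \<notin> P" by blast
  have c: "a \<in> carrier R" "b \<in> carrier R"
    using ab ideal.Icarr[OF assms(2)] ideal.Icarr[OF assms(3)] by simp_all
  have "a \<otimes> b \<in> I \<inter> J"
    using ideal.I_r_closed[OF assms(2)] ideal.I_l_closed[OF assms(3)] ab c by blast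
  thus False using primeideal.I_prime[OF assms(1) c] assms(4) ab by blast
qed

context
  assumes primitive_prime: "\<And>P. poisson_primitive R pb P \<Longrightarrow> primeideal P R"
    and separation: "\<And>J a. J \<in> prime_poisson_ideals R pb \<Longrightarrow> a \<in> carrier R \<Longrightarrow> a \<notin> J \<Longrightarrow>
      \<exists>P\<in>pspec_prim R pb. J \<subseteq> P \<and> a \<notin> P"
begin

text \<open>
  The separation assumption says that every prime Poisson ideal is an intersection of primitive ones.
\<close>

lemma Inter_pvariety:
  assumes J: "J \<in> prime_poisson_ideals R pb"
  shows "\<Inter>(pvariety R pb J) = J" "pvariety R pb J \<noteq> {}"
proof -
  have sep: "\<exists>P\<in>pvariety R pb J. a \<notin> P" if "a \<in> carrier R" "a \<notin> J" for a
    using separation[OF J that] by (auto simp: pvariety_def)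
  have pi: "primeideal J R" using J by (simp add: prime_poisson_ideals_def)
  have "carrier R \<noteq> J" "J \<subseteq> carrier R"
    using primeideal.I_notcarr[OF pi] ideal.Icarr[OF primeideal.axioms(1)[OF pi]] by auto
  then obtain x where "x \<in> carrier R" "x \<notin> J" by blast
  thus ne: "pvariety R pb J \<noteq> {}" using sep by blast
  have "P \<subseteq> carrier R" if "P \<in> pvariety R pb J" for P
    using that ideal.Icarr by (auto simp: pvariety_def pspec_prim_def poisson_primitive_def poisson_ideal_def)
  hence "\<Inter>(pvariety R pb J) \<subseteq> J" using sep ne by blast
  thus "\<Inter>(pvariety R pb J) = J" by (auto simp: pvariety_def)
qed

lemma irreducible_pvariety:
  assumes J: "J \<in> prime_poisson_ideals R pb"
  shows "irreducible_closedin (zariski R pb) (pvariety R pb J)"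
  unfolding irreducible_closedin_def
proof (intro conjI allI impI)
  have pJ: "poisson_ideal R pb J" "primeideal J R" using J by (simp_all add: prime_poisson_ideals_def)
  show "closedin (zariski R pb) (pvariety R pb J)" using pJ closedin_zariski by blast
  show "pvariety R pb J \<noteq> {}" by (rule Inter_pvariety[OF J])
  fix A B assume AB: "closedin (zariski R pb) A \<and> closedin (zariski R pb) B \<and> pvariety R pb J = A \<union> B"
  then obtain I1 I2 where I: "poisson_ideal R pb I1" "A = pvariety R pb I1"
      "poisson_ideal R pb I2" "B = pvariety R pb I2" using closedin_zariski by metis
  have "pvariety R pb J = pvariety R pb (I1 \<inter> I2)" using AB I pvariety_Un by simp
  hence "I1 \<inter> I2 \<subseteq> \<Inter>(pvariety R pb J)" by (auto simp: pvariety_def)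
  hence "I1 \<inter> I2 \<subseteq> J" using Inter_pvariety[OF J] by simp
  hence "I1 \<subseteq> J \<or> I2 \<subseteq> J"
    using prime_ideals_Int[OF pJ(2)] I by (simp add: poisson_ideal_def)
  hence "pvariety R pb J \<subseteq> A \<or> pvariety R pb J \<subseteq> B" unfolding I(2,4) by (auto simp: pvariety_def)
  thus "pvariety R pb J = A \<or> pvariety R pb J = B" using AB by blast
qed

text \<open>
  For a product \<open>a b\<close> in the intersection, \<open>Z\<close> is covered by the closed subsets of the ideals containing \<open>a\<close> and
  of those containing \<open>b\<close>, because primitive ideals are prime; by irreducibility one of them is \<open>Z\<close>.
\<close>

lemma Inter_irreducible:
  assumes Z: "irreducible_closedin (zariski R pb) Z"
  shows "\<Inter>Z \<in> prime_poisson_ideals R pb"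
proof -
  have cl: "closedin (zariski R pb) Z" and ne: "Z \<noteq> {}"
    and irr: "\<And>A B. closedin (zariski R pb) A \<Longrightarrow> closedin (zariski R pb) B \<Longrightarrow> Z = A \<union> B \<Longrightarrow> Z = A \<or> Z = B"
    using Z by (auto simp: irreducible_closedin_def)
  have sub: "Z \<subseteq> pspec_prim R pb" using closedin_subset[OF cl] by (simp add: topspace_zariski)
  have Zprim: "poisson_primitive R pb P" if "P \<in> Z" for P using that sub by (auto simp: pspec_prim_def)
  have Zpois: "poisson_ideal R pb P" if "P \<in> Z" for P using Zprim[OF that] by (auto simp: poisson_primitive_def)
  have pI: "poisson_ideal R pb (\<Inter>Z)" by (rule poisson_ideal_Inter[OF Zpois ne])
  have "primeideal (\<Inter>Z) R"
  proof (rule primeidealI)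
    show "ideal (\<Inter>Z) R" using pI by (simp add: poisson_ideal_def)
    show "cring R" by (rule is_cring)
    obtain P where P: "P \<in> Z" using ne by blast
    have "P \<subset> carrier R"
      using primeideal.I_notcarr[OF primitive_prime[OF Zprim[OF P]]]
        ideal.Icarr[of P R] Zpois[OF P] by (auto simp: poisson_ideal_def)
    thus "carrier R \<noteq> \<Inter>Z" using P by blast
    fix a b assume ab: "a \<in> carrier R" "b \<in> carrier R" "a \<otimes> b \<in> \<Inter>Z"
    \<comment> \<open>The Poisson ideal generated by \<open>a\<close>: membership of \<open>a\<close> is a closed condition on Poisson ideals.\<close>
    define G where "G = (\<lambda>a. \<Inter>{I. poisson_ideal R pb I \<and> a \<in> I})"
    have G: "poisson_ideal R pb (G a)" if "a \<in> carrier R" for a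
      unfolding G_def using that poisson_ideal_carrier by (intro poisson_ideal_Inter) auto
    have memG: "a \<in> P \<longleftrightarrow> P \<in> pvariety R pb (G a)" if "P \<in> Z" for a P
      using that sub Zpois[OF that] by (auto simp: G_def pvariety_def)
    let ?C = "\<lambda>a. Z \<inter> pvariety R pb (G a)"
    have C: "closedin (zariski R pb) (?C a)" if "a \<in> carrier R" for a
      using G[OF that] closedin_zariski cl by blast
    have "Z = ?C a \<union> ?C b"
    proof -
      have "a \<in> P \<or> b \<in> P" if "P \<in> Z" for P
        using primeideal.I_prime[OF primitive_prime[OF Zprim[OF that]] ab(1,2)] ab(3) that by blast
      thus ?thesis using memG by blast
    qed
    hence "Z = ?C a \<or> Z = ?C b" by (rule irr[OF C[OF ab(1)] C[OF ab(2)]])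
    thus "a \<in> \<Inter>Z \<or> b \<in> \<Inter>Z" using memG by blast
  qed
  thus ?thesis using pI by (simp add: prime_poisson_ideals_def)
qed

theorem bij_betw_irreducible_prime:
  "bij_betw Inter {Z. irreducible_closedin (zariski R pb) Z} (prime_poisson_ideals R pb)"
  "bij_betw (pvariety R pb) (prime_poisson_ideals R pb) {Z. irreducible_closedin (zariski R pb) Z}"
proof -
  have closed: "closedin (zariski R pb) Z" if "irreducible_closedin (zariski R pb) Z" for Z
    using that by (simp add: irreducible_closedin_def)
  show "bij_betw Inter {Z. irreducible_closedin (zariski R pb) Z} (prime_poisson_ideals R pb)"
    by (rule bij_betw_byWitness[where f' = "pvariety R pb"])
      (auto simp: pvariety_Inter closed Inter_pvariety Inter_irreducible irreducible_pvariety)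
  show "bij_betw (pvariety R pb) (prime_poisson_ideals R pb) {Z. irreducible_closedin (zariski R pb) Z}"
    by (rule bij_betw_byWitness[where f' = Inter])
      (auto simp: pvariety_Inter closed Inter_pvariety Inter_irreducible irreducible_pvariety)
qed

end

end


section \<open>Poisson ideals of symmetric algebras\<close>

lemma ideal_sym_ring: "ideal I (sym_ring U) \<longleftrightarrow> ideal_in (sym_span U) I"
proof
  assume I: "ideal I (sym_ring U)"
  interpret I: ideal I "sym_ring U" by fact
  show "ideal_in (sym_span U) I"
  proof
    show "1 \<in> sym_span U" using sym_span.const[of 1 U] by simp
    show "0 \<in> I" using additive_subgroup.zero_closed[OF ideal.axioms(1)[OF I]] by simp
    show "a + b \<in> I" if "a \<in> I" "b \<in> I" for a b using additive_subgroup.a_closed[OF ideal.axioms(1)[OF I], of a b] that by simp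
    show "s * a \<in> I" if "s \<in> sym_span U" "a \<in> I" for s a using I.I_l_closed[of a s] that by simp
    show "I \<subseteq> sym_span U" using I.Icarr by auto
  qed (fact sym_span.add sym_span.mult sym_span_uminus)+
next
  assume I: "ideal_in (sym_span U) I"
  interpret I: ideal_in "sym_span U" I by fact
  show "ideal I (sym_ring U)"
  proof (rule idealI)
    show "ring (sym_ring U)" using cring_sym_ring[of U] by (simp add: cring_def)
    show "subgroup I (add_monoid (sym_ring U))"
    proof (rule subgroup.intro)
      show "inv\<^bsub>add_monoid (sym_ring U)\<^esub> a \<in> I" if "a \<in> I" for a
        using sym_ring_a_inv[of a U] I.uminus_I[OF that] that I.I_subset by (auto simp: a_inv_def)
    qed (simp_all add: I.I_subset I.zero_I I.add_I)
  qed (simp_all add: I.mult_I I.mult_I2)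
qed

lemma primeideal_sym_ring: "primeideal I (sym_ring U) \<longleftrightarrow> prime_in (sym_span U) I"
proof
  assume I: "primeideal I (sym_ring U)"
  interpret I: primeideal I "sym_ring U" by fact
  interpret J: ideal_in "sym_span U" I using I.is_ideal by (simp add: ideal_sym_ring)
  show "prime_in (sym_span U) I"
  proof unfold_locales
    show "1 \<notin> I" using I.I_notcarr I.one_imp_carrier by auto
    show "a \<in> I \<or> b \<in> I" if "a \<in> sym_span U" "b \<in> sym_span U" "a * b \<in> I" for a b
      using I.I_prime[of a b] that by simp
  qed
next
  assume I: "prime_in (sym_span U) I"
  interpret I: prime_in "sym_span U" I by fact
  show "primeideal I (sym_ring U)"
  proof (rule primeidealI)
    show "ideal I (sym_ring U)" using I.ideal_in_axioms by (simp add: ideal_sym_ring)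
    show "carrier (sym_ring U) \<noteq> I" using I.one_A I.one_notin by auto
  qed (use I.prime_I cring_sym_ring in auto)
qed

lemma witt_pb_left_wvar_closed:
  assumes I: "ideal_in {p. indets p \<subseteq> X} I"
    and "\<And>n f. n \<in> X \<Longrightarrow> f \<in> I \<Longrightarrow> witt_pb (wvar n) f \<in> I" "f \<in> I" "indets s \<subseteq> X"
  shows "witt_pb f s \<in> I"
proof -
  interpret I: ideal_in "{p. indets p \<subseteq> X}" I by fact
  have "witt_pb s f = (\<Sum>i\<in>indets s. partial i s * witt_pb (wvar i) f)"
    by (rule witt_pb_expand) simp_all
  also have "\<dots> \<in> I"
    using assms indets_partial[of _ s] by (intro I.sum_I I.mult_I) (auto; blast)+
  finally show ?thesis
    using sym_bracket_skew[OF lie_bracket_witt, of f s] I.uminus_I by simp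
qed

text \<open>
  Brackets with arbitrary elements are combinations of brackets with generators, by the Leibniz rule.
\<close>

lemma prime_poisson_witt:
  fixes U :: "'k::field_char_0 witt set"
  assumes U: "sym_span U = {p. indets p \<subseteq> X}"
  shows "J \<in> prime_poisson_ideals (sym_ring U) witt_pb \<longleftrightarrow> witt_prime X J"
proof
  assume J: "J \<in> prime_poisson_ideals (sym_ring U) witt_pb"
  hence J1: "prime_in {p. indets p \<subseteq> X} J"
    by (simp add: prime_poisson_ideals_def primeideal_sym_ring U)
  have J2: "witt_pb a s \<in> J" if "a \<in> J" "indets s \<subseteq> X" for a s
    using J that by (auto simp: prime_poisson_ideals_def poisson_ideal_def U)
  interpret J: prime_in "{p. indets p \<subseteq> X}" J by (rule J1)
  show "witt_prime X J"
  proof unfold_locales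
    fix n f assume nf: "n \<in> X" "f \<in> J"
    have "indets (wvar n :: (int, 'k) sym) \<subseteq> X" using indets_wvar[of n] nf(1) by auto
    from J.uminus_I[OF J2[OF nf(2) this]] show "witt_pb (wvar n) f \<in> J"
      using sym_bracket_skew[OF lie_bracket_witt, of "wvar n" f] by simp
  qed
next
  assume J: "witt_prime X J"
  interpret J: witt_prime X J by fact
  show "J \<in> prime_poisson_ideals (sym_ring U) witt_pb"
    using J.prime_in_axioms J.ideal_in_axioms witt_pb_left_wvar_closed[OF J.ideal_in_axioms J.bracket_J]
    by (simp add: prime_poisson_ideals_def poisson_ideal_def ideal_sym_ring primeideal_sym_ring U)
qed

lemma diff_ring_sym_bracket:
  assumes "lie_bracket br" "\<And>u v. u \<in> U \<Longrightarrow> v \<in> U \<Longrightarrow> br u v \<in> U"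
  shows "diff_ring (sym_span U) ((\<lambda>s p. sym_bracket br p s) ` sym_span U)"
proof
  show "derivation D" if "D \<in> (\<lambda>s p. sym_bracket br p s) ` sym_span U" for D
    using that derivation_sym_bracket_left by blast
  show "D a \<in> sym_span U" if "D \<in> (\<lambda>s p. sym_bracket br p s) ` sym_span U" "a \<in> sym_span U" for D a
    using that sym_bracket_in_span[OF assms(1), of U] assms(2) by blast
qed

context
  fixes U :: "('x \<Rightarrow>\<^sub>0 'k::field_char_0) set" and br
  assumes lie: "lie_bracket br" and closed: "\<And>u v. u \<in> U \<Longrightarrow> v \<in> U \<Longrightarrow> br u v \<in> U"
begin

interpretation diff_ring "sym_span U" "(\<lambda>s p. sym_bracket br p s) ` sym_span U"
  by (rule diff_ring_sym_bracket[OF lie closed])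

lemma poisson_ideal_diff_ideal: "poisson_ideal (sym_ring U) (sym_bracket br) I \<longleftrightarrow> diff_ideal I"
  by (auto simp: poisson_ideal_def diff_ideal_def ideal_sym_ring)

lemma poisson_primitive_prime:
  assumes "poisson_primitive (sym_ring U) (sym_bracket br) P"
  shows "primeideal P (sym_ring U)"
proof -
  obtain M where M: "maximalideal M (sym_ring U)" and P: "diff_ideal P" "P \<subseteq> M"
    and largest: "\<And>I. diff_ideal I \<Longrightarrow> I \<subseteq> M \<Longrightarrow> I \<subseteq> P"
    using assms by (auto simp: poisson_primitive_def poisson_ideal_diff_ideal)
  have "primeideal M (sym_ring U)"
    by (rule cring.maximalideal_prime[OF cring_sym_ring M])
  hence M_prime: "prime_in (sym_span U) M" by (simp add: primeideal_sym_ring)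
  have inv: "\<exists>r\<in>sym_span U. r * of_nat n = 1" if "n > 0" for n
  proof
    have n: "of_nat n = (sym_const (of_nat n) :: ('x, 'k) sym)"
      using of_int_sym_const[of "int n"] by simp
    show "sym_const (1 / of_nat n) * of_nat n = (1 :: ('x, 'k) sym)"
      unfolding n sym_const_mult[symmetric] using that by simp
  qed (rule sym_span.const)
  have "prime_in (sym_span U) P" by (rule core_prime[OF M_prime P largest inv])
  thus ?thesis by (simp add: primeideal_sym_ring)
qed

end

lemma maximalideal_sym_ring:
  fixes M :: "('x, 'k::field) sym set"
  assumes M: "prime_in (sym_span U) M"
    and res: "\<And>b. b \<in> sym_span U \<Longrightarrow> \<exists>c. b - sym_const c \<in> M"
  shows "maximalideal M (sym_ring U)"
proof (rule maximalidealI)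
  interpret M: prime_in "sym_span U" M by fact
  show "ideal M (sym_ring U)" using M.ideal_in_axioms by (simp add: ideal_sym_ring)
  show "carrier (sym_ring U) \<noteq> M" using M.one_A M.one_notin by auto
  fix J assume J: "ideal J (sym_ring U)" "M \<subseteq> J" "J \<subseteq> carrier (sym_ring U)"
  interpret J: ideal_in "sym_span U" J using J(1) by (simp add: ideal_sym_ring)
  show "J = M \<or> J = carrier (sym_ring U)"
  proof (cases "J = M")
    case False
    then obtain b where b: "b \<in> J" "b \<notin> M" using J(2) by blast
    obtain c where c: "b - sym_const c \<in> M" using res b J.I_subset by blast
    have "c \<noteq> 0" using c b by auto
    have "b - (b - sym_const c) \<in> J" by (rule J.diff_I) (use c J(2) b in blast)+
    hence "sym_const c \<in> J" by simp
    hence "sym_const (1 / c) * sym_const c \<in> J" by (rule J.mult_I[OF sym_span.const])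
    hence "1 \<in> J" using \<open>c \<noteq> 0\<close> by (simp flip: sym_const_mult)
    hence "a \<in> J" if "a \<in> sym_span U" for a using J.mult_I[OF that] by fastforce
    thus ?thesis using J.I_subset by auto
  qed simp
qed

text \<open>
  A maximal ideal that contains \<open>J\<close> and avoids \<open>a\<close> exists by the Nullstellensatz; its core contains \<open>J\<close>.
\<close>

lemma poisson_primitive_separation:
  fixes U :: "('x \<Rightarrow>\<^sub>0 'k::{alg_closed_field, field_char_0}) set"
  assumes lie: "lie_bracket br" and closed: "\<And>u v. u \<in> U \<Longrightarrow> v \<in> U \<Longrightarrow> br u v \<in> U"
    and unc: "uncountable (UNIV :: 'k set)" and cnt: "countable (UNIV :: 'x set)"
    and J: "J \<in> prime_poisson_ideals (sym_ring U) (sym_bracket br)"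
    and a: "a \<in> carrier (sym_ring U)" "a \<notin> J"
  shows "\<exists>P\<in>pspec_prim (sym_ring U) (sym_bracket br). J \<subseteq> P \<and> a \<notin> P"
proof -
  interpret diff_ring "sym_span U" "(\<lambda>s p. sym_bracket br p s) ` sym_span U"
    by (rule diff_ring_sym_bracket[OF lie closed])
  have J': "prime_in (sym_span U) J" "poisson_ideal (sym_ring U) (sym_bracket br) J"
    using J by (simp_all add: prime_poisson_ideals_def primeideal_sym_ring)
  have aA: "a \<in> sym_span U" using a by simp
  obtain M where M: "prime_in (sym_span U) M" "J \<subseteq> M" "a \<notin> M"
      "\<And>b. b \<in> sym_span U \<Longrightarrow> b \<notin> M \<Longrightarrow> \<exists>d\<in>sym_span U. \<exists>n. a ^ n - d * b \<in> M"
    using maximal_avoiding[OF J'(1) aA a(2)] by blast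
  interpret M: prime_in "sym_span U" M by (rule M(1))
  have "maximalideal M (sym_ring U)"
    using residue_field_const[OF unc cnt M(1) sym_span.const aA M(3,4)]
    by (intro maximalideal_sym_ring M(1)) blast
  moreover obtain P where P: "diff_ideal P" "P \<subseteq> M" "\<And>I. diff_ideal I \<Longrightarrow> I \<subseteq> M \<Longrightarrow> I \<subseteq> P"
    using core_exists[OF M.ideal_in_axioms] by blast
  ultimately have "P \<in> pspec_prim (sym_ring U) (sym_bracket br)"
    unfolding pspec_prim_def poisson_primitive_def
    using poisson_ideal_diff_ideal[OF lie closed] by blast
  moreover have "J \<subseteq> P" using P(3) M(2) J'(2) poisson_ideal_diff_ideal[OF lie closed] by blast
  ultimately show ?thesis using P(2) M(3) by blast
qed

section \<open>Restriction to the polynomial vector fields\<close>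

theorem corollary5p2p14:
  assumes "uncountable (UNIV :: 'k::{alg_closed_field, field_char_0} set)"
  shows "bij_betw (\<lambda>J. J \<inter> carrier (S_W_ge :: (int, 'k) sym ring))
           (prime_poisson_ideals (S_W :: (int, 'k) sym ring) witt_pb)
           (prime_poisson_ideals (S_W_ge :: (int, 'k) sym ring) witt_pb)
       \<and> bij_betw (\<lambda>Z. pvariety (S_W_ge :: (int, 'k) sym ring) witt_pb (\<Inter>Z \<inter> carrier S_W_ge))
           {Z. irreducible_closedin (zariski (S_W :: (int, 'k) sym ring) witt_pb) Z}
           {Z. irreducible_closedin (zariski (S_W_ge :: (int, 'k) sym ring) witt_pb) Z}"
proof -
  let ?S = "S_W :: (int, 'k) sym ring" and ?A = "S_W_ge :: (int, 'k) sym ring"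
  have S: "J \<in> prime_poisson_ideals ?S witt_pb \<longleftrightarrow> witt_prime UNIV J" for J
    unfolding S_W_def by (rule prime_poisson_witt) (simp add: sym_span_UNIV)
  have A: "J \<in> prime_poisson_ideals ?A witt_pb \<longleftrightarrow> witt_prime {0..} J" for J
    unfolding S_W_ge_def by (rule prime_poisson_witt) (simp add: W_ge_carrier)
  have carrier: "carrier ?A = {p. indets p \<subseteq> {0..}}"
    by (simp add: S_W_ge_def W_ge_carrier)
  have restriction: "bij_betw (\<lambda>J. J \<inter> carrier ?A) (prime_poisson_ideals ?S witt_pb) (prime_poisson_ideals ?A witt_pb)"
    unfolding bij_betw_def
  proof
    show "inj_on (\<lambda>J. J \<inter> carrier ?A) (prime_poisson_ideals ?S witt_pb)"
    proof (rule inj_onI)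
      fix J1 J2 assume "J1 \<in> prime_poisson_ideals ?S witt_pb" "J2 \<in> prime_poisson_ideals ?S witt_pb"
        and "J1 \<inter> carrier ?A = J2 \<inter> carrier ?A"
      thus "J1 = J2" unfolding S carrier
        using contraction_subset[of J1 J2] contraction_subset[of J2 J1] by simp
    qed
    show "(\<lambda>J. J \<inter> carrier ?A) ` prime_poisson_ideals ?S witt_pb = prime_poisson_ideals ?A witt_pb"
    proof (intro equalityI subsetI)
      fix Q assume "Q \<in> (\<lambda>J. J \<inter> carrier ?A) ` prime_poisson_ideals ?S witt_pb"
      thus "Q \<in> prime_poisson_ideals ?A witt_pb"
        using witt_prime_contract by (auto simp: S A carrier)
    next
      fix Q assume "Q \<in> prime_poisson_ideals ?A witt_pb"
      then obtain J where "witt_prime UNIV J" "J \<inter> {p. indets p \<subseteq> {0..}} = Q"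
        using prime_extension[of Q] by (auto simp: A)
      thus "Q \<in> (\<lambda>J. J \<inter> carrier ?A) ` prime_poisson_ideals ?S witt_pb"
        using S carrier by blast
    qed
  qed
  have cnt: "countable (UNIV :: int set)" by simp
  have "bij_betw Inter {Z. irreducible_closedin (zariski ?S witt_pb) Z} (prime_poisson_ideals ?S witt_pb)"
    unfolding S_W_def
  proof (rule poisson_ring.bij_betw_irreducible_prime(1))
    show "poisson_ring (sym_ring UNIV) witt_pb" using poisson_ring_S_W unfolding S_W_def .
    show "primeideal P (sym_ring UNIV)" if "poisson_primitive (sym_ring (UNIV :: 'k witt set)) witt_pb P" for P
      by (rule poisson_primitive_prime[OF lie_bracket_witt _ that]) simp
    show "\<exists>P\<in>pspec_prim (sym_ring UNIV) witt_pb. J \<subseteq> P \<and> a \<notin> P"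
      if "J \<in> prime_poisson_ideals (sym_ring (UNIV :: 'k witt set)) witt_pb"
        "a \<in> carrier (sym_ring UNIV)" "a \<notin> J" for J a
      by (rule poisson_primitive_separation[OF lie_bracket_witt _ assms cnt that]) simp
  qed
  moreover have "bij_betw (pvariety ?A witt_pb) (prime_poisson_ideals ?A witt_pb)
      {Z. irreducible_closedin (zariski ?A witt_pb) Z}"
    unfolding S_W_ge_def
  proof (rule poisson_ring.bij_betw_irreducible_prime(2))
    show "poisson_ring (sym_ring W_ge) witt_pb" using poisson_ring_S_W_ge unfolding S_W_ge_def .
    show "primeideal P (sym_ring W_ge)" if "poisson_primitive (sym_ring (W_ge :: 'k witt set)) witt_pb P" for P
      by (rule poisson_primitive_prime[OF lie_bracket_witt witt_bracket_W_ge that])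
    show "\<exists>P\<in>pspec_prim (sym_ring W_ge) witt_pb. J \<subseteq> P \<and> a \<notin> P"
      if "J \<in> prime_poisson_ideals (sym_ring (W_ge :: 'k witt set)) witt_pb"
        "a \<in> carrier (sym_ring W_ge)" "a \<notin> J" for J a
      by (rule poisson_primitive_separation[OF lie_bracket_witt witt_bracket_W_ge assms cnt that])
  qed
  ultimately have "bij_betw (pvariety ?A witt_pb \<circ> ((\<lambda>J. J \<inter> carrier ?A) \<circ> Inter))
      {Z. irreducible_closedin (zariski ?S witt_pb) Z} {Z. irreducible_closedin (zariski ?A witt_pb) Z}"
    using restriction by (intro bij_betw_trans)
  thus ?thesis using restriction by (simp add: o_def)
qed

end
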